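(* Every caterpillar is antimagic. Furthermore, there exists an algorithm that, given a caterpillar $C$ of order $n$, produces an antimagic labeling of $C$ in time $O(n \log n)$.
   Context: All graphs are finite, undirected, connected and simple. For a graph $G$ with $m$ edges, an antimagic labeling is a bijection $\phi: E(G)\to\{1,2,\dots,m\}$ such that the vertex sums $s(u)=\sum_{e\in E_G(u)}\phi(e)$, where $E_G(u)$ is the set of edges incident to $u$, are pairwise distinct over all vertices $u\in V(G)$. A graph is antimagic if it admits an antimagic labeling. A caterpillar is a tree of order at least $3$ such that removing all its leaves yields a path. *)

theory Defs
  imports Complex_Main "HOL-Library.Landau_Symbols"
begin

text \<open>Finite simple graphs are given by a vertex set and a set of two-element edges.\<close>

definition simple_graph :: "'a set \<Rightarrow> 'a set set \<Rightarrow> bool" where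
  "simple_graph V E \<longleftrightarrow> finite V \<and> (\<forall>e\<in>E. e \<subseteq> V \<and> card e = 2)"

definition incident_edges :: "'a set set \<Rightarrow> 'a \<Rightarrow> 'a set set" where
  "incident_edges E u = {e \<in> E. u \<in> e}"

definition connected_graph :: "'a set \<Rightarrow> 'a set set \<Rightarrow> bool" where
  "connected_graph V E \<longleftrightarrow> V \<noteq> {} \<and> (\<forall>u\<in>V. \<forall>v\<in>V. (u, v) \<in> {(x, y). {x, y} \<in> E}\<^sup>*)"

definition graph_cycle :: "'a set set \<Rightarrow> 'a list \<Rightarrow> bool" where
  "graph_cycle E p \<longleftrightarrow> length p \<ge> 3 \<and> distinct p \<and>
     (\<forall>i. Suc i < length p \<longrightarrow> {p ! i, p ! Suc i} \<in> E) \<and> {last p, hd p} \<in> E"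

definition graph_tree :: "'a set \<Rightarrow> 'a set set \<Rightarrow> bool" where
  "graph_tree V E \<longleftrightarrow> simple_graph V E \<and> connected_graph V E \<and> (\<nexists>p. graph_cycle E p)"

definition leaves :: "'a set \<Rightarrow> 'a set set \<Rightarrow> 'a set" where
  "leaves V E = {v \<in> V. card (incident_edges E v) = 1}"

definition induced_edges :: "'a set set \<Rightarrow> 'a set \<Rightarrow> 'a set set" where
  "induced_edges E U = {e \<in> E. e \<subseteq> U}"

text \<open>A path may consist of a single vertex, so that stars are caterpillars.\<close>

definition path_graph :: "'a set \<Rightarrow> 'a set set \<Rightarrow> bool" where
  "path_graph V E \<longleftrightarrow> (\<exists>p. p \<noteq> [] \<and> distinct p \<and> V = set p \<and>
     E = {{p ! i, p ! Suc i} | i. Suc i < length p})"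

definition caterpillar :: "'a set \<Rightarrow> 'a set set \<Rightarrow> bool" where
  "caterpillar V E \<longleftrightarrow> graph_tree V E \<and> card V \<ge> 3 \<and>
     path_graph (V - leaves V E) (induced_edges E (V - leaves V E))"

definition vertex_sum :: "'a set set \<Rightarrow> ('a set \<Rightarrow> nat) \<Rightarrow> 'a \<Rightarrow> nat" where
  "vertex_sum E \<phi> u = (\<Sum>e\<in>incident_edges E u. \<phi> e)"

definition antimagic_labeling :: "'a set \<Rightarrow> 'a set set \<Rightarrow> ('a set \<Rightarrow> nat) \<Rightarrow> bool" where
  "antimagic_labeling V E \<phi> \<longleftrightarrow>
     bij_betw \<phi> E {1..card E} \<and> inj_on (vertex_sum E \<phi>) V"

definition antimagic :: "'a set \<Rightarrow> 'a set set \<Rightarrow> bool" where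
  "antimagic V E \<longleftrightarrow> (\<exists>\<phi>. antimagic_labeling V E \<phi>)"


text \<open>
  Algorithms are programs of a structured random access machine (word RAM). A program mentions
  finitely many scalar variables and arrays, all holding natural numbers; every operation,
  including an array access at a computed index, has unit cost.
\<close>

type_synonym name = string

record ram_state =
  var :: "name \<Rightarrow> nat"
  arr :: "name \<Rightarrow> nat \<Rightarrow> nat"

datatype aexp =
    Const nat
  | Var name
  | Read name aexp
  | Plus aexp aexp
  | Minus aexp aexp
  | Times aexp aexp
  | Div aexp aexp
  | Mod aexp aexp

datatype bexp =
    Less aexp aexp
  | Equal aexp aexp
  | Not bexp
  | And bexp bexp

datatype com =
    Skip
  | Assign name aexp
  | Write name aexp aexp
  | Seq com com
  | If bexp com com
  | While bexp com

fun aval :: "aexp \<Rightarrow> ram_state \<Rightarrow> nat" where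
  "aval (Const k) s = k"
| "aval (Var x) s = var s x"
| "aval (Read a e) s = arr s a (aval e s)"
| "aval (Plus e f) s = aval e s + aval f s"
| "aval (Minus e f) s = aval e s - aval f s"
| "aval (Times e f) s = aval e s * aval f s"
| "aval (Div e f) s = aval e s div aval f s"
| "aval (Mod e f) s = aval e s mod aval f s"

fun bval :: "bexp \<Rightarrow> ram_state \<Rightarrow> bool" where
  "bval (Less e f) s \<longleftrightarrow> aval e s < aval f s"
| "bval (Equal e f) s \<longleftrightarrow> aval e s = aval f s"
| "bval (Not b) s \<longleftrightarrow> \<not> bval b s"
| "bval (And b c) s \<longleftrightarrow> bval b s \<and> bval c s"

fun acost :: "aexp \<Rightarrow> nat" where
  "acost (Const k) = 1"
| "acost (Var x) = 1"
| "acost (Read a e) = 1 + acost e"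
| "acost (Plus e f) = 1 + acost e + acost f"
| "acost (Minus e f) = 1 + acost e + acost f"
| "acost (Times e f) = 1 + acost e + acost f"
| "acost (Div e f) = 1 + acost e + acost f"
| "acost (Mod e f) = 1 + acost e + acost f"

fun bcost :: "bexp \<Rightarrow> nat" where
  "bcost (Less e f) = 1 + acost e + acost f"
| "bcost (Equal e f) = 1 + acost e + acost f"
| "bcost (Not b) = 1 + bcost b"
| "bcost (And b c) = 1 + bcost b + bcost c"

text \<open>
  \<open>exec W c s t s'\<close>: started in \<open>s\<close>, the program \<open>c\<close> terminates in \<open>s'\<close> after exactly \<open>t\<close> steps.
  A memory cell can only hold values below \<open>W\<close>; an overflowing assignment gets stuck, so that no
  derivation exists. Intermediate values of an expression are at most polynomial in \<open>W\<close>, with an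
  exponent depending on the program only. Hence if \<open>W\<close> is polynomial in the input size, all
  operations act on words of logarithmic length and unit cost is justified.
\<close>

inductive exec :: "nat \<Rightarrow> com \<Rightarrow> ram_state \<Rightarrow> nat \<Rightarrow> ram_state \<Rightarrow> bool" for W :: nat where
  exec_Skip:
    "exec W Skip s 1 s"
| exec_Assign:
    "aval e s < W \<Longrightarrow>
     exec W (Assign x e) s (1 + acost e) (s\<lparr>var := (var s)(x := aval e s)\<rparr>)"
| exec_Write:
    "aval e s < W \<Longrightarrow>
     exec W (Write a i e) s (1 + acost i + acost e)
       (s\<lparr>arr := (arr s)(a := (arr s a)(aval i s := aval e s))\<rparr>)"
| exec_Seq:
    "exec W c s t s' \<Longrightarrow> exec W d s' t' s'' \<Longrightarrow> exec W (Seq c d) s (t + t') s''"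
| exec_If_True:
    "bval b s \<Longrightarrow> exec W c s t s' \<Longrightarrow> exec W (If b c d) s (1 + bcost b + t) s'"
| exec_If_False:
    "\<not> bval b s \<Longrightarrow> exec W d s t s' \<Longrightarrow> exec W (If b c d) s (1 + bcost b + t) s'"
| exec_While_False:
    "\<not> bval b s \<Longrightarrow> exec W (While b c) s (1 + bcost b) s"
| exec_While_True:
    "bval b s \<Longrightarrow> exec W c s t s' \<Longrightarrow> exec W (While b c) s' t' s'' \<Longrightarrow>
     exec W (While b c) s (1 + bcost b + t + t') s''"

inductive_cases exec_SkipE: "exec W Skip s t s'"
inductive_cases exec_AssignE: "exec W (Assign x e) s t s'"
inductive_cases exec_WriteE: "exec W (Write a i e) s t s'"
inductive_cases exec_SeqE: "exec W (Seq c d) s t s'"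
inductive_cases exec_IfE: "exec W (If b c d) s t s'"
inductive_cases exec_WhileE: "exec W (While b c) s t s'"

lemma exec_deterministic:
  "exec W c s t s' \<Longrightarrow> exec W c s u s'' \<Longrightarrow> u = t \<and> s'' = s'"
proof (induction arbitrary: u s'' rule: exec.induct)
  case exec_Skip
  then show ?case by (auto elim: exec_SkipE)
next
  case exec_Assign
  from exec_Assign.prems show ?case by (rule exec_AssignE) simp
next
  case exec_Write
  from exec_Write.prems show ?case by (rule exec_WriteE) simp
next
  case exec_Seq
  from exec_Seq.prems show ?case by (rule exec_SeqE) (use exec_Seq.IH in metis)
next
  case exec_If_True
  from exec_If_True.prems show ?case
    by (rule exec_IfE) (use exec_If_True.IH exec_If_True.hyps(1) in fastforce)+
next
  case exec_If_False
  from exec_If_False.prems show ?case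
    by (rule exec_IfE) (use exec_If_False.IH exec_If_False.hyps(1) in fastforce)+
next
  case exec_While_False
  from exec_While_False.prems show ?case
    by (rule exec_WhileE) (use exec_While_False.hyps(1) in fastforce)+
next
  case exec_While_True
  from exec_While_True.prems show ?case
    by (rule exec_WhileE) (use exec_While_True.IH exec_While_True.hyps(1) in fastforce)+
qed

text \<open>
  A graph on the vertices \<open>0, \<dots>, n - 1\<close> is presented to a program as a list of its edges, in
  arbitrary order and with arbitrarily ordered end points: \<open>U[i]\<close> and \<open>V[i]\<close> are the ends of the
  \<open>i\<close>-th edge. All memory cells that do not belong to the input are initially 0.
\<close>

definition edge :: "'a \<times> 'a \<Rightarrow> 'a set" where
  "edge p = {fst p, snd p}"

definition edge_list :: "'a set set \<Rightarrow> ('a \<times> 'a) list \<Rightarrow> bool" where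
  "edge_list E es \<longleftrightarrow> distinct (map edge es) \<and> set (map edge es) = E"

definition input_state :: "nat \<Rightarrow> (nat \<times> nat) list \<Rightarrow> ram_state" where
  "input_state n es =
    \<lparr>var = (\<lambda>_. 0)(''n'' := n, ''m'' := length es),
     arr = (\<lambda>_ _. 0)(''U'' := (\<lambda>i. if i < length es then fst (es ! i) else 0),
                     ''V'' := (\<lambda>i. if i < length es then snd (es ! i) else 0))\<rparr>"

text \<open>The output is read off the array \<open>L\<close>: \<open>L[i]\<close> is the label of the \<open>i\<close>-th edge.\<close>

definition outputs_labeling :: "(nat \<times> nat) list \<Rightarrow> ram_state \<Rightarrow> (nat set \<Rightarrow> nat) \<Rightarrow> bool" where
  "outputs_labeling es s \<phi> \<longleftrightarrow> (\<forall>i < length es. \<phi> (edge (es ! i)) = arr s ''L'' i)"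

end

theory Submission
  imports Defs
begin

text \<open>
  Let the spine be \<open>X\<^sub>0, \<dots>, X\<^sub>r\<^sub>-\<^sub>1\<close> and extend it by a pendant edge at either end to a path with edges
  \<open>e\<^sub>0, \<dots>, e\<^sub>r\<close>; the remaining edges are the legs. Counting back from \<open>e\<^sub>r\<close>, call every second edge
  low, starting with \<open>e\<^sub>r\<close>, and the others high. The high edges get the largest labels, increasing
  along the path; the low edges and the legs share the labels \<open>1, \<dots>, b\<close>, again with the low edges
  increasing along the path. Then the path sums \<open>s\<^sub>k\<close>, contributed to \<open>X\<^sub>k\<close> by \<open>e\<^sub>k\<close> and \<open>e\<^sub>k\<^sub>+\<^sub>1\<close>, increase
  strictly, and all exceed every leaf sum.

  The danger is a vertex with a single leg whose total equals the path sum of a vertex of degree 2.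
  If \<open>s\<^sub>k \<le> m\<close>, then \<open>s\<^sub>k\<close> is the label of a later high edge \<open>e\<^sub>t\<close>; the leg of \<open>X\<^sub>k\<close> gets a label \<open>y\<close>
  strictly between those of the low edges \<open>e\<^sub>t\<^sub>-\<^sub>1\<close> and \<open>e\<^sub>t\<^sub>+\<^sub>1\<close>, so the total \<open>s\<^sub>k + y\<close> lies strictly
  between the consecutive path sums \<open>s\<^sub>t\<^sub>-\<^sub>1\<close> and \<open>s\<^sub>t\<close>. Since distinct \<open>k\<close> give distinct \<open>t\<close>, these
  totals are distinct. All other legs get labels above those of all low edges, which lifts their
  vertices above every path sum; keeping one leg back at each such vertex and distributing the
  last labels in the order of the partial sums makes these totals distinct as well.

  The labeling is computed by one sweep along the path, and the partial sums, which are below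
  \<open>n\<^sup>2\<close>, are sorted by two passes of counting sort. An arbitrary caterpillar is antimagic since it
  is isomorphic to one on \<open>{..<n}\<close>.
\<close>

section \<open>Running straight-line programs and loops\<close>

text \<open>Consecutive path sums share an edge: s_(k+1) - s_k is the difference of the labels of
  e_(k+2) and e_k, which lie in the same class. This is why both classes increase along the path.
  Each path sum has exactly one high summand. With e_r low, the only high edge that can reach a leaf
  is e_0, and it carries the smallest high label; hence path sums exceed leaf sums. A path sum s_k
  \<le> m falls into the block of the high labels, so it is the label of some e_t. It exceeds its
  own high summand, so t > k + 1: the sweep knows s_k before it reaches e_t. Giving the leg of X_k
  the next small label right after e_t has been labelled puts it between e_(t-1) and e_(t+1). For
  the lifted vertices the threshold is m + c0, where c0 is the first small label that the sweep
  leaves free: the last path sum is the largest, and it is at most m + (c0 - 1). A single leg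
  labelled c0 or more suffices if s_k > m. If there are two such legs, s_k > m - nhigh suffices,
  because c0 exceeds the number nhigh of high edges.\<close>

fun work :: "com \<Rightarrow> nat" where
  "work Skip = 1"
| "work (Assign x e) = 1 + acost e"
| "work (Write a i e) = 1 + acost i + acost e"
| "work (Seq c d) = work c + work d"
| "work (If b c d) = 1 + bcost b + work c + work d"
| "work (While b c) = 1 + bcost b + work c"

text \<open>All loops of the program are unnested, so a run in which every loop makes at most \<open>N\<close>
  iterations takes at most \<open>work c * Suc N\<close> steps.\<close>

definition runs :: "nat \<Rightarrow> nat \<Rightarrow> com \<Rightarrow> ram_state \<Rightarrow> ram_state \<Rightarrow> bool" where
  "runs W N c s s' \<longleftrightarrow> (\<exists>t. exec W c s t s' \<and> t \<le> work c * Suc N)"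

fun sem :: "com \<Rightarrow> ram_state \<Rightarrow> ram_state" where
  "sem Skip s = s"
| "sem (Assign x e) s = s\<lparr>var := (var s)(x := aval e s)\<rparr>"
| "sem (Write a i e) s = s\<lparr>arr := (arr s)(a := (arr s a)(aval i s := aval e s))\<rparr>"
| "sem (Seq c d) s = sem d (sem c s)"
| "sem (If b c d) s = (if bval b s then sem c s else sem d s)"
| "sem (While b c) s = s"

text \<open>Excluding loops here makes the dummy value of \<open>sem\<close> at \<open>While\<close>
  harmless.\<close>

fun safe :: "nat \<Rightarrow> com \<Rightarrow> ram_state \<Rightarrow> bool" where
  "safe W Skip s \<longleftrightarrow> True"
| "safe W (Assign x e) s \<longleftrightarrow> aval e s < W"
| "safe W (Write a i e) s \<longleftrightarrow> aval e s < W"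
| "safe W (Seq c d) s \<longleftrightarrow> safe W c s \<and> safe W d (sem c s)"
| "safe W (If b c d) s \<longleftrightarrow> (if bval b s then safe W c s else safe W d s)"
| "safe W (While b c) s \<longleftrightarrow> False"

lemma runs_safe: "safe W c s \<Longrightarrow> runs W 0 c s (sem c s)"
proof (induction c arbitrary: s)
  case Skip
  then show ?case by (auto simp: runs_def intro!: exI[of _ 1] exec.intros)
next
  case (Assign x e)
  then show ?case using exec_Assign[of e s W x] by (auto simp: runs_def)
next
  case (Write a i e)
  then show ?case using exec_Write[of e s W a i] by (auto simp: runs_def)
next
  case (Seq c d)
  then obtain t t' where "exec W c s t (sem c s)" "t \<le> work c"
      "exec W d (sem c s) t' (sem d (sem c s))" "t' \<le> work d"
    by (force simp: runs_def)
  then have "exec W (Seq c d) s (t + t') (sem (Seq c d) s)" "t + t' \<le> work (Seq c d)"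
    using exec_Seq by auto
  then show ?case by (auto simp: runs_def)
next
  case (If b c d)
  show ?case
  proof (cases "bval b s")
    case True
    with If obtain t where "exec W c s t (sem c s)" "t \<le> work c" by (force simp: runs_def)
    with exec_If_True[OF True this(1), of d] True show ?thesis
      by (auto simp: runs_def intro!: exI[of _ "Suc (bcost b + t)"])
  next
    case False
    with If obtain t where "exec W d s t (sem d s)" "t \<le> work d" by (force simp: runs_def)
    with exec_If_False[OF False this(1), of c] False show ?thesis
      by (auto simp: runs_def intro!: exI[of _ "Suc (bcost b + t)"])
  qed
qed simp

lemma runs_mono: "runs W N c s s' \<Longrightarrow> N \<le> M \<Longrightarrow> runs W M c s s'"
  unfolding runs_def by (meson Suc_le_mono le_trans mult_le_mono2)

lemma runs_straight:
  assumes "safe W c s"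
  shows "runs W N c s (sem c s)"
  using runs_mono[OF runs_safe[OF assms]] by simp

lemma runs_Seq:
  assumes "runs W N c s s'" "runs W N d s' s''"
  shows "runs W N (Seq c d) s s''"
proof -
  from assms obtain t t' where "exec W c s t s'" "t \<le> work c * Suc N"
      "exec W d s' t' s''" "t' \<le> work d * Suc N"
    unfolding runs_def by blast
  then have "exec W (Seq c d) s (t + t') s''" "t + t' \<le> work (Seq c d) * Suc N"
    by (blast intro: exec_Seq) (use \<open>t \<le> _\<close> \<open>t' \<le> _\<close> in \<open>simp add: algebra_simps\<close>)
  then show ?thesis unfolding runs_def by blast
qed

text \<open>The induction runs over the number \<open>d\<close> of iterations left. The factor
  \<open>Suc d\<close> instead of \<open>d\<close> pays for the last, failing test of the
  guard.\<close>

lemma exec_While_iterations: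
  assumes body: "\<And>k s. k < K \<Longrightarrow> I k s \<Longrightarrow> bval b s \<and> safe W c s \<and> I (Suc k) (sem c s)"
    and exit: "\<And>s. I K s \<Longrightarrow> \<not> bval b s"
  shows "I k s \<Longrightarrow> d = K - k \<Longrightarrow> k \<le> K \<Longrightarrow>
    \<exists>t s'. exec W (While b c) s t s' \<and> t \<le> (1 + bcost b + work c) * Suc d \<and> I K s'"
proof (induction d arbitrary: k s)
  case 0
  then have "I K s" by simp
  from exec_While_False[OF exit[OF this], of W c] this show ?case
    by (intro exI[of _ "1 + bcost b"] exI[of _ s]) auto
next
  case (Suc d)
  then have k: "k < K" by simp
  from body[OF k Suc.prems(1)] have b: "bval b s" "safe W c s" and I: "I (Suc k) (sem c s)"
    by auto
  from runs_safe[OF b(2)] obtain t where t: "exec W c s t (sem c s)" "t \<le> work c"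
    by (auto simp: runs_def)
  from Suc.IH[OF I] Suc.prems k obtain t' s' where
    t': "exec W (While b c) (sem c s) t' s'" "t' \<le> (1 + bcost b + work c) * Suc d" "I K s'"
    by fastforce
  from exec_While_True[OF b(1) t(1) t'(1)] t(2) t'(2,3) show ?case
    by (intro exI[of _ "1 + bcost b + t + t'"] exI[of _ s']) auto
qed

lemma runs_While:
  assumes "I 0 s"
    and "\<And>k s. k < K \<Longrightarrow> I k s \<Longrightarrow> bval b s \<and> safe W c s \<and> I (Suc k) (sem c s)"
    and "\<And>s. I K s \<Longrightarrow> \<not> bval b s" and "K \<le> N"
  shows "\<exists>s'. runs W N (While b c) s s' \<and> I K s'"
proof -
  from exec_While_iterations[of K I b W c, OF assms(2,3) assms(1)]
  obtain t s' where t: "exec W (While b c) s t s'" "t \<le> (1 + bcost b + work c) * Suc K" "I K s'"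
    by auto
  have "t \<le> work (While b c) * Suc N"
    using t(2) assms(4) by (metis Suc_le_mono le_trans mult_le_mono2 work.simps(6))
  with t show ?thesis unfolding runs_def by blast
qed

definition agree_off :: "'a set \<Rightarrow> ('a \<Rightarrow> 'b) \<Rightarrow> ('a \<Rightarrow> 'b) \<Rightarrow> bool" where
  "agree_off S f g \<longleftrightarrow> (\<forall>x. x \<notin> S \<longrightarrow> g x = f x)"

text \<open>Frame condition of a program phase: an invariant then has to describe only what the
  phase writes, and everything else carries over from the start state.\<close>

definition agree :: "name set \<Rightarrow> name set \<Rightarrow> ram_state \<Rightarrow> ram_state \<Rightarrow> bool" where
  "agree vs as s s' \<longleftrightarrow> agree_off vs (var s) (var s') \<and> agree_off as (arr s) (arr s')"

lemma agree_off_upd [simp]: "x \<in> S \<Longrightarrow> agree_off S f (g(x := e)) = agree_off S f g"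
  by (auto simp: agree_off_def)

lemma agree_off_refl [simp]: "agree_off S f f"
  by (simp add: agree_off_def)

lemma agree_var: "agree vs as s s' \<Longrightarrow> x \<notin> vs \<Longrightarrow> var s' x = var s x"
  by (simp add: agree_def agree_off_def)

lemma agree_arr: "agree vs as s s' \<Longrightarrow> a \<notin> as \<Longrightarrow> arr s' a = arr s a"
  by (simp add: agree_def agree_off_def)

lemma agree_mono_trans:
  "agree vs as s s' \<Longrightarrow> agree vs' as' s' s'' \<Longrightarrow> vs \<subseteq> ws \<Longrightarrow> vs' \<subseteq> ws \<Longrightarrow> as \<subseteq> bs \<Longrightarrow> as' \<subseteq> bs \<Longrightarrow>
    agree ws bs s s''"
  unfolding agree_def agree_off_def subset_iff by metis

definition for_loop :: "name \<Rightarrow> aexp \<Rightarrow> com \<Rightarrow> com" where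
  "for_loop x e c = Seq (Assign x (Const 0)) (While (Less (Var x) e) (Seq c (Assign x (Plus (Var x) (Const 1)))))"

text \<open>The increment of the counter is absorbed here: the body only has to preserve
  \<open>x\<close>. The bound \<open>K < W\<close> is strict because the counter itself reaches
  \<open>K\<close>.\<close>

lemma runs_for_loop:
  assumes "I 0 (s\<lparr>var := (var s)(x := 0)\<rparr>)"
    and body: "\<And>k s. k < K \<Longrightarrow> I k s \<Longrightarrow> var s x = k \<Longrightarrow>
          safe W c s \<and> var (sem c s) x = k \<and> I (Suc k) ((sem c s)\<lparr>var := (var (sem c s))(x := Suc k)\<rparr>)"
    and bound: "\<And>k s. k \<le> K \<Longrightarrow> I k s \<Longrightarrow> aval e s = K" and "K \<le> N" "K < W"
  shows "\<exists>s'. runs W N (for_loop x e c) s s' \<and> I K s' \<and> var s' x = K"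
proof -
  let ?s = "s\<lparr>var := (var s)(x := 0)\<rparr>"
  have a: "runs W N (Assign x (Const 0)) s ?s"
    using runs_straight[of W "Assign x (Const 0)" s N] assms(5) by simp
  let ?J = "\<lambda>k s. I k s \<and> var s x = k"
  have "\<exists>s'. runs W N (While (Less (Var x) e) (Seq c (Assign x (Plus (Var x) (Const 1))))) ?s s' \<and> ?J K s'"
  proof (rule runs_While)
    show "?J 0 ?s" using assms(1) by simp
    fix k t assume k: "k < K" and J: "?J k t"
    from body[OF k conjunct1[OF J] conjunct2[OF J]] bound[of k t] k J \<open>K < W\<close>
    show "bval (Less (Var x) e) t \<and> safe W (Seq c (Assign x (Plus (Var x) (Const 1)))) t \<and>
      ?J (Suc k) (sem (Seq c (Assign x (Plus (Var x) (Const 1)))) t)"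
      by simp
  next
    fix t assume "?J K t"
    then show "\<not> bval (Less (Var x) e) t" using bound[of K t] by simp
  qed fact
  then obtain s' where "runs W N (While (Less (Var x) e) (Seq c (Assign x (Plus (Var x) (Const 1))))) ?s s'" "?J K s'"
    by blast
  with runs_Seq[OF a] show ?thesis unfolding for_loop_def by blast
qed

section \<open>Counting sort\<close>

text \<open>The slot of index \<open>i\<close> in the stable sort of \<open>{..<q}\<close> by
  \<kappa>: ties are broken by the index.\<close>

definition lex_pos :: "(nat \<Rightarrow> nat) \<Rightarrow> nat \<Rightarrow> nat \<Rightarrow> nat" where
  "lex_pos \<kappa> q i = card {j. j < q \<and> (\<kappa> j < \<kappa> i \<or> \<kappa> j = \<kappa> i \<and> j < i)}"

lemma lex_pos_less:
  assumes "\<kappa> i < \<kappa> i' \<or> \<kappa> i = \<kappa> i' \<and> i < i'" "i < q"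
  shows "lex_pos \<kappa> q i < lex_pos \<kappa> q i'"
proof -
  let ?L = "\<lambda>i. {j. j < q \<and> (\<kappa> j < \<kappa> i \<or> \<kappa> j = \<kappa> i \<and> j < i)}"
  have "?L i \<subseteq> ?L i'" using assms(1) by fastforce
  moreover have "i \<in> ?L i'" "i \<notin> ?L i" using assms by auto
  ultimately have "?L i \<subset> ?L i'" by blast
  from psubset_card_mono[OF _ this] show ?thesis by (simp add: lex_pos_def)
qed

lemma lex_pos_bound: "i < q \<Longrightarrow> lex_pos \<kappa> q i < q"
proof -
  assume "i < q"
  then have "{j. j < q \<and> (\<kappa> j < \<kappa> i \<or> \<kappa> j = \<kappa> i \<and> j < i)} \<subset> {..<q}" by auto
  from psubset_card_mono[OF _ this] show ?thesis by (simp add: lex_pos_def)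
qed

lemma inj_on_lex_pos: "inj_on (lex_pos \<kappa> q) {..<q}"
proof (rule inj_onI)
  fix i j assume *: "i \<in> {..<q}" "j \<in> {..<q}" "lex_pos \<kappa> q i = lex_pos \<kappa> q j"
  then show "i = j"
    using lex_pos_less[of \<kappa> i j q] lex_pos_less[of \<kappa> j i q] by (metis lessThan_iff less_irrefl nat_neq_iff)
qed

lemma bij_betw_lex_pos: "bij_betw (lex_pos \<kappa> q) {..<q} {..<q}"
  using inj_on_lex_pos lex_pos_bound
  by (metis (no_types, lifting) bij_betw_def endo_inj_surj finite_lessThan image_subsetI lessThan_iff)

text \<open>The form in which counting sort computes the slot: the first sum comes from the prefix
  sums, the second counts the equal keys placed before \<open>i\<close>.\<close>

lemma lex_pos_split:
  "lex_pos \<kappa> q i = (\<Sum>j<q. if \<kappa> j < \<kappa> i then 1 else 0) + (\<Sum>j<i. if \<kappa> j = \<kappa> i then 1 else 0)"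
  if "i < q"
proof -
  let ?A = "{j\<in>{..<q}. \<kappa> j < \<kappa> i}" and ?B = "{j\<in>{..<i}. \<kappa> j = \<kappa> i}"
  have "lex_pos \<kappa> q i = card (?A \<union> ?B)"
    unfolding lex_pos_def by (rule arg_cong[where f = card]) (use that in auto)
  also have "\<dots> = card ?A + card ?B"
    by (rule card_Un_disjoint) auto
  also have "card ?A = (\<Sum>j<q. if \<kappa> j < \<kappa> i then 1 else 0)"
    by (simp add: sum.inter_filter[symmetric])
  also have "card ?B = (\<Sum>j<i. if \<kappa> j = \<kappa> i then 1 else 0)"
    by (simp add: sum.inter_filter[symmetric])
  finally show ?thesis .
qed

text \<open>\<open>A\<close> holds the items, \<open>B\<close> receives the sorted copy, and
  \<open>C\<close> counts. The expression \<open>key\<close> is evaluated on the item stored in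
  \<open>''x''\<close>; keys lie below \<open>n\<close>, hence the range of the middle loop.\<close>

definition counting_sort :: "name \<Rightarrow> name \<Rightarrow> name \<Rightarrow> aexp \<Rightarrow> com" where
  "counting_sort A B C key =
    Seq (for_loop ''i'' (Var ''q'')
          (Seq (Assign ''x'' (Read A (Var ''i'')))
               (Write C key (Plus (Read C key) (Const 1)))))
    (Seq (Assign ''a'' (Const 0))
    (Seq (for_loop ''i'' (Var ''n'')
          (Seq (Assign ''x'' (Read C (Var ''i'')))
          (Seq (Write C (Var ''i'') (Var ''a''))
               (Assign ''a'' (Plus (Var ''a'') (Var ''x''))))))
         (for_loop ''i'' (Var ''q'')
          (Seq (Assign ''x'' (Read A (Var ''i'')))
          (Seq (Write B (Read C key) (Var ''x''))
               (Write C key (Plus (Read C key) (Const 1))))))))"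

text \<open>The last disjunct is stability. It allows two passes to be composed into a sort by
  two-digit keys.\<close>

lemma runs_counting_sort:
  assumes dist: "A \<noteq> B" "A \<noteq> C" "B \<noteq> C"
    and key: "\<And>s'. agree {''i'', ''x'', ''a''} {B, C} s s' \<Longrightarrow> aval key s' = k (var s' ''x'')"
    and kn: "\<And>i. i < q \<Longrightarrow> k (arr s A i) < n"
    and q: "var s ''q'' = q" "q \<le> N" "q < W" and n: "var s ''n'' = n" "n \<le> N" "n < W"
    and AW: "\<And>i. i < q \<Longrightarrow> arr s A i < W"
    and C0: "\<And>v. arr s C v = 0"
  shows "\<exists>s'. runs W N (counting_sort A B C key) s s' \<and> agree {''i'', ''x'', ''a''} {B, C} s s' \<and>
     (\<exists>\<pi>. bij_betw \<pi> {..<q} {..<q} \<and> (\<forall>t<q. arr s' B t = arr s A (\<pi> t)) \<and>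
       (\<forall>t t'. t < t' \<and> t' < q \<longrightarrow> k (arr s A (\<pi> t)) < k (arr s A (\<pi> t')) \<or>
          k (arr s A (\<pi> t)) = k (arr s A (\<pi> t')) \<and> \<pi> t < \<pi> t'))"
proof -
  define \<kappa> where "\<kappa> i = k (arr s A i)" for i
  let ?ag = "agree {''i'', ''x'', ''a''} {B, C} s"
  let ?n1 = "\<lambda>P i. \<Sum>j<i. if P j then 1 else (0::nat)"
  have cb: "?n1 P i \<le> i" for P i
    by (induction i) auto
  let ?c1 = "Seq (Assign ''x'' (Read A (Var ''i''))) (Write C key (Plus (Read C key) (Const 1)))"
  define I1 where "I1 = (\<lambda>i s'. ?ag s' \<and> arr s' C = (\<lambda>v. ?n1 (\<lambda>j. \<kappa> j = v) i))"
  have "\<exists>s'. runs W N (for_loop ''i'' (Var ''q'') ?c1) s s' \<and> I1 q s' \<and> var s' ''i'' = q"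
  proof (rule runs_for_loop, goal_cases)
    show "I1 0 (s\<lparr>var := (var s)(''i'' := 0)\<rparr>)" using C0 by (simp add: I1_def agree_def fun_eq_iff)
  next
    case (2 i t)
    then have i: "i < q" and I: "I1 i t" and vi: "var t ''i'' = i" by auto
    let ?t = "t\<lparr>var := (var t)(''x'' := arr s A i)\<rparr>"
    from I have ag: "?ag t" and C: "arr t C = (\<lambda>v. ?n1 (\<lambda>j. \<kappa> j = v) i)" by (auto simp: I1_def)
    then have agt: "?ag ?t" by (simp add: agree_def)
    have A: "arr t A = arr s A" by (rule agree_arr[OF ag]) (use dist in auto)
    from key[OF agt] have k: "aval key ?t = \<kappa> i" by (simp add: \<kappa>_def)
    have le: "arr t C (\<kappa> i) < W - 1" using C cb[of "\<lambda>j. \<kappa> j = \<kappa> i" i] i q(3) by simp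
    have upd: "(arr t C)(\<kappa> i := Suc (arr t C (\<kappa> i))) = (\<lambda>v. ?n1 (\<lambda>j. \<kappa> j = v) (Suc i))"
      unfolding C by (simp add: fun_eq_iff)
    have sem: "sem ?c1 t = ?t\<lparr>arr := (arr t)(C := (arr t C)(\<kappa> i := Suc (arr t C (\<kappa> i))))\<rparr>"
      using k by (simp add: vi A)
    have "safe W ?c1 t" using AW[OF i] le k by (simp add: vi A)
    moreover have "?ag (?t\<lparr>arr := (arr t)(C := f)\<rparr>)" for f
      using agt by (simp add: agree_def)
    ultimately show ?case
      unfolding sem upd by (simp add: vi I1_def agree_def)
  next
    fix i t assume "I1 i t"
    then have "?ag t" by (simp add: I1_def)
    from agree_var[OF this, of "''q''"] q(1) show "aval (Var ''q'') t = q" by simp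
  qed (use q in auto)
  then obtain s1 where r1: "runs W N (for_loop ''i'' (Var ''q'') ?c1) s s1" and I1: "I1 q s1" by blast
  let ?s2 = "s1\<lparr>var := (var s1)(''a'' := 0)\<rparr>"
  have r2: "runs W N (Assign ''a'' (Const 0)) s1 ?s2"
    using runs_straight[of W "Assign ''a'' (Const 0)" s1 N] n by simp
  let ?c2 = "Seq (Assign ''x'' (Read C (Var ''i'')))
          (Seq (Write C (Var ''i'') (Var ''a'')) (Assign ''a'' (Plus (Var ''a'') (Var ''x''))))"
  \<comment> \<open>Cells below \<open>i\<close> already hold the first slot of their key, the
    others still its multiplicity.\<close>
  define I2 where "I2 = (\<lambda>i s'. ?ag s' \<and> var s' ''a'' = ?n1 (\<lambda>j. \<kappa> j < i) q \<and>
     arr s' C = (\<lambda>v. if v < i then ?n1 (\<lambda>j. \<kappa> j < v) q else ?n1 (\<lambda>j. \<kappa> j = v) q))"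
  have "\<exists>s'. runs W N (for_loop ''i'' (Var ''n'') ?c2) ?s2 s' \<and> I2 n s' \<and> var s' ''i'' = n"
  proof (rule runs_for_loop, goal_cases)
    show "I2 0 (?s2\<lparr>var := (var ?s2)(''i'' := 0)\<rparr>)" using I1 by (simp add: I1_def I2_def agree_def)
  next
    case (2 i t)
    then have i: "i < n" and I: "I2 i t" and vi: "var t ''i'' = i" by auto
    have *: "?n1 (\<lambda>j. \<kappa> j < i) q + ?n1 (\<lambda>j. \<kappa> j = i) q = ?n1 (\<lambda>j. \<kappa> j < Suc i) q"
      unfolding sum.distrib[symmetric] by (rule sum.cong) auto
    have b: "?n1 P q < W" for P
      using cb[of P q] q(3) by simp
    from I have ag: "?ag t" and a: "var t ''a'' = ?n1 (\<lambda>j. \<kappa> j < i) q"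
      and C: "arr t C = (\<lambda>v. if v < i then ?n1 (\<lambda>j. \<kappa> j < v) q else ?n1 (\<lambda>j. \<kappa> j = v) q)"
      by (auto simp: I2_def)
    have Ci: "arr t C i = ?n1 (\<lambda>j. \<kappa> j = i) q" by (simp add: C)
    have upd: "(arr t C)(i := ?n1 (\<lambda>j. \<kappa> j < i) q) =
      (\<lambda>v. if v < Suc i then ?n1 (\<lambda>j. \<kappa> j < v) q else ?n1 (\<lambda>j. \<kappa> j = v) q)"
      unfolding C by (auto simp: fun_eq_iff less_Suc_eq)
    have sem: "sem ?c2 t = t\<lparr>var := (var t)(''x'' := arr t C i, ''a'' := ?n1 (\<lambda>j. \<kappa> j < Suc i) q),
       arr := (arr t)(C := (arr t C)(i := ?n1 (\<lambda>j. \<kappa> j < i) q))\<rparr>"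
      by (simp add: vi a Ci *)
    have "safe W ?c2 t" using b by (simp add: vi a Ci *)
    then show ?case
      using ag unfolding sem upd by (simp add: vi I2_def agree_def)
  next
    fix i t assume "I2 i t"
    then have "?ag t" by (simp add: I2_def)
    from agree_var[OF this, of "''n''"] n(1) show "aval (Var ''n'') t = n" by simp
  qed (use n in auto)
  then obtain s3 where r3: "runs W N (for_loop ''i'' (Var ''n'') ?c2) ?s2 s3" and I2: "I2 n s3" by blast
  let ?c3 = "Seq (Assign ''x'' (Read A (Var ''i'')))
          (Seq (Write B (Read C key) (Var ''x'')) (Write C key (Plus (Read C key) (Const 1))))"
  \<comment> \<open>The cell of each key has moved past the equal keys already placed, so at time
    \<open>i\<close> the cell of \<open>\<kappa> i\<close> is exactly
    \<open>lex_pos \<kappa> q i\<close>.\<close>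
  define I3 where "I3 = (\<lambda>i s'. ?ag s' \<and> (\<forall>j<i. arr s' B (lex_pos \<kappa> q j) = arr s A j) \<and>
     (\<forall>v<n. arr s' C v = ?n1 (\<lambda>j. \<kappa> j < v) q + ?n1 (\<lambda>j. \<kappa> j = v) i))"
  have "\<exists>s'. runs W N (for_loop ''i'' (Var ''q'') ?c3) s3 s' \<and> I3 q s' \<and> var s' ''i'' = q"
  proof (rule runs_for_loop, goal_cases)
    show "I3 0 (s3\<lparr>var := (var s3)(''i'' := 0)\<rparr>)" using I2 by (simp add: I2_def I3_def agree_def)
  next
    case (2 i t)
    then have i: "i < q" and I: "I3 i t" and vi: "var t ''i'' = i" by auto
    let ?t = "t\<lparr>var := (var t)(''x'' := arr s A i)\<rparr>"
    from I have ag: "?ag t" by (simp add: I3_def)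
    then have agt: "?ag ?t" by (simp add: agree_def)
    have A: "arr t A = arr s A" by (rule agree_arr[OF ag]) (use dist in auto)
    from key[OF agt] have k: "aval key ?t = \<kappa> i" by (simp add: \<kappa>_def)
    have kin: "\<kappa> i < n" using kn i by (simp add: \<kappa>_def)
    then have c: "arr t C (\<kappa> i) = lex_pos \<kappa> q i"
      using I lex_pos_split[OF i] by (simp add: I3_def)
    let ?B = "(arr t B)(lex_pos \<kappa> q i := arr s A i)"
    let ?C = "(arr t C)(\<kappa> i := Suc (lex_pos \<kappa> q i))"
    let ?u = "?t\<lparr>arr := (arr t)(B := ?B)\<rparr>"
    have agu: "?ag ?u" and agv: "?ag (?t\<lparr>arr := (arr t)(B := ?B, C := ?C)\<rparr>)"
      using agt by (simp_all add: agree_def)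
    from key[OF agu] have k': "aval key ?u = \<kappa> i" by (simp add: \<kappa>_def)
    have sem: "sem ?c3 t = ?t\<lparr>arr := (arr t)(B := ?B, C := ?C)\<rparr>"
      using k k' dist by (simp add: vi A c)
    have "safe W ?c3 t" using AW[OF i] lex_pos_bound[OF i, of \<kappa>] k k' dist q(3) by (simp add: vi A c)
    moreover have "\<forall>j<Suc i. ?B (lex_pos \<kappa> q j) = arr s A j"
    proof (intro allI impI)
      fix j assume j: "j < Suc i"
      show "?B (lex_pos \<kappa> q j) = arr s A j"
      proof (cases "j = i")
        case False
        then have "lex_pos \<kappa> q j \<noteq> lex_pos \<kappa> q i"
          using inj_onD[OF inj_on_lex_pos, of \<kappa> q j i] i j by auto
        then show ?thesis using I False j by (simp add: I3_def)
      qed simp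
    qed
    moreover have "\<forall>v<n. ?C v = ?n1 (\<lambda>j. \<kappa> j < v) q + ?n1 (\<lambda>j. \<kappa> j = v) (Suc i)"
      using I lex_pos_split[OF i, of \<kappa>] by (auto simp: I3_def)
    ultimately show ?case
      using agv dist unfolding sem by (simp add: vi I3_def agree_def del: sum.lessThan_Suc)
  next
    fix i t assume "I3 i t"
    then have "?ag t" by (simp add: I3_def)
    from agree_var[OF this, of "''q''"] q(1) show "aval (Var ''q'') t = q" by simp
  qed (use q in auto)
  then obtain s4 where r4: "runs W N (for_loop ''i'' (Var ''q'') ?c3) s3 s4" and I3: "I3 q s4" by blast
  \<comment> \<open>\<pi> reads the sort backwards, from the output slot to the input index.\<close>
  define \<pi> where "\<pi> = the_inv_into {..<q} (lex_pos \<kappa> q)"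
  have b\<pi>: "bij_betw \<pi> {..<q} {..<q}"
    unfolding \<pi>_def by (rule bij_betw_the_inv_into[OF bij_betw_lex_pos])
  have \<pi>: "lex_pos \<kappa> q (\<pi> t) = t" "\<pi> t < q" if "t < q" for t
    using f_the_inv_into_f_bij_betw[OF bij_betw_lex_pos] b\<pi> that
    by (auto simp: \<pi>_def bij_betw_def)
  have ord: "\<kappa> (\<pi> t) < \<kappa> (\<pi> t') \<or> \<kappa> (\<pi> t) = \<kappa> (\<pi> t') \<and> \<pi> t < \<pi> t'" if "t < t'" "t' < q" for t t'
  proof (rule ccontr)
    assume "\<not> ?thesis"
    moreover have "\<pi> t \<noteq> \<pi> t'" using \<pi>(1)[of t] \<pi>(1)[of t'] that by force
    ultimately have "\<kappa> (\<pi> t') < \<kappa> (\<pi> t) \<or> \<kappa> (\<pi> t') = \<kappa> (\<pi> t) \<and> \<pi> t' < \<pi> t" by auto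
    from lex_pos_less[of \<kappa>, OF this, of q] \<pi>[of t] \<pi>[of t'] that show False by simp
  qed
  have "runs W N (counting_sort A B C key) s s4"
    unfolding counting_sort_def by (intro runs_Seq[OF r1] runs_Seq[OF r2] runs_Seq[OF r3] r4)
  moreover have "arr s4 B t = arr s A (\<pi> t)" if "t < q" for t
    using I3 \<pi>[OF that] by (auto simp: I3_def)
  ultimately show ?thesis using I3 b\<pi> ord unfolding I3_def \<kappa>_def by blast
qed

section \<open>The labeling\<close>

lemma bij_betw_insert_upd:
  assumes "bij_betw f A {1..<c}" "x \<notin> A" "1 \<le> c"
  shows "bij_betw (f(x := c)) (insert x A) {1..<Suc c}"
proof -
  have "bij_betw (f(x := c)) A {1..<c}"
    using assms by (subst bij_betw_cong[of _ _ f]) auto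
  moreover have "bij_betw (f(x := c)) {x} {c}" by (simp add: bij_betw_def)
  ultimately have "bij_betw (f(x := c)) (A \<union> {x}) ({1..<c} \<union> {c})"
    by (rule bij_betw_combine) auto
  moreover have "{1..<c} \<union> {c} = {1..<Suc c}" using assms(3) by auto
  ultimately show ?thesis by simp
qed

text \<open>What the labeling argument has to know about a caterpillar, with edges replaced by their
  indices below \<open>m\<close>: \<open>X\<close> lists the spine, \<open>Ed\<close> the extended
  path, and every other edge is a leg hanging at its \<open>stem\<close>. By \<open>leaf_inj\<close>
  no edge joins two leaves, and by \<open>leaf_Ed\<close> the path meets leaves only with its two
  end edges.\<close>

locale layout =
  fixes n m r :: nat and ei :: "nat \<Rightarrow> nat set" and X Ed stem :: "nat \<Rightarrow> nat"
  assumes r_pos: "0 < r" and m_n: "m < n" and r_n: "r < n"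
    and X_inj: "inj_on X {..<r}" and X_n: "k < r \<Longrightarrow> X k < n"
    and Ed_inj: "inj_on Ed {..r}" and Ed_m: "i \<le> r \<Longrightarrow> Ed i < m"
    and X_Ed: "k < r \<Longrightarrow> i \<le> r \<Longrightarrow> X k \<in> ei (Ed i) \<longleftrightarrow> i = k \<or> i = Suc k"
    and X_leg: "k < r \<Longrightarrow> e < m \<Longrightarrow> e \<notin> Ed ` {..r} \<Longrightarrow> X k \<in> ei e \<longleftrightarrow> stem e = X k"
    and stem_X: "e < m \<Longrightarrow> e \<notin> Ed ` {..r} \<Longrightarrow> \<exists>k<r. stem e = X k"
    and leaf_edge: "v < n \<Longrightarrow> v \<notin> X ` {..<r} \<Longrightarrow> \<exists>!e. e < m \<and> v \<in> ei e"
    and leaf_inj: "v \<notin> X ` {..<r} \<Longrightarrow> w \<notin> X ` {..<r} \<Longrightarrow> v \<in> ei e \<Longrightarrow> w \<in> ei e \<Longrightarrow> e < m \<Longrightarrow> v = w"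
    and leaf_Ed: "v \<notin> X ` {..<r} \<Longrightarrow> i \<le> r \<Longrightarrow> v \<in> ei (Ed i) \<Longrightarrow> i = 0 \<or> i = r"
begin

definition legs :: "nat \<Rightarrow> nat set" where
  "legs k = {e. e < m \<and> e \<notin> Ed ` {..r} \<and> stem e = X k}"

definition lc :: "nat \<Rightarrow> nat" where "lc k = card (legs k)"

definition leg :: "nat \<Rightarrow> nat" where "leg k = the_elem (legs k)"

definition high :: "nat \<Rightarrow> bool" where "high i \<longleftrightarrow> odd (r - i)"

definition nhigh :: nat where "nhigh = Suc r div 2"

text \<open>The indices of the high edges share one parity, so \<open>i div 2\<close> numbers them
  consecutively from 0, and their labels fill the block from \<open>m - nhigh + 1\<close> to
  \<open>m\<close>.\<close>

definition hl :: "nat \<Rightarrow> nat" where "hl i = m - nhigh + 1 + i div 2"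

definition highs :: "nat set" where "highs = Ed ` {i. i \<le> r \<and> high i}"

definition vsum :: "(nat \<Rightarrow> nat) \<Rightarrow> nat \<Rightarrow> nat" where
  "vsum L v = (\<Sum>e<m. if v \<in> ei e then L e else 0)"

definition psum :: "(nat \<Rightarrow> nat) \<Rightarrow> nat \<Rightarrow> nat" where
  "psum L k = L (Ed k) + L (Ed (Suc k))"

lemma finite_legs [simp]: "finite (legs k)"
  by (simp add: legs_def)

lemma legs_m: "e \<in> legs k \<Longrightarrow> e < m"
  by (simp add: legs_def)

lemma legs_not_Ed: "e \<in> legs k \<Longrightarrow> i \<le> r \<Longrightarrow> e \<noteq> Ed i"
  by (auto simp: legs_def)

lemma legs_not_highs: "e \<in> legs k \<Longrightarrow> e \<notin> highs"
  by (auto simp: legs_def highs_def)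

lemma legs_disj: "e \<in> legs k \<Longrightarrow> e \<in> legs k' \<Longrightarrow> k < r \<Longrightarrow> k' < r \<Longrightarrow> k = k'"
  using X_inj by (auto simp: legs_def inj_on_def)

lemma leg_single: "lc k = 1 \<Longrightarrow> legs k = {leg k}"
  unfolding lc_def leg_def by (metis card_1_singletonE the_elem_eq)

lemma Ed_eq: "i \<le> r \<Longrightarrow> j \<le> r \<Longrightarrow> Ed i = Ed j \<longleftrightarrow> i = j"
  using Ed_inj by (auto simp: inj_on_def)

lemma Ed_highs: "i \<le> r \<Longrightarrow> Ed i \<in> highs \<longleftrightarrow> high i"
  using Ed_eq by (auto simp: highs_def)

lemma vsum_X:
  assumes "k < r"
  shows "vsum L (X k) = psum L k + sum L (legs k)"
proof -
  have "vsum L (X k) = sum L {e \<in> {..<m}. X k \<in> ei e}"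
    unfolding vsum_def by (rule sum.inter_filter[symmetric]) simp
  also have "{e \<in> {..<m}. X k \<in> ei e} = {Ed k, Ed (Suc k)} \<union> legs k"
    using assms X_Ed[OF assms] X_leg[OF assms] Ed_m by (auto simp: legs_def)
  also have "sum L \<dots> = sum L {Ed k, Ed (Suc k)} + sum L (legs k)"
    using assms by (intro sum.union_disjoint) (auto simp: legs_def)
  also have "sum L {Ed k, Ed (Suc k)} = psum L k"
    using assms Ed_eq[of k "Suc k"] by (simp add: psum_def)
  finally show ?thesis .
qed

lemma vsum_upd:
  assumes "e < m" "L e = 0"
  shows "vsum (L(e := x)) v = vsum L v + (if v \<in> ei e then x else 0)"
proof -
  have "vsum (L(e := x)) v = (\<Sum>e'<m. (if v \<in> ei e' then L e' else 0) + (if e' = e then if v \<in> ei e then x else 0 else 0))"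
    unfolding vsum_def by (rule sum.cong) (use assms in auto)
  also have "\<dots> = vsum L v + (\<Sum>e'<m. if e' = e then if v \<in> ei e then x else 0 else 0)"
    by (simp add: vsum_def sum.distrib)
  finally show ?thesis using assms(1) by simp
qed

lemma high_div_inj: "i \<le> r \<Longrightarrow> i' \<le> r \<Longrightarrow> high i \<Longrightarrow> high i' \<Longrightarrow> i div 2 = i' div 2 \<Longrightarrow> i = i'"
  unfolding high_def by presburger

lemma high_div_less: "i \<le> r \<Longrightarrow> high i \<Longrightarrow> i div 2 < nhigh"
  unfolding high_def nhigh_def by presburger

lemma high_div_ex: "x < nhigh \<Longrightarrow> \<exists>i\<le>r. high i \<and> i div 2 = x"
  unfolding high_def nhigh_def
  by (rule exI[of _ "2 * x + (if odd r then 0 else 1)"]) (auto elim!: oddE evenE)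

lemma high_Suc: "i < r \<Longrightarrow> high (Suc i) \<longleftrightarrow> \<not> high i"
  unfolding high_def by presburger

lemma not_high_r: "\<not> high r"
  by (simp add: high_def)

lemma bij_betw_high: "bij_betw (\<lambda>i. i div 2) {i. i \<le> r \<and> high i} {..<nhigh}"
  unfolding bij_betw_def inj_on_def using high_div_inj high_div_less high_div_ex by force

lemma card_highs: "card highs = nhigh"
proof -
  have "card highs = card {i. i \<le> r \<and> high i}"
    unfolding highs_def by (rule card_image) (use Ed_inj in \<open>auto simp: inj_on_def\<close>)
  also have "\<dots> = nhigh" using bij_betw_same_card[OF bij_betw_high] by simp
  finally show ?thesis .
qed

lemma Ed_image: "Ed ` {..r} \<subseteq> {..<m}"
  using Ed_m by auto

lemma highs_m: "highs \<subseteq> {..<m}"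
  using Ed_m by (auto simp: highs_def)

lemma Suc_r_le_m: "Suc r \<le> m"
  using card_mono[OF _ Ed_image] card_image[OF Ed_inj] by simp

lemma nhigh_le: "nhigh \<le> m" "2 * nhigh \<le> Suc r"
  using Suc_r_le_m by (auto simp: nhigh_def)

lemma hl_le: "i \<le> r \<Longrightarrow> high i \<Longrightarrow> hl i \<le> m"
  using high_div_less[of i] nhigh_le(1) by (simp add: hl_def)

text \<open>In a map \<open>S\<close>, the entry \<open>S x = Suc k\<close> says that the vertex \<open>k\<close> has a single leg and path sum \<open>x\<close>;
  the entry 0 says that there is no such vertex.\<close>

definition records :: "nat \<Rightarrow> (nat \<Rightarrow> nat) \<Rightarrow> (nat \<Rightarrow> nat) \<Rightarrow> bool" where
  "records i L S \<longleftrightarrow> (\<forall>x. if S x = 0 then \<forall>k. Suc k < i \<and> lc k = 1 \<longrightarrow> psum L k \<noteq> x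
         else S x < i \<and> lc (S x - 1) = 1 \<and> psum L (S x - 1) = x)"

text \<open>\<open>Ed t\<close> is the high edge whose label clashes with the path sum of
  \<open>k\<close>. The upper bound on the label of the leg is claimed only once
  \<open>Ed (Suc t)\<close> has a label, which happens one step after the insertion.\<close>

definition inserted :: "nat \<Rightarrow> (nat \<Rightarrow> nat) \<Rightarrow> nat \<Rightarrow> nat \<Rightarrow> nat \<Rightarrow> bool" where
  "inserted i L k e t \<longleftrightarrow> t \<le> r \<and> Suc k < t \<and> t < i \<and> high t \<and> psum L k = L (Ed t) \<and>
     L (Ed (t - 1)) < L e \<and> (Suc t < i \<longrightarrow> L e < L (Ed (Suc t)))"

text \<open>The invariant after labelling \<open>Ed 0, \<dots>, Ed (i - 1)\<close>. The label 0 means unlabelled, and \<open>c\<close> is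
  the next free label below those of the high edges.\<close>

inductive sweep :: "nat \<Rightarrow> (nat \<Rightarrow> nat) \<Rightarrow> nat \<Rightarrow> (nat \<Rightarrow> nat) \<Rightarrow> bool" for i L c S where
  sweepI: "sweep i L c S"
  if "\<And>t. t \<le> r \<Longrightarrow> L (Ed t) = 0 \<longleftrightarrow> i \<le> t"
    and "\<And>t. t \<le> r \<Longrightarrow> t < i \<Longrightarrow> high t \<Longrightarrow> L (Ed t) = hl t"
    and "bij_betw L ({e. e < m \<and> L e \<noteq> 0} - highs) {1..<c}" "1 \<le> c"
    and "\<And>t t'. t < t' \<Longrightarrow> t' < i \<Longrightarrow> t' \<le> r \<Longrightarrow> \<not> high t \<Longrightarrow> \<not> high t' \<Longrightarrow> L (Ed t) < L (Ed t')"
    and "\<And>k e. k < r \<Longrightarrow> e \<in> legs k \<Longrightarrow> L e \<noteq> 0 \<Longrightarrow> lc k = 1 \<and> (\<exists>t. inserted i L k e t)"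
    and "\<And>k t. k < r \<Longrightarrow> t \<le> r \<Longrightarrow> Suc k < i \<Longrightarrow> t < i \<Longrightarrow> high t \<Longrightarrow> lc k = 1 \<Longrightarrow> psum L k = L (Ed t) \<Longrightarrow>
       L (leg k) \<noteq> 0"
    and "records i L S"

lemma sweepD:
  assumes "sweep i L c S"
  shows "\<And>t. t \<le> r \<Longrightarrow> L (Ed t) = 0 \<longleftrightarrow> i \<le> t"
    and "\<And>t. t \<le> r \<Longrightarrow> t < i \<Longrightarrow> high t \<Longrightarrow> L (Ed t) = hl t"
    and "bij_betw L ({e. e < m \<and> L e \<noteq> 0} - highs) {1..<c}" "1 \<le> c"
    and "\<And>t t'. t < t' \<Longrightarrow> t' < i \<Longrightarrow> t' \<le> r \<Longrightarrow> \<not> high t \<Longrightarrow> \<not> high t' \<Longrightarrow> L (Ed t) < L (Ed t')"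
    and "\<And>k e. k < r \<Longrightarrow> e \<in> legs k \<Longrightarrow> L e \<noteq> 0 \<Longrightarrow> lc k = 1 \<and> (\<exists>t. inserted i L k e t)"
    and "\<And>k t. k < r \<Longrightarrow> t \<le> r \<Longrightarrow> Suc k < i \<Longrightarrow> t < i \<Longrightarrow> high t \<Longrightarrow> lc k = 1 \<Longrightarrow> psum L k = L (Ed t) \<Longrightarrow>
       L (leg k) \<noteq> 0"
    and "records i L S"
  using assms unfolding sweep.simps by simp_all

lemma sweep_0: "sweep 0 (\<lambda>_. 0) 1 (\<lambda>_. 0)"
  by (simp add: sweep.simps records_def bij_betw_def)

lemma sweep_Ed_mono:
  assumes "sweep i L c S" "Suc (Suc t) < i" "Suc (Suc t) \<le> r"
  shows "L (Ed t) < L (Ed (Suc (Suc t)))"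
proof (cases "high t")
  case True
  then have "high (Suc (Suc t))" using high_Suc[of t] high_Suc[of "Suc t"] assms(3) by simp
  then have "L (Ed t) = hl t" "L (Ed (Suc (Suc t))) = hl (Suc (Suc t))"
    using assms True sweepD(2)[OF assms(1)] by auto
  then show ?thesis by (simp add: hl_def)
next
  case False
  then have "\<not> high (Suc (Suc t))" using high_Suc[of t] high_Suc[of "Suc t"] assms(3) by simp
  then show ?thesis using assms False sweepD(5)[OF assms(1)] by auto
qed

text \<open>The sums at \<open>k\<close> and \<open>Suc k\<close> share \<open>Ed (Suc k)\<close>,
  so \<open>sweep_Ed_mono\<close> compares the remaining summands.\<close>

lemma sweep_psum_mono:
  assumes "sweep i L c S" "k < k'" "Suc k' < i" "k' < r"
  shows "psum L k < psum L k'"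
  using assms(2-4)
proof (induction k')
  case (Suc k')
  have "psum L k' < psum L (Suc k')"
    using sweep_Ed_mono[OF assms(1), of k'] Suc.prems by (simp add: psum_def)
  then show ?case using Suc by (cases "k = k'") auto
qed simp

lemma sweep_low_less:
  assumes "sweep i L c S" "t < i" "t \<le> r" "\<not> high t"
  shows "L (Ed t) < c"
proof -
  have "Ed t \<in> {e. e < m \<and> L e \<noteq> 0} - highs"
    using assms Ed_m Ed_highs sweepD(1)[OF assms(1), of t] by auto
  then have "L (Ed t) \<in> {1..<c}" by (rule bij_betw_apply[OF sweepD(3)[OF assms(1)]])
  then show ?thesis by simp
qed

lemma sweep_leg_less:
  assumes "sweep i L c S" "e \<in> legs k" "L e \<noteq> 0"
  shows "L e < c"
proof -
  have "e \<in> {e. e < m \<and> L e \<noteq> 0} - highs"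
    using assms(2,3) legs_m legs_not_highs by auto
  then have "L e \<in> {1..<c}" by (rule bij_betw_apply[OF sweepD(3)[OF assms(1)]])
  then show ?thesis by simp
qed

text \<open>Labelling \<open>Ed i\<close> completes the path sum of vertex \<open>i - 1\<close>; its
  entry \<open>Suc (i - 1)\<close> is \<open>i\<close>.\<close>

definition sweep_S :: "nat \<Rightarrow> (nat \<Rightarrow> nat) \<Rightarrow> (nat \<Rightarrow> nat) \<Rightarrow> nat \<Rightarrow> nat" where
  "sweep_S i L S = (if 0 < i \<and> lc (i - 1) = 1 then S(psum L (i - 1) := i) else S)"

lemma psum_upd_Ed:
  assumes "Suc k < i" "i \<le> r"
  shows "psum (L(Ed i := x)) k = psum L k"
  using assms Ed_eq by (simp add: psum_def)

text \<open>Overwriting an entry would do no harm: a nonzero entry vouches for one vertex only,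
  while 0 rules out all of them.\<close>

lemma records_upd_Ed:
  assumes "records i L S" "i \<le> r"
  shows "records (Suc i) (L(Ed i := x)) (sweep_S i (L(Ed i := x)) S)"
  unfolding records_def
proof
  fix y
  let ?L = "L(Ed i := x)"
  have old: "if S y = 0 then \<forall>k. Suc k < i \<and> lc k = 1 \<longrightarrow> psum ?L k \<noteq> y
         else S y < i \<and> lc (S y - 1) = 1 \<and> psum ?L (S y - 1) = y"
  proof (cases "S y = 0")
    case True
    then show ?thesis using assms psum_upd_Ed[of _ i L x] unfolding records_def by auto
  next
    case False
    then have *: "S y < i" "lc (S y - 1) = 1" "psum L (S y - 1) = y"
      using assms(1) unfolding records_def by presburger+
    then show ?thesis using False psum_upd_Ed[of "S y - 1" i L x] assms(2) by simp
  qed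
  show "if sweep_S i ?L S y = 0 then \<forall>k. Suc k < Suc i \<and> lc k = 1 \<longrightarrow> psum ?L k \<noteq> y
         else sweep_S i ?L S y < Suc i \<and> lc (sweep_S i ?L S y - 1) = 1 \<and> psum ?L (sweep_S i ?L S y - 1) = y"
  proof (cases "0 < i \<and> lc (i - 1) = 1 \<and> y = psum ?L (i - 1)")
    case True
    then have "sweep_S i ?L S y = i" by (simp add: sweep_S_def)
    then show ?thesis using True by simp
  next
    case False
    then have S: "sweep_S i ?L S y = S y" by (auto simp: sweep_S_def)
    show ?thesis
    proof (cases "S y = 0")
      case True
      have "psum ?L k \<noteq> y" if "Suc k < Suc i" "lc k = 1" for k
      proof (cases "Suc k = i")
        case True
        then have "i - 1 = k" "0 < i" by auto
        then show ?thesis using False that by auto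
      next
        case False
        then show ?thesis using old that \<open>S y = 0\<close> by auto
      qed
      then show ?thesis unfolding S using True by simp
    next
      case False
      then show ?thesis unfolding S using old by simp
    qed
  qed
qed

text \<open>The label \<open>c\<close> exceeds all labels of low edges and legs so far. This keeps
  the low edges increasing and supplies the upper bound still due for a leg inserted in the previous
  step.\<close>

lemma sweep_step_low:
  assumes "sweep i L c S" "i \<le> r" "\<not> high i"
  shows "sweep (Suc i) (L(Ed i := c)) (Suc c) (sweep_S i (L(Ed i := c)) S)"
proof -
  note s = sweepD[OF assms(1)]
  define L1 where "L1 = L(Ed i := c)"
  have Edi: "L1 (Ed t) = (if t = i then c else L (Ed t))" if "t \<le> r" for t
    using that assms(2) Ed_eq by (simp add: L1_def)
  have Lleg: "L1 e = L e" if "e \<in> legs k" for e k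
    using that legs_not_Ed assms(2) by (auto simp: L1_def)
  show ?thesis
    unfolding L1_def[symmetric]
  proof (rule sweepI)
  show "L1 (Ed t) = 0 \<longleftrightarrow> Suc i \<le> t" if "t \<le> r" for t using Edi s(1) s(4) that by auto
  show "L1 (Ed t) = hl t" if "t \<le> r" "t < Suc i" "high t" for t
    using Edi s(2) assms(3) that by (auto simp: less_Suc_eq)
  have "{e. e < m \<and> L1 e \<noteq> 0} - highs = insert (Ed i) ({e. e < m \<and> L e \<noteq> 0} - highs)"
    using Ed_m[OF assms(2)] Ed_highs[OF assms(2)] assms(3) s(4) by (auto simp: L1_def)
  moreover have "Ed i \<notin> {e. e < m \<and> L e \<noteq> 0} - highs" using s(1)[OF assms(2)] by auto
  ultimately show "bij_betw L1 ({e. e < m \<and> L1 e \<noteq> 0} - highs) {1..<Suc c}"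
    using bij_betw_insert_upd[OF s(3) _ s(4)] by (simp add: L1_def)
  show "1 \<le> Suc c" by simp
  show "L1 (Ed t) < L1 (Ed t')" if "t < t'" "t' < Suc i" "t' \<le> r" "\<not> high t" "\<not> high t'" for t t'
    using that Edi s(5) sweep_low_less[OF assms(1)] by (auto simp: less_Suc_eq)
  show "lc k = 1 \<and> (\<exists>t. inserted (Suc i) L1 k e t)"
    if k: "k < r" and e: "e \<in> legs k" and "L1 e \<noteq> 0" for k e
  proof -
    have Le: "L1 e = L e" "L e \<noteq> 0" using Lleg[OF e] that by auto
    from s(6)[OF k e Le(2)] obtain t where t: "t \<le> r" "Suc k < t" "t < i" "high t" "psum L k = L (Ed t)"
      "L (Ed (t - 1)) < L e" "Suc t < i \<longrightarrow> L e < L (Ed (Suc t))" and l: "lc k = 1"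
      unfolding inserted_def by blast
    \<comment> \<open>If \<open>Suc t = i\<close>, the upper bound becomes due now, and it is
      \<open>c\<close>.\<close>
    have "L1 e < L1 (Ed (Suc t))"
    proof (cases "Suc t = i")
      case True
      then show ?thesis using sweep_leg_less[OF assms(1) e Le(2)] Le(1) Edi[of i] assms(2) by simp
    next
      case False
      then show ?thesis using t Le(1) Edi[of "Suc t"] assms(2) by auto
    qed
    moreover have "psum L1 k = L1 (Ed t)" "L1 (Ed (t - 1)) < L1 e"
      using t psum_upd_Ed[of k i L c] assms(2) Edi[of t] Edi[of "t - 1"] Le(1) by (auto simp: L1_def)
    ultimately have "inserted (Suc i) L1 k e t" using t unfolding inserted_def by simp
    then show ?thesis using l by blast
  qed
  show "L1 (leg k) \<noteq> 0"
    if k: "k < r" and t: "t \<le> r" "Suc k < Suc i" "t < Suc i" "high t" "lc k = 1" "psum L1 k = L1 (Ed t)" for k t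
  proof -
    have ti: "t < i" using t assms(3) by (cases "t = i") auto
    show ?thesis
    proof (cases "Suc k = i")
      case True
      \<comment> \<open>The vertex completed in this step cannot clash with an earlier high edge:
        its sum contains the label of \<open>Ed k\<close>, the largest high label so far.\<close>
      then have "high k" using high_Suc[of k] assms(2,3) by auto
      then have "L (Ed k) = hl k" "L (Ed t) = hl t" using s(2) True assms(2) ti t by auto
      moreover have "hl t \<le> hl k" using True ti by (simp add: hl_def div_le_mono)
      moreover have "psum L1 k = L (Ed k) + c" using True Edi[of k] Edi[of i] assms(2) by (simp add: psum_def)
      ultimately show ?thesis using t(6) Edi[of t] ti t(1) s(4) by auto
    next
      case False
      then have "psum L k = L (Ed t)" using t ti psum_upd_Ed[of k i L c] assms(2) Edi[of t] by (auto simp: L1_def)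
      then have "L (leg k) \<noteq> 0" using s(7)[of k t] k t ti False by auto
      then show ?thesis using s(4) by (simp add: L1_def)
    qed
  qed
  show "records (Suc i) L1 (sweep_S i L1 S)"
    unfolding L1_def by (rule records_upd_Ed[OF s(8) assms(2)])
qed
qed

text \<open>The state between labelling the high edge and a possible insertion. Compared with
  \<open>sweep\<close>, only clashes with \<open>Ed i\<close> itself are unresolved. By the last
  claim these concern earlier vertices only, since the sum of vertex \<open>i - 1\<close> contains
  \<open>hl i\<close> and another positive label.\<close>

lemma sweep_step_high_label:
  assumes "sweep i L c S" "i \<le> r" "high i"
  defines "L1 \<equiv> L(Ed i := hl i)"
  shows "\<And>t. t \<le> r \<Longrightarrow> L1 (Ed t) = 0 \<longleftrightarrow> Suc i \<le> t"
    "\<And>t. t \<le> r \<Longrightarrow> t < Suc i \<Longrightarrow> high t \<Longrightarrow> L1 (Ed t) = hl t"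
    "bij_betw L1 ({e. e < m \<and> L1 e \<noteq> 0} - highs) {1..<c}"
    "\<And>t t'. t < t' \<Longrightarrow> t' < Suc i \<Longrightarrow> t' \<le> r \<Longrightarrow> \<not> high t \<Longrightarrow> \<not> high t' \<Longrightarrow> L1 (Ed t) < L1 (Ed t')"
    "\<And>k e. k < r \<Longrightarrow> e \<in> legs k \<Longrightarrow> L1 e \<noteq> 0 \<Longrightarrow> lc k = 1 \<and> (\<exists>t<i. inserted (Suc i) L1 k e t)"
    "\<And>k t. k < r \<Longrightarrow> t \<le> r \<Longrightarrow> Suc k < Suc i \<Longrightarrow> t < i \<Longrightarrow> high t \<Longrightarrow> lc k = 1 \<Longrightarrow> psum L1 k = L1 (Ed t) \<Longrightarrow> L1 (leg k) \<noteq> 0"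
    "\<And>k. k < r \<Longrightarrow> Suc k < Suc i \<Longrightarrow> psum L1 k = hl i \<Longrightarrow> Suc k < i"
proof -
  note s = sweepD[OF assms(1)]
  have hl0: "hl i > 0" by (simp add: hl_def)
  have Edi: "L1 (Ed t) = (if t = i then hl i else L (Ed t))" if "t \<le> r" for t
    using that assms(2) Ed_eq by (simp add: L1_def)
  have Lleg: "L1 e = L e" if "e \<in> legs k" for e k
    using that legs_not_Ed assms(2) by (auto simp: L1_def)
  show "L1 (Ed t) = 0 \<longleftrightarrow> Suc i \<le> t" if "t \<le> r" for t using Edi that s(1) hl0 by auto
  show "L1 (Ed t) = hl t" if "t \<le> r" "t < Suc i" "high t" for t
    using Edi s(2) that by (auto simp: less_Suc_eq)
  have "Ed i \<in> highs" using Ed_highs assms(2,3) by simp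
  then have "{e. e < m \<and> L1 e \<noteq> 0} - highs = {e. e < m \<and> L e \<noteq> 0} - highs"
    by (auto simp: L1_def)
  moreover have "bij_betw L1 ({e. e < m \<and> L e \<noteq> 0} - highs) {1..<c} \<longleftrightarrow> bij_betw L ({e. e < m \<and> L e \<noteq> 0} - highs) {1..<c}"
    by (rule bij_betw_cong) (use \<open>Ed i \<in> highs\<close> in \<open>auto simp: L1_def\<close>)
  ultimately show "bij_betw L1 ({e. e < m \<and> L1 e \<noteq> 0} - highs) {1..<c}" using s(3) by simp
  show "L1 (Ed t) < L1 (Ed t')" if "t < t'" "t' < Suc i" "t' \<le> r" "\<not> high t" "\<not> high t'" for t t'
    using that Edi s(5) assms(3) by (auto simp: less_Suc_eq)
  show "lc k = 1 \<and> (\<exists>t<i. inserted (Suc i) L1 k e t)"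
    if k: "k < r" and e: "e \<in> legs k" and "L1 e \<noteq> 0" for k e
  proof -
    have Le: "L1 e = L e" "L e \<noteq> 0" using Lleg[OF e] that by auto
    from s(6)[OF k e Le(2)] obtain t where t: "t \<le> r" "Suc k < t" "t < i" "high t" "psum L k = L (Ed t)"
      "L (Ed (t - 1)) < L e" "Suc t < i \<longrightarrow> L e < L (Ed (Suc t))" and l: "lc k = 1"
      unfolding inserted_def by blast
    \<comment> \<open>Consecutive path edges are never both high, so no upper bound becomes due in
      this step.\<close>
    have "Suc t \<noteq> i" using t(3,4) assms(2,3) high_Suc[of t] by auto
    then have "L1 e < L1 (Ed (Suc t))" if "Suc t < Suc i"
      using t that Le(1) Edi[of "Suc t"] assms(2) by auto
    moreover have "psum L1 k = L1 (Ed t)" "L1 (Ed (t - 1)) < L1 e"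
      using t psum_upd_Ed[of k i L "hl i"] assms(2) Edi[of t] Edi[of "t - 1"] Le(1) by (auto simp: L1_def)
    ultimately have "inserted (Suc i) L1 k e t" using t unfolding inserted_def by simp
    then show ?thesis using l t(3) by blast
  qed
  have new: "psum L1 k > hl i" if "Suc k = i" for k
  proof -
    have "L1 (Ed k) \<noteq> 0" using that s(1) assms(2) Edi[of k] hl0 by auto
    then show ?thesis using that Edi[of i] assms(2) by (simp add: psum_def)
  qed
  show "L1 (leg k) \<noteq> 0"
    if k: "k < r" and t: "t \<le> r" "Suc k < Suc i" "t < i" "high t" "lc k = 1" "psum L1 k = L1 (Ed t)" for k t
  proof (cases "Suc k = i")
    case True
    have "L1 (Ed t) = hl t" using t s(2) Edi[of t] by auto
    moreover have "hl t \<le> hl i" using t(3) by (simp add: hl_def div_le_mono)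
    ultimately show ?thesis using new[OF True] t(6) by simp
  next
    case False
    then have "psum L k = L (Ed t)" using t psum_upd_Ed[of k i L "hl i"] assms(2) Edi[of t] by (auto simp: L1_def)
    then have "L (leg k) \<noteq> 0" using s(7)[of k t] k t False by auto
    then show ?thesis using hl0 by (simp add: L1_def)
  qed
  show "Suc k < i" if "k < r" "Suc k < Suc i" "psum L1 k = hl i" for k
    using new[of k] that by (cases "Suc k = i") auto
qed

text \<open>An entry 0 at \<open>hl i\<close> means that no vertex with a single leg clashes with
  the new label, so nothing has to be inserted.\<close>

lemma sweep_step_high:
  assumes "sweep i L c S" "i \<le> r" "high i"
  defines "L1 \<equiv> L(Ed i := hl i)"
  defines "S1 \<equiv> sweep_S i L1 S"
  assumes "S1 (hl i) = 0"
  shows "sweep (Suc i) L1 c S1"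
proof (rule sweepI)
  note h = sweep_step_high_label[OF assms(1-3), folded L1_def]
  show rec: "records (Suc i) L1 S1"
    unfolding S1_def L1_def by (rule records_upd_Ed[OF sweepD(8)[OF assms(1)] assms(2)])
  show "1 \<le> c" using sweepD(4)[OF assms(1)] .
  show "L1 (leg k) \<noteq> 0"
    if "k < r" "t \<le> r" "Suc k < Suc i" "t < Suc i" "high t" "lc k = 1" "psum L1 k = L1 (Ed t)" for k t
  proof (cases "t = i")
    case True
    then have "psum L1 k = hl i" using h(2)[of i] assms(2,3) that by simp
    moreover have "\<forall>k. Suc k < Suc i \<and> lc k = 1 \<longrightarrow> psum L1 k \<noteq> hl i"
      using rec assms(6) unfolding records_def by presburger
    ultimately show ?thesis using that by blast
  qed (use h(6) that in auto)
  show "lc k = 1 \<and> (\<exists>t. inserted (Suc i) L1 k e t)" if "k < r" "e \<in> legs k" "L1 e \<noteq> 0" for k e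
    using h(5)[OF that] by blast
qed (fact sweep_step_high_label(1-4)[OF assms(1-3), folded L1_def])+

text \<open>The map names the clashing vertex \<open>k0\<close>. Its leg gets \<open>c\<close>,
  which is above the label of the low edge \<open>Ed (i - 1)\<close>; the label of
  \<open>Ed (Suc i)\<close> will be larger still.\<close>

lemma sweep_step_special:
  assumes "sweep i L c S" "i \<le> r" "high i"
  defines "L1 \<equiv> L(Ed i := hl i)"
  defines "S1 \<equiv> sweep_S i L1 S"
  defines "k0 \<equiv> S1 (hl i) - 1"
  assumes "S1 (hl i) \<noteq> 0"
  shows "sweep (Suc i) (L1(leg k0 := c)) (Suc c) S1" "k0 < r" "lc k0 = 1" "L1 (leg k0) = 0"
proof -
  note h = sweep_step_high_label[OF assms(1-3), folded L1_def]
  have rec: "records (Suc i) L1 S1"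
    unfolding S1_def L1_def by (rule records_upd_Ed[OF sweepD(8)[OF assms(1)] assms(2)])
  have c: "1 \<le> c" using sweepD(4)[OF assms(1)] .
  have "S1 (hl i) < Suc i \<and> lc k0 = 1 \<and> psum L1 k0 = hl i"
    using rec assms(7) unfolding records_def k0_def by presburger
  then have k0: "Suc k0 < Suc i" "psum L1 k0 = hl i" and lk0: "lc k0 = 1"
    using assms(7) by (auto simp: k0_def)
  then show k0r: "k0 < r" using assms(2) by simp
  show "lc k0 = 1" by fact
  have k0i: "Suc k0 < i" using h(7)[OF k0r k0] .
  have leg0: "leg k0 \<in> legs k0" using leg_single[OF lk0] by simp
  \<comment> \<open>An earlier label on this leg would stem from a high edge with the same label as
    \<open>Ed i\<close>, but \<open>hl\<close> is injective on high indices.\<close>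
  show L0: "L1 (leg k0) = 0"
  proof (rule ccontr)
    assume "L1 (leg k0) \<noteq> 0"
    from h(5)[OF k0r leg0 this] obtain t where t: "t \<le> r" "t < i" "high t" "psum L1 k0 = L1 (Ed t)"
      unfolding inserted_def by blast
    then have "hl t = hl i" using h(2)[of t] k0 by simp
    then have "t = i" using high_div_inj[of t i] t assms(2,3) by (simp add: hl_def)
    with t show False by simp
  qed
  define L2 where "L2 = L1(leg k0 := c)"
  have LEd: "L2 (Ed t) = L1 (Ed t)" if "t \<le> r" for t using legs_not_Ed[OF leg0 that] by (simp add: L2_def)
  have Lps: "psum L2 k = psum L1 k" if "k < r" for k using LEd that by (simp add: psum_def)
  show "sweep (Suc i) (L1(leg k0 := c)) (Suc c) S1"
    unfolding L2_def[symmetric]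
  proof (rule sweepI)
    have "{e. e < m \<and> L2 e \<noteq> 0} - highs = insert (leg k0) ({e. e < m \<and> L1 e \<noteq> 0} - highs)"
      using legs_m[OF leg0] legs_not_highs[OF leg0] c by (auto simp: L2_def)
    then show "bij_betw L2 ({e. e < m \<and> L2 e \<noteq> 0} - highs) {1..<Suc c}"
      using bij_betw_insert_upd[OF h(3) _ c, of "leg k0"] L0 by (simp add: L2_def)
    show "1 \<le> Suc c" by simp
    show "L2 (Ed t) = 0 \<longleftrightarrow> Suc i \<le> t" if "t \<le> r" for t using h(1) LEd that by simp
    show "L2 (Ed t) = hl t" if "t \<le> r" "t < Suc i" "high t" for t using h(2) LEd that by simp
    show "L2 (Ed t) < L2 (Ed t')" if "t < t'" "t' < Suc i" "t' \<le> r" "\<not> high t" "\<not> high t'" for t t'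
      using h(4)[OF that] LEd[of t] LEd[of t'] that by linarith
    show "lc k = 1 \<and> (\<exists>t. inserted (Suc i) L2 k e t)"
      if k: "k < r" and e: "e \<in> legs k" and "L2 e \<noteq> 0" for k e
    proof (cases "e = leg k0")
      case True
      then have [simp]: "k = k0" using legs_disj[of e k k0] e leg0 k k0r by simp
      have "\<not> high (i - 1)" using high_Suc[of "i - 1"] k0i assms(2,3) by auto
      then have "L (Ed (i - 1)) < c" using sweep_low_less[OF assms(1), of "i - 1"] k0i assms(2) by auto
      moreover have "L1 (Ed (i - 1)) = L (Ed (i - 1))" using Ed_eq[of "i - 1" i] k0i assms(2) by (auto simp: L1_def)
      ultimately have "L2 (Ed (i - 1)) < L2 e" using LEd[of "i - 1"] assms(2) True by (simp add: L2_def)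
      moreover have "psum L2 k = L2 (Ed i)" using Lps[OF k0r] LEd[of i] h(2)[of i] assms(2,3) k0 by simp
      ultimately have "inserted (Suc i) L2 k e i" using k0i assms(2,3) by (simp add: inserted_def)
      then show ?thesis using lk0 by auto
    next
      case False
      then have e': "L2 e = L1 e" by (simp add: L2_def)
      with h(5)[OF k e] \<open>L2 e \<noteq> 0\<close> obtain t where t: "inserted (Suc i) L1 k e t" "t < i" and l: "lc k = 1"
        by auto
      have "inserted (Suc i) L2 k e t"
        using t Lps[OF k] LEd[of t] LEd[of "t - 1"] LEd[of "Suc t"] assms(2) e' by (auto simp: inserted_def)
      then show ?thesis using l by blast
    qed
    show "L2 (leg k) \<noteq> 0"
      if "k < r" "t \<le> r" "Suc k < Suc i" "t < Suc i" "high t" "lc k = 1" "psum L2 k = L2 (Ed t)" for k t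
    proof (cases "t = i")
      case True
      \<comment> \<open>Since path sums increase strictly, \<open>k0\<close> is the only vertex with
        sum \<open>hl i\<close>.\<close>
      then have eq: "psum L1 k = psum L1 k0" using h(2)[of i] assms(2,3) that Lps[of k] LEd[of i] k0 by simp
      have ki: "Suc k < i" using h(7)[of k] that k0(2) eq by simp
      have "psum L1 k = psum L k" "psum L1 k0 = psum L k0"
        using psum_upd_Ed[of k i L "hl i"] psum_upd_Ed[of k0 i L "hl i"] ki k0i assms(2)
        by (simp_all add: L1_def)
      then have "k = k0"
        using sweep_psum_mono[OF assms(1), of k k0] sweep_psum_mono[OF assms(1), of k0 k] k0i k0r that(1) ki eq
        by (cases k k0 rule: linorder_cases) auto
      then show ?thesis using c by (simp add: L2_def)
    next
      case False
      then have "L1 (leg k) \<noteq> 0" using h(6)[of k t] that Lps[of k] LEd[of t] by auto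
      then show ?thesis using c by (simp add: L2_def)
    qed
    show "records (Suc i) L2 S1"
      unfolding records_def
    proof
      fix y
      have "if S1 y = 0 then \<forall>k. Suc k < Suc i \<and> lc k = 1 \<longrightarrow> psum L1 k \<noteq> y
         else S1 y < Suc i \<and> lc (S1 y - 1) = 1 \<and> psum L1 (S1 y - 1) = y"
        using rec unfolding records_def by blast
      then show "if S1 y = 0 then \<forall>k. Suc k < Suc i \<and> lc k = 1 \<longrightarrow> psum L2 k \<noteq> y
         else S1 y < Suc i \<and> lc (S1 y - 1) = 1 \<and> psum L2 (S1 y - 1) = y"
        using Lps assms(2) by auto
    qed
  qed
qed

end

section \<open>Filling in the remaining legs\<close>

context layout
begin

text \<open>The invariant of the pass over the edges that labels all but one leg at every vertex whose legs
  were left unlabelled by the sweep result \<open>L0\<close>. \<open>C\<close> counts the unlabelled legs, and the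
  legs held back are collected in the queue \<open>Q\<close> of length \<open>q\<close>.\<close>

inductive filling ::
  "(nat \<Rightarrow> nat) \<Rightarrow> nat \<Rightarrow> nat \<Rightarrow> (nat \<Rightarrow> nat) \<Rightarrow> nat \<Rightarrow> (nat \<Rightarrow> nat) \<Rightarrow> (nat \<Rightarrow> nat) \<Rightarrow> nat \<Rightarrow> bool"
  for L0 c0 i L c C Q q where
  fillingI: "filling L0 c0 i L c C Q q"
  if "\<And>e. e < m \<Longrightarrow> L0 e \<noteq> 0 \<Longrightarrow> L e = L0 e"
    "\<And>e. e < m \<Longrightarrow> L0 e = 0 \<Longrightarrow> L e \<noteq> 0 \<Longrightarrow> c0 \<le> L e" "c0 \<le> c" "1 \<le> c"
    "bij_betw L ({e. e < m \<and> L e \<noteq> 0} - highs) {1..<c}"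
    "\<And>k e. k < r \<Longrightarrow> e \<in> legs k \<Longrightarrow> L e = 0 \<Longrightarrow> C (X k) = card {e \<in> legs k. L e = 0}"
    "bij_betw Q {..<q} {e. e < i \<and> L e = 0}"
    "\<And>k e. k < r \<Longrightarrow> e \<in> legs k \<Longrightarrow> e < i \<Longrightarrow> L e = 0 \<Longrightarrow> card {e \<in> legs k. L e = 0} = 1"
    "\<And>k e. k < r \<Longrightarrow> e \<in> legs k \<Longrightarrow> L0 e = 0 \<Longrightarrow> \<exists>e\<in>legs k. L e = 0"

lemma fillingD:
  assumes "filling L0 c0 i L c C Q q"
  shows "\<And>e. e < m \<Longrightarrow> L0 e \<noteq> 0 \<Longrightarrow> L e = L0 e"
    "\<And>e. e < m \<Longrightarrow> L0 e = 0 \<Longrightarrow> L e \<noteq> 0 \<Longrightarrow> c0 \<le> L e" "c0 \<le> c" "1 \<le> c"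
    "bij_betw L ({e. e < m \<and> L e \<noteq> 0} - highs) {1..<c}"
    "\<And>k e. k < r \<Longrightarrow> e \<in> legs k \<Longrightarrow> L e = 0 \<Longrightarrow> C (X k) = card {e \<in> legs k. L e = 0}"
    "bij_betw Q {..<q} {e. e < i \<and> L e = 0}"
    "\<And>k e. k < r \<Longrightarrow> e \<in> legs k \<Longrightarrow> e < i \<Longrightarrow> L e = 0 \<Longrightarrow> card {e \<in> legs k. L e = 0} = 1"
    "\<And>k e. k < r \<Longrightarrow> e \<in> legs k \<Longrightarrow> L0 e = 0 \<Longrightarrow> \<exists>e\<in>legs k. L e = 0"
  using assms unfolding filling.simps by simp_all

text \<open>A leg labelled by the sweep is the only leg of its vertex. So where one leg is
  unlabelled all are, and the counter may start at \<open>lc k\<close>.\<close>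

lemma filling_0:
  assumes "sweep (Suc r) L c S" "\<And>k. k < r \<Longrightarrow> C (X k) = lc k"
  shows "filling L c 0 L c C Q 0"
proof (rule fillingI)
  note s = sweepD[OF assms(1)]
  show "bij_betw L ({e. e < m \<and> L e \<noteq> 0} - highs) {1..<c}" by (rule s(3))
  show "1 \<le> c" by (rule s(4))
  show "C (X k) = card {e \<in> legs k. L e = 0}" if k: "k < r" and e: "e \<in> legs k" "L e = 0" for k e
  proof -
    have "L e' = 0" if "e' \<in> legs k" for e'
    proof (rule ccontr)
      assume "L e' \<noteq> 0"
      with s(6)[OF k that] have "legs k = {leg k}" using leg_single by blast
      with e that \<open>L e' \<noteq> 0\<close> show False by simp
    qed
    then have "{e \<in> legs k. L e = 0} = legs k" by blast
    then show ?thesis using assms(2)[OF k] by (simp add: lc_def)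
  qed
qed (auto simp: bij_betw_def)

lemma unlabelled_leg:
  assumes "sweep (Suc r) L0 c0 S" "filling L0 c0 i L c C Q q" "e < m" "L e = 0"
  shows "\<exists>k<r. e \<in> legs k \<and> stem e = X k"
proof -
  have "e \<notin> Ed ` {..r}"
  proof
    assume "e \<in> Ed ` {..r}"
    then obtain t where t: "t \<le> r" "e = Ed t" by auto
    then have "L0 e \<noteq> 0" using sweepD(1)[OF assms(1), of t] by auto
    then show False using fillingD(1)[OF assms(2,3)] assms(4) by simp
  qed
  with stem_X[OF assms(3) this] assms(3) show ?thesis unfolding legs_def by auto
qed

lemma filling_skip:
  assumes "filling L0 c0 i L c C Q q" "L i \<noteq> 0"
  shows "filling L0 c0 (Suc i) L c C Q q"
proof -
  have "{e. e < Suc i \<and> L e = 0} = {e. e < i \<and> L e = 0}"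
    using assms(2) by (auto simp: less_Suc_eq)
  with assms show ?thesis
    by (intro fillingI) (use fillingD[OF assms(1)] in \<open>auto simp: less_Suc_eq\<close>)
qed

lemma filling_label:
  assumes f: "filling L0 c0 i L c C Q q" and i: "i < m" "L i = 0"
    and k: "k < r" "i \<in> legs k" and C: "1 < C (X k)"
  shows "filling L0 c0 (Suc i) (L(i := c)) (Suc c) (C(X k := C (X k) - 1)) Q q"
proof (rule fillingI)
  note f' = fillingD[OF f]
  let ?L = "L(i := c)" and ?C = "C(X k := C (X k) - 1)"
  have c: "1 \<le> c" by (rule f'(4))
  have L0i: "L0 i = 0" using f'(1)[OF i(1)] i(2) by auto
  have cardk: "C (X k) = card {e \<in> legs k. L e = 0}" by (rule f'(6)[OF k i(2)])
  have setk: "{e \<in> legs k. ?L e = 0} = {e \<in> legs k. L e = 0} - {i}" using c by auto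
  then have cardk': "card {e \<in> legs k. ?L e = 0} = C (X k) - 1"
    using i(2) k cardk by (simp add: card_Diff_singleton)
  have other: "{e \<in> legs k'. ?L e = 0} = {e \<in> legs k'. L e = 0}" if "k' < r" "k' \<noteq> k" for k'
    using that legs_disj[OF k(2) _ k(1)] by (auto split: if_splits)
  have Xk: "X k' \<noteq> X k" if "k' < r" "k' \<noteq> k" for k' using X_inj that k(1) by (auto simp: inj_on_def)
  show "?L e = L0 e" if "e < m" "L0 e \<noteq> 0" for e using that L0i f'(1) by auto
  show "c0 \<le> ?L e" if "e < m" "L0 e = 0" "?L e \<noteq> 0" for e
    using that f'(2)[of e] f'(3) by (cases "e = i") auto
  show "c0 \<le> Suc c" using f'(3) by simp
  have "{e. e < m \<and> ?L e \<noteq> 0} - highs = insert i ({e. e < m \<and> L e \<noteq> 0} - highs)"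
    using i legs_not_highs[OF k(2)] c by auto
  then show "bij_betw ?L ({e. e < m \<and> ?L e \<noteq> 0} - highs) {1..<Suc c}"
    using bij_betw_insert_upd[OF f'(5) _ c, of i] i(2) by simp
  show "?C (X k') = card {e \<in> legs k'. ?L e = 0}" if "k' < r" "e \<in> legs k'" "?L e = 0" for k' e
  proof (cases "k' = k")
    case False
    then show ?thesis using other that Xk f'(6)[of k' e] c by (auto split: if_splits)
  qed (use cardk' in simp)
  have "{e. e < Suc i \<and> ?L e = 0} = {e. e < i \<and> L e = 0}" using c by (auto simp: less_Suc_eq)
  then show "bij_betw Q {..<q} {e. e < Suc i \<and> ?L e = 0}" using f'(7) by simp
  show "card {e \<in> legs k'. ?L e = 0} = 1" if "k' < r" "e \<in> legs k'" "e < Suc i" "?L e = 0" for k' e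
  proof -
    have e: "e < i" "L e = 0" using that c by (auto split: if_splits simp: less_Suc_eq)
    then have "card {e \<in> legs k'. L e = 0} = 1" using f'(8) that by blast
    moreover have "k' \<noteq> k" using calculation cardk C by auto
    ultimately show ?thesis using other that by simp
  qed
  show "\<exists>e\<in>legs k'. ?L e = 0" if "k' < r" "e \<in> legs k'" "L0 e = 0" for k' e
  proof (cases "k' = k")
    case True
    have "card {e \<in> legs k. ?L e = 0} > 0" using cardk' C by simp
    then have "{e \<in> legs k. ?L e = 0} \<noteq> {}" by (metis card.empty less_irrefl)
    then show ?thesis using True by blast
  next
    case False
    then show ?thesis using f'(9)[OF that] other[OF that(1) False] by blast
  qed
qed simp

text \<open>As \<open>i\<close> itself is unlabelled, the counter is exactly 1: this is the leg to
  hold back.\<close>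

lemma filling_queue:
  assumes f: "filling L0 c0 i L c C Q q" and i: "i < m" "L i = 0"
    and k: "k < r" "i \<in> legs k" and C: "\<not> 1 < C (X k)"
  shows "filling L0 c0 (Suc i) L c C (Q(q := i)) (Suc q)"
proof (rule fillingI)
  note f' = fillingD[OF f]
  show "bij_betw (Q(q := i)) {..<Suc q} {e. e < Suc i \<and> L e = 0}"
  proof -
    have "bij_betw (Q(q := i)) {..<q} {e. e < i \<and> L e = 0}"
      using f'(7) by (subst bij_betw_cong[of _ _ Q]) auto
    moreover have "bij_betw (Q(q := i)) {q} {i}" by (simp add: bij_betw_def)
    ultimately have "bij_betw (Q(q := i)) ({..<q} \<union> {q}) ({e. e < i \<and> L e = 0} \<union> {i})"
      by (rule bij_betw_combine) auto
    moreover have "{e. e < i \<and> L e = 0} \<union> {i} = {e. e < Suc i \<and> L e = 0}" using i by auto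
    moreover have "{..<q} \<union> {q} = {..<Suc q}" by auto
    ultimately show ?thesis by simp
  qed
  have cardk: "card {e \<in> legs k. L e = 0} = 1"
  proof -
    have "card {e \<in> legs k. L e = 0} \<noteq> 0" using k i by auto
    moreover have "C (X k) = card {e \<in> legs k. L e = 0}" by (rule f'(6)[OF k i(2)])
    ultimately show ?thesis using C by linarith
  qed
  show "card {e \<in> legs k'. L e = 0} = 1" if "k' < r" "e \<in> legs k'" "e < Suc i" "L e = 0" for k' e
  proof (cases "e = i")
    case True
    then show ?thesis using that cardk legs_disj[OF that(2), of k] k by simp
  next
    case False
    then show ?thesis using f'(8)[OF that(1,2)] that by simp
  qed
qed (use fillingD[OF f] in auto)

fun assign :: "(nat \<Rightarrow> nat) \<Rightarrow> nat \<Rightarrow> (nat \<Rightarrow> nat) \<Rightarrow> nat \<Rightarrow> nat \<Rightarrow> nat" where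
  "assign L c Q 0 = L"
| "assign L c Q (Suc t) = (assign L c Q t)(Q t := c + t)"

lemma assign_other: "e \<notin> Q ` {..<t} \<Longrightarrow> assign L c Q t e = L e"
  by (induction t) (auto simp: lessThan_Suc)

lemma assign_Q: "inj_on Q {..<q} \<Longrightarrow> t \<le> q \<Longrightarrow> u < t \<Longrightarrow> assign L c Q t (Q u) = c + u"
proof (induction t)
  case (Suc t)
  then show ?case by (cases "u = t") (auto simp: inj_on_def)
qed simp

lemma bij_betw_assign:
  assumes "bij_betw L (A - highs) {1..<c}" "1 \<le> c" "inj_on Q {..<q}" "Q ` {..<q} \<inter> A = {}" "Q ` {..<q} \<inter> highs = {}"
    "t \<le> q"
  shows "bij_betw (assign L c Q t) ((A \<union> Q ` {..<t}) - highs) {1..<c + t}"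
  using assms(6)
proof (induction t)
  case (Suc t)
  have "Q t \<notin> Q ` {..<t}"
  proof
    assume "Q t \<in> Q ` {..<t}"
    then obtain u where "u < t" "Q t = Q u" by auto
    then show False using inj_onD[OF assms(3), of t u] Suc.prems by simp
  qed
  moreover have Qt: "Q t \<in> Q ` {..<q}" using Suc.prems by auto
  ultimately have "Q t \<notin> (A \<union> Q ` {..<t}) - highs" using assms(4) by blast
  moreover have "(A \<union> Q ` {..<Suc t}) - highs = insert (Q t) ((A \<union> Q ` {..<t}) - highs)"
    using assms(5) Qt by (auto simp: lessThan_Suc)
  ultimately show ?case
    using bij_betw_insert_upd[of "assign L c Q t" "(A \<union> Q ` {..<t}) - highs" "c + t" "Q t"] Suc assms(2)
    by (simp add: fun_upd_def)
qed (use assms(1) in simp)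

end

section \<open>Distinctness of the final vertex sums\<close>

locale final_labels = layout +
  fixes L0 c0 S L c C Q q Q'
  assumes sweep: "sweep (Suc r) L0 c0 S"
    and filling: "filling L0 c0 m L c C Q q"
    and Q': "bij_betw Q' {..<q} {e. e < m \<and> L e = 0}"
    and sorted: "\<And>t t'. t < t' \<Longrightarrow> t' < q \<Longrightarrow> vsum L (stem (Q' t)) \<le> vsum L (stem (Q' t'))"
begin

definition "Lf = assign L c Q' q"

lemma inj_Q': "inj_on Q' {..<q}" and Q'_image: "Q' ` {..<q} = {e. e < m \<and> L e = 0}"
  using Q' by (auto simp: bij_betw_def)

lemma Lf_old: "e < m \<Longrightarrow> L e \<noteq> 0 \<Longrightarrow> Lf e = L e"
  unfolding Lf_def by (rule assign_other) (use Q'_image in auto)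

lemma Lf_new: "u < q \<Longrightarrow> Lf (Q' u) = c + u"
  unfolding Lf_def by (rule assign_Q[OF inj_Q']) auto

lemma Lf_L0: "e < m \<Longrightarrow> L0 e \<noteq> 0 \<Longrightarrow> Lf e = L0 e"
  using Lf_old[of e] fillingD(1)[OF filling, of e] by simp

lemma Lf_ge: "e < m \<Longrightarrow> L0 e = 0 \<Longrightarrow> c0 \<le> Lf e"
proof (cases "L e = 0")
  case True
  assume "e < m"
  then obtain u where "u < q" "e = Q' u" using True Q'_image by (auto simp: set_eq_iff image_iff)
  then show ?thesis using Lf_new fillingD(3)[OF filling] by simp
next
  case False
  assume "e < m" "L0 e = 0"
  then show ?thesis using False Lf_old fillingD(2)[OF filling] by simp
qed

lemma Ed_labelled: "t \<le> r \<Longrightarrow> L0 (Ed t) \<noteq> 0"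
  using sweepD(1)[OF sweep, of t] by simp

lemma Lf_Ed: "t \<le> r \<Longrightarrow> Lf (Ed t) = L0 (Ed t)"
  using Lf_L0 Ed_m Ed_labelled by simp

lemma L0_high: "t \<le> r \<Longrightarrow> high t \<Longrightarrow> L0 (Ed t) = hl t"
  using sweepD(2)[OF sweep, of t] by simp

lemma Q'_highs: "Q' ` {..<q} \<inter> highs = {}"
  unfolding Q'_image highs_def using Ed_labelled fillingD(1)[OF filling] Ed_m by force

lemma bij_Lf_low: "bij_betw Lf ({..<m} - highs) {1..<c + q}"
proof -
  have "bij_betw Lf (({e. e < m \<and> L e \<noteq> 0} \<union> Q' ` {..<q}) - highs) {1..<c + q}"
    unfolding Lf_def
    by (rule bij_betw_assign[OF fillingD(5,4)[OF filling] inj_Q' _ Q'_highs]) (auto simp: Q'_image)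
  moreover have "{e. e < m \<and> L e \<noteq> 0} \<union> Q' ` {..<q} = {..<m}" using Q'_image by auto
  ultimately show ?thesis by simp
qed

text \<open>Low edges and legs fill an initial block without gaps, so the first label after it is
  the smallest high one.\<close>

lemma c_q: "c + q = m - nhigh + 1"
proof -
  have "card ({..<m} - highs) = m - nhigh"
    using card_Diff_subset[OF _ highs_m] finite_subset[OF highs_m] card_highs by simp
  then show ?thesis using bij_betw_same_card[OF bij_Lf_low] fillingD(4)[OF filling] by simp
qed

lemma bij_Lf_high: "bij_betw Lf highs {m - nhigh + 1..m}"
proof -
  have "bij_betw (\<lambda>i. Lf (Ed i)) {i. i \<le> r \<and> high i} {m - nhigh + 1..m}"
  proof -
    have "bij_betw (\<lambda>x. m - nhigh + 1 + x) {..<nhigh} {m - nhigh + 1..m}"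
      by (rule bij_betw_byWitness[of _ "\<lambda>x. x - (m - nhigh + 1)"]) (use nhigh_le(1) in auto)
    from bij_betw_trans[OF bij_betw_high this]
    have "bij_betw (\<lambda>i. hl i) {i. i \<le> r \<and> high i} {m - nhigh + 1..m}"
      by (simp add: hl_def comp_def)
    moreover have "Lf (Ed i) = hl i" if "i \<in> {i. i \<le> r \<and> high i}" for i using that Lf_Ed L0_high by simp
    ultimately show ?thesis using bij_betw_cong[of "{i. i \<le> r \<and> high i}" "\<lambda>i. Lf (Ed i)" hl] by simp
  qed
  moreover have "bij_betw Ed {i. i \<le> r \<and> high i} highs"
    unfolding highs_def using Ed_inj by (auto simp: bij_betw_def inj_on_def)
  ultimately show ?thesis using bij_betw_comp_iff[of Ed "{i. i \<le> r \<and> high i}" highs Lf] by (simp add: comp_def)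
qed

theorem bij_Lf: "bij_betw Lf {..<m} {1..m}"
proof -
  have "bij_betw Lf (({..<m} - highs) \<union> highs) ({1..<c + q} \<union> {m - nhigh + 1..m})"
    by (rule bij_betw_combine[OF bij_Lf_low bij_Lf_high]) (auto simp: c_q)
  moreover have "({..<m} - highs) \<union> highs = {..<m}" using highs_m by auto
  moreover have "{1..<c + q} \<union> {m - nhigh + 1..m} = {1..m}" using c_q nhigh_le(1) by auto
  ultimately show ?thesis by simp
qed

lemma Lf_low_le: "e < m \<Longrightarrow> e \<notin> highs \<Longrightarrow> Lf e \<le> m - nhigh"
  using bij_betw_apply[OF bij_Lf_low, of e] c_q by auto

lemma psum_Lf: "k < r \<Longrightarrow> psum Lf k = psum L0 k"
  using Lf_Ed by (simp add: psum_def)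

text \<open>One of the two path edges is high, with label at least \<open>m - nhigh + 1\<close>, and
  the other contributes at least 1. Hence a path sum up to \<open>m\<close> is a high label.\<close>

lemma psum_ge: "k < r \<Longrightarrow> m - nhigh + 2 \<le> psum L0 k"
  using L0_high[of k] L0_high[of "Suc k"] Ed_labelled[of k] Ed_labelled[of "Suc k"] high_Suc[of k]
  by (cases "high k") (auto simp: psum_def hl_def)

lemma psum_mono: "k < k' \<Longrightarrow> k' < r \<Longrightarrow> psum L0 k < psum L0 k'"
  using sweep_psum_mono[OF sweep] by simp

lemma psum_mono_le: "k \<le> k' \<Longrightarrow> k' < r \<Longrightarrow> psum L0 k \<le> psum L0 k'"
  using psum_mono[of k k'] by (cases "k = k'") auto

text \<open>The maximum is attained at the last spine vertex: \<open>Ed (r - 1)\<close> is high,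
  with label at most \<open>m\<close>, and \<open>Ed r\<close> is low, with label below
  \<open>c0\<close>.\<close>

lemma psum_le: "k < r \<Longrightarrow> psum L0 k < m + c0"
proof -
  have "psum L0 (r - 1) < m + c0"
  proof -
    have "high (r - 1)" using not_high_r high_Suc[of "r - 1"] r_pos by simp
    then have "L0 (Ed (r - 1)) \<le> m" using L0_high hl_le[of "r - 1"] by simp
    moreover have "L0 (Ed r) < c0" using sweep_low_less[OF sweep, of r] not_high_r by simp
    ultimately show ?thesis using r_pos by (simp add: psum_def)
  qed
  moreover assume "k < r"
  then have "psum L0 k \<le> psum L0 (r - 1)" by (intro psum_mono_le) auto
  ultimately show ?thesis by linarith
qed

text \<open>At least half of the path edges are low, and the sweep labels them all below
  \<open>c0\<close>. So one extra leg label makes up for a path sum that falls short of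
  \<open>m\<close> by less than \<open>nhigh\<close>.\<close>

lemma c0_gt: "nhigh < c0"
proof -
  have "Ed ` {i. i \<le> r \<and> \<not> high i} \<subseteq> {e. e < m \<and> L0 e \<noteq> 0} - highs"
    using Ed_m Ed_labelled Ed_highs by auto
  then have "card (Ed ` {i. i \<le> r \<and> \<not> high i}) \<le> card ({e. e < m \<and> L0 e \<noteq> 0} - highs)"
    by (rule card_mono[rotated]) simp
  also have "\<dots> = c0 - 1" using bij_betw_same_card[OF sweepD(3)[OF sweep]] by simp
  also have "card (Ed ` {i. i \<le> r \<and> \<not> high i}) = card {i. i \<le> r \<and> \<not> high i}"
    by (rule card_image) (use Ed_inj in \<open>auto simp: inj_on_def\<close>)
  also have "{i. i \<le> r \<and> \<not> high i} = {..r} - {i. i \<le> r \<and> high i}" by auto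
  also have "card \<dots> = Suc r - nhigh"
    using bij_betw_same_card[OF bij_betw_high] by (subst card_Diff_subset) auto
  finally show ?thesis using nhigh_le(2) sweepD(4)[OF sweep] by linarith
qed

definition vs :: "nat \<Rightarrow> nat" where "vs k = vsum Lf (X k)"

lemma vs_eq: "k < r \<Longrightarrow> vs k = psum L0 k + sum Lf (legs k)"
  unfolding vs_def using vsum_X psum_Lf by simp

lemma vs_light: "k < r \<Longrightarrow> legs k = {} \<Longrightarrow> vs k = psum L0 k"
  by (simp add: vs_eq)

text \<open>The total is \<open>L0 (Ed t) + L0 e\<close>. Replacing \<open>L0 e\<close> by the
  labels of the neighbours \<open>Ed (t - 1)\<close> and \<open>Ed (t + 1)\<close> gives the path
  sums at \<open>t - 1\<close> and \<open>t\<close>. Here \<open>t < r\<close> because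
  \<open>Ed r\<close> is low.\<close>

lemma vs_special:
  assumes k: "k < r" and e: "e \<in> legs k" "L0 e \<noteq> 0"
  obtains t where "0 < t" "t < r" "psum L0 k = L0 (Ed t)" "psum L0 (t - 1) < vs k" "vs k < psum L0 t" "high t"
proof -
  from sweepD(6)[OF sweep k e] obtain t where l: "lc k = 1" and t: "t \<le> r" "Suc k < t" "high t"
    "psum L0 k = L0 (Ed t)" "L0 (Ed (t - 1)) < L0 e" "Suc t < Suc r \<Longrightarrow> L0 e < L0 (Ed (Suc t))"
    unfolding inserted_def by blast
  have tr: "t < r" using t(1,3) not_high_r by (cases "t = r") auto
  have "legs k = {e}" using leg_single[OF l] e(1) by simp
  then have "vs k = L0 (Ed t) + L0 e" using vs_eq[OF k] t(4) Lf_L0[OF legs_m[OF e(1)] e(2)] by simp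
  then have "psum L0 (t - 1) < vs k" "vs k < psum L0 t"
    using t tr by (auto simp: psum_def)
  then show ?thesis using that[of t] t tr by simp
qed

lemma vs_big:
  assumes k: "k < r" and ne: "legs k \<noteq> {}" and all0: "\<And>e. e \<in> legs k \<Longrightarrow> L0 e = 0"
  shows "m + c0 \<le> vs k"
proof (cases "lc k = 1")
  case True
  then have leg: "legs k = {leg k}" by (rule leg_single)
  \<comment> \<open>Otherwise the path sum is a high label, and the sweep would have labelled this
    single leg.\<close>
  have "m < psum L0 k"
  proof (rule ccontr)
    assume "\<not> m < psum L0 k"
    then have "psum L0 k - (m - nhigh + 1) < nhigh" using psum_ge[OF k] nhigh_le(1) by linarith
    then obtain t where t: "t \<le> r" "high t" "t div 2 = psum L0 k - (m - nhigh + 1)"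
      using high_div_ex by blast
    then have "psum L0 k = L0 (Ed t)" using L0_high psum_ge[OF k] by (simp add: hl_def)
    then have "L0 (leg k) \<noteq> 0" using sweepD(7)[OF sweep k t(1)] k t True by simp
    then show False using all0[of "leg k"] leg by simp
  qed
  moreover have "c0 \<le> Lf (leg k)" using Lf_ge[of "leg k"] all0[of "leg k"] leg legs_m[of "leg k" k] by simp
  ultimately show ?thesis using vs_eq[OF k] leg by simp
next
  case False
  then have "1 < card (legs k)" using ne unfolding lc_def
    by (metis One_nat_def card_eq_0_iff finite_legs less_one linorder_neqE_nat)
  have "c0 \<le> Lf e" if "e \<in> legs k" for e using Lf_ge legs_m that all0 by blast
  then have "of_nat (card (legs k)) * c0 \<le> sum Lf (legs k)" by (intro sum_bounded_below) auto
  moreover have "2 * c0 \<le> card (legs k) * c0" using \<open>1 < card (legs k)\<close> by (intro mult_right_mono) auto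
  ultimately have "2 * c0 \<le> sum Lf (legs k)" by (simp only: of_nat_id)
  then show ?thesis using vs_eq[OF k] psum_ge[OF k] c0_gt nhigh_le(1) by linarith
qed

text \<open>The total is the partial sum by which the queue is sorted plus the label given to
  position \<open>u\<close>.\<close>

lemma vs_big_queue:
  assumes k: "k < r" and e: "e \<in> legs k" "L0 e = 0"
  obtains u where "u < q" "stem (Q' u) = X k" "vs k = vsum L (X k) + (c + u)"
proof -
  from fillingD(9)[OF filling k e] obtain e' where e': "e' \<in> legs k" "L e' = 0" by blast
  then have "card {e \<in> legs k. L e = 0} = 1" using fillingD(8)[OF filling k] legs_m by blast
  then obtain x where "{e \<in> legs k. L e = 0} = {x}" by (rule card_1_singletonE)
  then have one: "{e \<in> legs k. L e = 0} = {e'}" using e' by (metis (mono_tags, lifting) mem_Collect_eq singletonD)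
  have "e' \<in> Q' ` {..<q}" unfolding Q'_image using e' legs_m by blast
  then obtain u where u: "u < q" "e' = Q' u" by auto
  have "stem (Q' u) = X k" using e' u by (simp add: legs_def)
  moreover have "vs k = vsum L (X k) + (c + u)"
  proof -
    have split: "legs k = insert e' (legs k - {e'})" using e' by auto
    have "sum Lf (legs k - {e'}) = sum L (legs k - {e'})"
      by (rule sum.cong) (use one legs_m Lf_old in auto)
    moreover have "psum Lf k = psum L k"
      using Lf_Ed fillingD(1)[OF filling] Ed_m Ed_labelled k by (simp add: psum_def)
    moreover have "sum Lf (legs k) = Lf e' + sum Lf (legs k - {e'})" "sum L (legs k) = L e' + sum L (legs k - {e'})"
      using e' by (auto simp: sum.remove)
    ultimately show ?thesis using vsum_X[OF k] Lf_new[OF u(1)] u e' by (simp add: vs_def)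
  qed
  ultimately show ?thesis using that u by blast
qed

lemma vs_inj_aux:
  assumes "k < r" "k' < r" "k \<noteq> k'" 
    and light: "legs k = {}"
  shows "vs k \<noteq> vs k'"
proof -
  have k: "vs k = psum L0 k" using vs_light assms by simp
  consider "legs k' = {}" | e where "e \<in> legs k'" "L0 e \<noteq> 0" | "legs k' \<noteq> {}" "\<And>e. e \<in> legs k' \<Longrightarrow> L0 e = 0" by blast
  then show ?thesis
  proof cases
    case 1
    then show ?thesis using k vs_light[of k'] assms psum_mono[of k k'] psum_mono[of k' k]
      by (cases k k' rule: linorder_cases) auto
  next
    case 2
    from vs_special[OF assms(2) 2] obtain t where t: "0 < t" "t < r" "psum L0 (t - 1) < vs k'" "vs k' < psum L0 t" by blast
    have "psum L0 k \<le> psum L0 (t - 1) \<or> psum L0 t \<le> psum L0 k"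
      using psum_mono_le[of k "t - 1"] psum_mono_le[of t k] t assms(1) by (cases "k < t") auto
    then show ?thesis using t k by linarith
  next
    case 3
    then show ?thesis using vs_big[OF assms(2) 3] k psum_le[OF assms(1)] by simp
  qed
qed

text \<open>A vertex has no legs, a leg labelled by the sweep, or only later legs. Two of the second
  kind have different \<open>t\<close> and so lie in disjoint intervals between path sums. Two of
  the third kind add strictly increasing labels to nondecreasing partial sums.\<close>

lemma vs_inj:
  assumes "k < r" "k' < r" "vs k = vs k'"
  shows "k = k'"
proof (rule ccontr)
  assume ne: "k \<noteq> k'"
  have special_less: "vs k < m + c0" if "k < r" "e \<in> legs k" "L0 e \<noteq> 0" for k e
    using vs_special[OF that] psum_le by (metis less_trans)
  have c: "legs k \<noteq> {}" "legs k' \<noteq> {}" using vs_inj_aux[of k k'] vs_inj_aux[of k' k] assms ne by auto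
  \<comment> \<open>The totals of the second kind stay below \<open>m + c0\<close>, those of the
    third do not.\<close>
  have sp: "(\<exists>e\<in>legs k. L0 e \<noteq> 0) \<longleftrightarrow> (\<exists>e\<in>legs k'. L0 e \<noteq> 0)"
    using special_less[of k] special_less[of k'] vs_big[of k] vs_big[of k'] c assms by (metis leD)
  show False
  proof (cases "\<exists>e\<in>legs k. L0 e \<noteq> 0")
    case True
    with sp obtain e e' where e: "e \<in> legs k" "L0 e \<noteq> 0" "e' \<in> legs k'" "L0 e' \<noteq> 0" by blast
    obtain t where t: "0 < t" "t < r" "psum L0 k = L0 (Ed t)" "psum L0 (t - 1) < vs k" "vs k < psum L0 t" "high t"
      using vs_special[OF assms(1) e(1,2)] by blast
    obtain t' where t': "0 < t'" "t' < r" "psum L0 k' = L0 (Ed t')" "psum L0 (t' - 1) < vs k'" "vs k' < psum L0 t'" "high t'"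
      using vs_special[OF assms(2) e(3,4)] by blast
    have "t \<noteq> t'" using t(3) t'(3) psum_mono[of k k'] psum_mono[of k' k] assms ne by (cases k k' rule: linorder_cases) auto
    moreover have "\<not> t < t'" 
    proof
      assume "t < t'"
      then have "psum L0 t \<le> psum L0 (t' - 1)" using psum_mono_le[of t "t' - 1"] t' by simp
      then show False using t t' assms(3) by linarith
    qed
    moreover have "\<not> t' < t" 
    proof
      assume "t' < t"
      then have "psum L0 t' \<le> psum L0 (t - 1)" using psum_mono_le[of t' "t - 1"] t by simp
      then show False using t t' assms(3) by linarith
    qed
    ultimately show False by linarith
  next
    case False
    with sp c obtain e e' where e: "e \<in> legs k" "L0 e = 0" "e' \<in> legs k'" "L0 e' = 0" by blast
    obtain u where u: "u < q" "stem (Q' u) = X k" "vs k = vsum L (X k) + (c + u)"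
      using vs_big_queue[OF assms(1) e(1,2)] by blast
    obtain u' where u': "u' < q" "stem (Q' u') = X k'" "vs k' = vsum L (X k') + (c + u')"
      using vs_big_queue[OF assms(2) e(3,4)] by blast
    have "X k \<noteq> X k'" using X_inj assms ne by (auto simp: inj_on_def)
    then have "u \<noteq> u'" using u u' by auto
    then show False using sorted[of u u'] sorted[of u' u] u u' assms(3)
      by (cases u u' rule: linorder_cases) auto
  qed
qed

lemma vsum_leaf:
  assumes "v < n" "v \<notin> X ` {..<r}" "e < m" "v \<in> ei e"
  shows "vsum Lf v = Lf e"
proof -
  have "v \<in> ei e' \<longleftrightarrow> e' = e" if "e' < m" for e' using leaf_edge[OF assms(1,2)] assms that by blast
  then have "vsum Lf v = (\<Sum>e'<m. if e' = e then Lf e else 0)" unfolding vsum_def by (intro sum.cong) auto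
  then show ?thesis using assms(3) by simp
qed

text \<open>A high edge at a leaf can only be \<open>Ed 0\<close>, which carries the smallest high
  label; all other labels at leaves are below the high block.\<close>

lemma vsum_leaf_le:
  assumes "v < n" "v \<notin> X ` {..<r}" "e < m" "v \<in> ei e"
  shows "vsum Lf v \<le> m - nhigh + 1"
proof (cases "e \<in> highs")
  case True
  then obtain i where i: "i \<le> r" "high i" "e = Ed i" by (auto simp: highs_def)
  then have "i = 0" using leaf_Ed[OF assms(2), of i] assms(4) not_high_r by auto
  then show ?thesis using vsum_leaf[OF assms] Lf_Ed[of 0] L0_high[of 0] i by (simp add: hl_def)
next
  case False
  then show ?thesis using vsum_leaf[OF assms] Lf_low_le[OF assms(3)] by simp
qed

theorem inj_vsum: "inj_on (vsum Lf) {..<n}"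
proof (rule inj_onI)
  fix v w assume v: "v \<in> {..<n}" and w: "w \<in> {..<n}" and eq: "vsum Lf v = vsum Lf w"
  have spine: "m - nhigh + 1 < vsum Lf v" if "v \<in> X ` {..<r}" for v
    using that psum_ge vs_eq unfolding vs_def by fastforce
  have le: "vsum Lf v \<le> m - nhigh + 1" if "v < n" "v \<notin> X ` {..<r}" for v
    using leaf_edge[OF that] vsum_leaf_le[OF that] by blast
  show "v = w"
  proof (cases "v \<in> X ` {..<r}")
    case True
    then have "w \<in> X ` {..<r}" using spine[OF True] le[of w] w eq by (metis leD lessThan_iff)
    with True eq show ?thesis using vs_inj unfolding vs_def by auto
  next
    case False
    then have w': "w \<notin> X ` {..<r}" using spine[of w] le[of v] v eq by (metis leD lessThan_iff)
    obtain e where e: "e < m" "v \<in> ei e" using leaf_edge[of v] v False by auto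
    obtain e' where e': "e' < m" "w \<in> ei e'" using leaf_edge[of w] w w' by auto
    have "Lf e = Lf e'" using vsum_leaf[of v e] vsum_leaf[of w e'] v w False w' e e' eq by auto
    then have "e = e'" using bij_Lf e e' by (auto simp: bij_betw_def inj_on_def)
    then show ?thesis using leaf_inj[OF False w' e(2)] e' by simp
  qed
qed

end

section \<open>Caterpillars and their spines\<close>

definition caterpillar_graph :: "'a set \<Rightarrow> 'a set set \<Rightarrow> bool" where
  "caterpillar_graph V E \<longleftrightarrow> simple_graph V E \<and> connected_graph V E \<and> card V \<ge> 3 \<and>
     path_graph (V - leaves V E) (induced_edges E (V - leaves V E))"

lemma caterpillar_imp_graph: "caterpillar V E \<Longrightarrow> caterpillar_graph V E"
  by (simp add: caterpillar_def caterpillar_graph_def graph_tree_def)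

lemma path_graph_image:
  assumes "path_graph V E" "inj_on h V"
  shows "path_graph (h ` V) ((`) h ` E)"
proof -
  from assms(1) obtain p where p: "p \<noteq> []" "distinct p" "V = set p"
    "E = {{p ! i, p ! Suc i} | i. Suc i < length p}" unfolding path_graph_def by blast
  have "(`) h ` E = {{map h p ! i, map h p ! Suc i} | i. Suc i < length (map h p)}"
  proof -
    have "(`) h ` E = {h ` {p ! i, p ! Suc i} | i. Suc i < length p}" unfolding p(4) by blast
    also have "\<dots> = {{map h p ! i, map h p ! Suc i} | i. Suc i < length (map h p)}"
      by (intro Collect_cong ex_cong1) auto
    finally show ?thesis .
  qed
  then show ?thesis unfolding path_graph_def using p assms(2)
    by (intro exI[of _ "map h p"]) (auto simp: distinct_map)
qed

section \<open>Transport along an injective renaming of the vertices\<close>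

context
  fixes h :: "'a \<Rightarrow> 'b" and V :: "'a set" and E :: "'a set set"
  assumes simple: "simple_graph V E" and inj: "inj_on h V"
begin

lemma edge_image_inj: "inj_on ((`) h) E"
proof (rule inj_onI)
  fix e f assume "e \<in> E" "f \<in> E" "h ` e = h ` f"
  moreover have "e \<subseteq> V" "f \<subseteq> V" using simple \<open>e \<in> E\<close> \<open>f \<in> E\<close> by (auto simp: simple_graph_def)
  ultimately show "e = f" using inj_on_image_eq_iff[OF inj] by blast
qed

lemma incident_edges_image:
  assumes "u \<in> V"
  shows "incident_edges ((`) h ` E) (h u) = (`) h ` incident_edges E u"
proof -
  have "h u \<in> h ` e \<longleftrightarrow> u \<in> e" if "e \<in> E" for e
  proof -
    have "e \<subseteq> V" using simple that by (auto simp: simple_graph_def)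
    then show ?thesis using inj_on_image_mem_iff[OF inj assms] by blast
  qed
  then show ?thesis unfolding incident_edges_def by blast
qed

lemma incident_edges_inj: "inj_on ((`) h) (incident_edges E u)"
  by (rule inj_on_subset[OF edge_image_inj]) (auto simp: incident_edges_def)

lemma leaves_image: "leaves (h ` V) ((`) h ` E) = h ` leaves V E"
proof -
  have "card (incident_edges ((`) h ` E) (h u)) = card (incident_edges E u)" if "u \<in> V" for u
    using incident_edges_image[OF that] card_image[OF incident_edges_inj] by simp
  then show ?thesis unfolding leaves_def by auto
qed

lemma caterpillar_graph_image:
  assumes "caterpillar_graph V E"
  shows "caterpillar_graph (h ` V) ((`) h ` E)"
proof -
  have sub: "e \<subseteq> V" if "e \<in> E" for e using simple that by (auto simp: simple_graph_def)
  have "simple_graph (h ` V) ((`) h ` E)"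
    unfolding simple_graph_def
  proof (intro conjI ballI)
    show "finite (h ` V)" using simple by (simp add: simple_graph_def)
    fix f assume "f \<in> (`) h ` E"
    then obtain e where e: "e \<in> E" "f = h ` e" by blast
    then have "card e = 2" using simple by (simp add: simple_graph_def)
    then show "card f = 2" using e card_image[OF inj_on_subset[OF inj sub[OF e(1)]]] by simp
    show "f \<subseteq> h ` V" using e sub by blast
  qed
  moreover have "connected_graph (h ` V) ((`) h ` E)"
  proof -
    have "(h u, h v) \<in> {(x, y). {x, y} \<in> (`) h ` E}\<^sup>*" if "(u, v) \<in> {(x, y). {x, y} \<in> E}\<^sup>*" for u v
      using that
    proof (induction rule: rtrancl_induct)
      case (step y z)
      then have "{h y, h z} \<in> (`) h ` E" by (intro image_eqI[of _ _ "{y, z}"]) auto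
      then have "(h y, h z) \<in> {(x, y). {x, y} \<in> (`) h ` E}" by simp
      with step.IH show ?case by (rule rtrancl_into_rtrancl)
    qed simp
    then show ?thesis using assms by (auto simp: caterpillar_graph_def connected_graph_def)
  qed
  moreover have "card (h ` V) \<ge> 3" using assms card_image[OF inj] by (simp add: caterpillar_graph_def)
  moreover have "path_graph (h ` V - leaves (h ` V) ((`) h ` E))
     (induced_edges ((`) h ` E) (h ` V - leaves (h ` V) ((`) h ` E)))"
  proof -
    have sp: "h ` V - leaves (h ` V) ((`) h ` E) = h ` (V - leaves V E)"
      unfolding leaves_image by (rule inj_on_image_set_diff[OF inj, symmetric]) (auto simp: leaves_def)
    have "h ` e \<subseteq> h ` (V - leaves V E) \<longleftrightarrow> e \<subseteq> V - leaves V E" if "e \<in> E" for e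
    proof
      assume a: "h ` e \<subseteq> h ` (V - leaves V E)"
      show "e \<subseteq> V - leaves V E"
      proof
        fix x assume "x \<in> e"
        then have "x \<in> V" "h x \<in> h ` (V - leaves V E)" using a sub[OF that] by auto
        then show "x \<in> V - leaves V E" using inj_on_image_mem_iff[OF inj, of x "V - leaves V E"] by simp
      qed
    qed auto
    then have "induced_edges ((`) h ` E) (h ` (V - leaves V E)) = (`) h ` induced_edges E (V - leaves V E)"
      unfolding induced_edges_def by blast
    then show ?thesis unfolding sp
      using path_graph_image[of "V - leaves V E" _ h] assms inj_on_subset[OF inj]
      by (auto simp: caterpillar_graph_def)
  qed
  ultimately show ?thesis by (simp add: caterpillar_graph_def)
qed

lemma antimagic_labeling_pullback:
  assumes "antimagic_labeling (h ` V) ((`) h ` E) \<phi>"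
  shows "antimagic_labeling V E (\<lambda>e. \<phi> (h ` e))"
proof -
  have "bij_betw (\<phi> \<circ> (`) h) E {1..card E}"
    using assms card_image[OF edge_image_inj] edge_image_inj
    by (intro bij_betw_trans[of _ _ "(`) h ` E"]) (auto simp: antimagic_labeling_def bij_betw_def)
  moreover have "vertex_sum E (\<lambda>e. \<phi> (h ` e)) u = vertex_sum ((`) h ` E) \<phi> (h u)" if "u \<in> V" for u
    unfolding vertex_sum_def incident_edges_image[OF that]
    by (simp add: sum.reindex[OF incident_edges_inj])
  moreover have "inj_on (vertex_sum ((`) h ` E) \<phi> \<circ> h) V"
    using assms inj by (auto simp: antimagic_labeling_def intro: comp_inj_on)
  ultimately show ?thesis unfolding antimagic_labeling_def comp_def
    by (auto simp: inj_on_def)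
qed

end

lemma edge_list_exists:
  assumes "simple_graph V E"
  shows "\<exists>es. edge_list E es"
proof -
  have fin: "finite E"
    using assms finite_subset[of E "Pow V"] by (auto simp: simple_graph_def)
  then obtain xs where xs: "set xs = E" "distinct xs" using finite_distinct_list by blast
  have "\<exists>p. edge p = e" if "e \<in> E" for e
  proof -
    from that assms have "card e = 2" by (auto simp: simple_graph_def)
    then obtain x y where "e = {x, y}" by (auto simp: card_2_iff)
    then show ?thesis by (intro exI[of _ "(x, y)"]) (simp add: edge_def)
  qed
  then obtain f where f: "edge (f e) = e" if "e \<in> E" for e by metis
  have "map edge (map f xs) = xs" using f xs by (auto intro: map_idI)
  then show ?thesis unfolding edge_list_def using xs by metis
qed

section \<open>Degrees, pendant edges and spine of a caterpillar given by an edge list\<close>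

locale cat_input =
  fixes n :: nat and E :: "nat set set" and es :: "(nat \<times> nat) list"
  assumes cat: "caterpillar_graph {..<n} E" and es: "edge_list E es"
begin

definition m :: nat where "m = length es"
definition U :: "nat \<Rightarrow> nat" where "U i = fst (es ! i)"
definition V :: "nat \<Rightarrow> nat" where "V i = snd (es ! i)"
definition ei :: "nat \<Rightarrow> nat set" where "ei i = {U i, V i}"

lemma ei_edge: "ei i = edge (es ! i)"
  by (simp add: ei_def edge_def U_def V_def)

lemma ei_image: "ei ` {..<m} = E"
proof -
  have "ei ` {..<m} = edge ` set es" by (auto simp: ei_edge m_def set_conv_nth)
  then show ?thesis using es by (simp add: edge_list_def)
qed

lemma ei_inj: "inj_on ei {..<m}"
  using es by (auto simp: edge_list_def m_def ei_edge inj_on_def distinct_conv_nth)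

lemma n3: "3 \<le> n"
  using cat by (simp add: caterpillar_graph_def)

lemma UV: assumes "i < m" shows "U i < n" "V i < n" "U i \<noteq> V i"
proof -
  have "ei i \<in> E" using ei_image assms by blast
  then have "ei i \<subseteq> {..<n}" "card (ei i) = 2"
    using cat by (auto simp: caterpillar_graph_def simple_graph_def)
  then show "U i < n" "V i < n" "U i \<noteq> V i" by (auto simp: ei_def)
qed

definition deg :: "nat \<Rightarrow> nat" where "deg v = (\<Sum>i<m. if v \<in> ei i then 1 else 0)"

lemma incident_eq: "incident_edges E v = ei ` {i \<in> {..<m}. v \<in> ei i}"
  unfolding incident_edges_def ei_image[symmetric] by blast

lemma ei_inj': "inj_on ei {i \<in> {..<m}. P i}"
  by (rule inj_on_subset[OF ei_inj]) auto

lemma deg_card': "deg v = card {i \<in> {..<m}. v \<in> ei i}"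
  by (simp add: deg_def sum.inter_filter[symmetric])

lemma deg_card: "deg v = card (incident_edges E v)"
  unfolding deg_card' incident_eq using card_image[OF ei_inj'] by simp

lemma leaves_eq: "leaves {..<n} E = {v. v < n \<and> deg v = 1}"
  by (auto simp: leaves_def deg_card)

lemma connected:
  assumes "u < n" "v < n"
  shows "(u, v) \<in> {(x, y). {x, y} \<in> E}\<^sup>*"
  using cat assms by (simp add: caterpillar_graph_def connected_graph_def)

lemma deg_pos: assumes "v < n" shows "1 \<le> deg v"
proof -
  obtain w where w: "w < n" "w \<noteq> v"
    using n3 that[of 0] that[of 1] by (cases "v = 0") auto
  from connected[OF assms w(1)] obtain y where "{v, y} \<in> E"
    using w(2) by (auto elim: converse_rtranclE)
  then obtain i where "i < m" "ei i = {v, y}" using ei_image by blast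
  then have "{i \<in> {..<m}. v \<in> ei i} \<noteq> {}" by auto
  then have "deg v \<noteq> 0" unfolding deg_card' by simp
  then show ?thesis by simp
qed

lemma deg1_unique: "deg v = 1 \<Longrightarrow> i < m \<Longrightarrow> j < m \<Longrightarrow> v \<in> ei i \<Longrightarrow> v \<in> ei j \<Longrightarrow> i = j"
proof -
  assume "deg v = 1" and *: "i < m" "j < m" "v \<in> ei i" "v \<in> ei j"
  then obtain x where "{i \<in> {..<m}. v \<in> ei i} = {x}" unfolding deg_card' by (metis card_1_singletonE)
  then have "i \<in> {x}" "j \<in> {x}" using * by blast+
  then show ?thesis by simp
qed

text \<open>An edge joining two leaves would be a whole connected component, but there are at least
  three vertices.\<close>

lemma not_both_leaves:
  assumes i: "i < m" and "deg (U i) = 1" "deg (V i) = 1"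
  shows False
proof -
  have "w \<in> {U i, V i}" if "(U i, w) \<in> {(x, y). {x, y} \<in> E}\<^sup>*" for w
    using that
  proof (induction rule: rtrancl_induct)
    case (step y z)
    then obtain j where j: "j < m" "ei j = {y, z}" using ei_image by blast
    have "y \<in> ei j" "y \<in> ei i" using j step.IH by (auto simp: ei_def)
    then have "i = j" using deg1_unique[of y i j] i j step.IH assms by auto
    then show ?case using j by (auto simp: ei_def)
  qed simp
  then have "{..<n} \<subseteq> {U i, V i}" using connected[OF UV(1)[OF i]] by blast
  then have "card {..<n} \<le> card {U i, V i}" by (intro card_mono) auto
  also have "\<dots> \<le> 2" by (simp add: card_insert_if)
  finally show False using n3 by simp
qed

definition pend :: "nat \<Rightarrow> bool" where "pend i \<longleftrightarrow> deg (U i) = 1 \<or> deg (V i) = 1"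
text \<open>Meaningful on pendant edges; elsewhere it defaults to the first end.\<close>

definition stem :: "nat \<Rightarrow> nat" where "stem i = (if deg (U i) = 1 then V i else U i)"
definition tip :: "nat \<Rightarrow> nat" where "tip i = (if deg (U i) = 1 then U i else V i)"

lemma pend_props:
  assumes "i < m" "pend i"
  shows "ei i = {stem i, tip i}" "deg (stem i) \<noteq> 1" "deg (tip i) = 1" "stem i < n" "tip i < n"
  using assms not_both_leaves[OF assms(1)] UV[OF assms(1)]
  by (auto simp: ei_def stem_def tip_def pend_def)

lemma stem_n: "i < m \<Longrightarrow> stem i < n"
  using UV by (simp add: stem_def)

definition spine :: "nat list \<Rightarrow> bool" where
  "spine p \<longleftrightarrow> p \<noteq> [] \<and> distinct p \<and> set p = {v. v < n \<and> deg v \<noteq> 1} \<and>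
     {e \<in> E. e \<subseteq> set p} = {{p ! k, p ! Suc k} | k. Suc k < length p}"

lemma spine_exists: "\<exists>p. spine p"
proof -
  have eq: "{..<n} - leaves {..<n} E = {v. v < n \<and> deg v \<noteq> 1}" by (auto simp: leaves_eq)
  from cat have "path_graph {v. v < n \<and> deg v \<noteq> 1} {e \<in> E. e \<subseteq> {v. v < n \<and> deg v \<noteq> 1}}"
    unfolding caterpillar_graph_def eq induced_edges_def by blast
  then obtain p where "p \<noteq> []" "distinct p" "{v. v < n \<and> deg v \<noteq> 1} = set p"
    "{e \<in> E. e \<subseteq> {v. v < n \<and> deg v \<noteq> 1}} = {{p ! k, p ! Suc k} | k. Suc k < length p}"
    unfolding path_graph_def by blast
  then have "spine p" unfolding spine_def by simp
  then show ?thesis ..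
qed

text \<open>The program may find either end of the spine first, so the order must be
  reversible.\<close>

lemma spine_rev: assumes "spine p" shows "spine (rev p)"
proof -
  have "{{p ! k, p ! Suc k} | k. Suc k < length p} \<subseteq> {{rev p ! k, rev p ! Suc k} | k. Suc k < length p}" for p :: "nat list"
  proof
    fix e assume "e \<in> {{p ! k, p ! Suc k} | k. Suc k < length p}"
    then obtain k where k: "e = {p ! k, p ! Suc k}" "Suc k < length p" by blast
    let ?j = "length p - Suc (Suc k)"
    have "rev p ! ?j = p ! Suc k" "rev p ! Suc ?j = p ! k" "Suc ?j < length p"
      using k(2) by (auto simp: rev_nth Suc_diff_Suc)
    then show "e \<in> {{rev p ! k, rev p ! Suc k} | k. Suc k < length p}"
      unfolding k(1) mem_Collect_eq by (intro exI[of _ ?j]) auto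
  qed
  from this[of p] this[of "rev p"]
  have "{{p ! k, p ! Suc k} | k. Suc k < length p} = {{rev p ! k, rev p ! Suc k} | k. Suc k < length p}"
    by auto
  then show ?thesis using assms
    unfolding spine_def set_rev distinct_rev rev_is_Nil_conv length_rev by metis
qed

end

section \<open>A caterpillar with a fixed order of its spine\<close>

locale cat_spine = cat_input +
  fixes p :: "nat list"
  assumes spine: "spine p"
begin

definition r :: nat where "r = length p"

lemma p_facts: "p \<noteq> []" "distinct p" "set p = {v. v < n \<and> deg v \<noteq> 1}"
  "{e \<in> E. e \<subseteq> set p} = {{p ! k, p ! Suc k} | k. Suc k < r}"
  using spine unfolding spine_def r_def by metis+

lemma r_pos: "0 < r"
  using p_facts(1) by (simp add: r_def)

lemma p_nth: "k < r \<Longrightarrow> p ! k < n" "k < r \<Longrightarrow> deg (p ! k) \<noteq> 1"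
  using p_facts(3) nth_mem[of k p] by (auto simp: r_def)

lemma p_eq: "k < r \<Longrightarrow> j < r \<Longrightarrow> p ! k = p ! j \<longleftrightarrow> k = j"
  using p_facts(2) by (simp add: nth_eq_iff_index_eq r_def)

lemma p_ex: "v < n \<Longrightarrow> deg v \<noteq> 1 \<Longrightarrow> \<exists>k<r. v = p ! k"
  using p_facts(3) by (auto simp: r_def set_conv_nth)

lemma p_image: "(\<lambda>k. p ! k) ` {..<r} = {v. v < n \<and> deg v \<noteq> 1}"
  unfolding p_facts(3)[symmetric] by (auto simp: r_def set_conv_nth)

definition se :: "nat \<Rightarrow> nat" where "se k = (THE i. i < m \<and> ei i = {p ! k, p ! Suc k})"

lemma se_props:
  assumes "Suc k < r"
  shows "se k < m" "ei (se k) = {p ! k, p ! Suc k}" "\<not> pend (se k)"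
proof -
  have "{p ! k, p ! Suc k} \<in> E" using p_facts(4) assms by blast
  then obtain i where i: "i < m" "ei i = {p ! k, p ! Suc k}" using ei_image by (metis image_iff lessThan_iff)
  have "se k = i" unfolding se_def
    by (rule the_equality) (use i ei_inj in \<open>auto simp: inj_on_def\<close>)
  then show se: "se k < m" "ei (se k) = {p ! k, p ! Suc k}" using i by auto
  have "U (se k) \<in> {p ! k, p ! Suc k}" "V (se k) \<in> {p ! k, p ! Suc k}" using se(2) by (auto simp: ei_def)
  then show "\<not> pend (se k)" using p_nth(2)[of k] p_nth(2)[of "Suc k"] assms by (auto simp: pend_def)
qed

lemma not_pend_ex:
  assumes "i < m" "\<not> pend i"
  shows "\<exists>k. Suc k < r \<and> i = se k"
proof -
  have "ei i \<in> {e \<in> E. e \<subseteq> set p}"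
    using assms UV[OF assms(1)] p_facts(3) ei_image by (auto simp: ei_def pend_def)
  then obtain k where k: "Suc k < r" "ei i = {p ! k, p ! Suc k}" unfolding p_facts(4) by blast
  then have "i = se k" using se_props[OF k(1)] assms(1) ei_inj by (auto simp: inj_on_def)
  then show ?thesis using k by blast
qed

lemma p_in_se: "k < r \<Longrightarrow> Suc j < r \<Longrightarrow> p ! k \<in> ei (se j) \<longleftrightarrow> k = j \<or> k = Suc j"
  using se_props(2)[of j] p_eq by auto

lemma se_eq: "Suc k < r \<Longrightarrow> Suc j < r \<Longrightarrow> se k = se j \<longleftrightarrow> k = j"
  using p_in_se[of k j] p_in_se[of "Suc k" j] p_in_se[of k k] p_in_se[of "Suc k" k] by auto

text \<open>With \<open>g\<close> constantly 1 this counts the spine edges at a vertex; with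
  \<open>g\<close> the identity it evaluates the index sum from which the walk recovers the next
  edge.\<close>

lemma sum_spine_edges:
  fixes g :: "nat \<Rightarrow> nat"
  assumes "k < r"
  shows "(\<Sum>i<m. if \<not> pend i \<and> p ! k \<in> ei i then g i else 0) =
    (if 0 < k then g (se (k - 1)) else 0) + (if Suc k < r then g (se k) else 0)"
proof -
  let ?A = "if 0 < k then {se (k - 1)} else {}" and ?B = "if Suc k < r then {se k} else {}"
  have "{i \<in> {..<m}. \<not> pend i \<and> p ! k \<in> ei i} = ?A \<union> ?B"
  proof (intro equalityI subsetI)
    fix i assume "i \<in> {i \<in> {..<m}. \<not> pend i \<and> p ! k \<in> ei i}"
    then obtain j where "Suc j < r" "i = se j" "k = j \<or> k = Suc j"
      using not_pend_ex p_in_se[OF assms] by blast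
    then show "i \<in> ?A \<union> ?B" by auto
  next
    fix i assume "i \<in> ?A \<union> ?B"
    then consider "0 < k" "i = se (k - 1)" | "Suc k < r" "i = se k" by (auto split: if_splits)
    then show "i \<in> {i \<in> {..<m}. \<not> pend i \<and> p ! k \<in> ei i}"
      using se_props p_in_se[OF assms] assms by cases auto
  qed
  moreover have "?A \<inter> ?B = {}" using se_eq[of "k - 1" k] by auto
  ultimately have "sum g {i \<in> {..<m}. \<not> pend i \<and> p ! k \<in> ei i} = sum g ?A + sum g ?B"
    by (simp only: sum.union_disjoint finite.intros if_split) (rule sum.union_disjoint; auto)
  then show ?thesis by (auto simp: sum.inter_filter[symmetric])
qed

definition lcnt :: "nat \<Rightarrow> nat" where "lcnt v = (\<Sum>i<m. if pend i \<and> stem i = v then 1 else 0)"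

lemma p_in_pend: "i < m \<Longrightarrow> pend i \<Longrightarrow> k < r \<Longrightarrow> p ! k \<in> ei i \<longleftrightarrow> stem i = p ! k"
  using pend_props(1,3)[of i] p_nth(2)[of k] by (metis insert_iff singletonD)

lemma deg_p:
  assumes "k < r"
  shows "deg (p ! k) = (if 0 < k then 1 else 0) + (if Suc k < r then 1 else 0) + lcnt (p ! k)"
proof -
  have "deg (p ! k) = (\<Sum>i<m. (if \<not> pend i \<and> p ! k \<in> ei i then 1 else 0) + (if pend i \<and> stem i = p ! k then 1 else 0))"
    unfolding deg_def by (rule sum.cong) (use p_in_pend[OF _ _ assms] in auto)
  then show ?thesis using sum_spine_edges[OF assms, of "\<lambda>_. 1"] by (simp add: sum.distrib lcnt_def)
qed

text \<open>A spine vertex has degree at least 2, but an end of the spine has at most one spine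
  edge, and none if \<open>r = 1\<close>. Pendant edges make up the rest.\<close>

lemma lcnt_ends:
  "0 < lcnt (p ! 0)" "0 < lcnt (p ! (r - 1))" "r = 1 \<Longrightarrow> 1 < lcnt (p ! 0)"
  using deg_p[of 0] deg_p[of "r - 1"] r_pos p_nth[of 0] p_nth[of "r - 1"] deg_pos[of "p ! 0"] deg_pos[of "p ! (r - 1)"]
  by (auto split: if_splits)

text \<open>Pendant edges have distinct leaves as tips, so there are at most \<open>n - r\<close> of
  them; the other edges join the \<open>r - 1\<close> consecutive pairs of the spine.\<close>

lemma m_less_n: "m < n"
proof -
  have "{..<m} = {i \<in> {..<m}. pend i} \<union> se ` {k. Suc k < r}"
    using not_pend_ex se_props by blast
  then have "m = card ({i \<in> {..<m}. pend i} \<union> se ` {k. Suc k < r})" by (metis card_lessThan)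
  also have "\<dots> \<le> card {i \<in> {..<m}. pend i} + card (se ` {k. Suc k < r})" by (rule card_Un_le)
  also have "card (se ` {k. Suc k < r}) \<le> card {k. Suc k < r}"
    by (rule card_image_le) (auto intro: finite_subset[of _ "{..<r}"])
  also have "{k. Suc k < r} = {..<r - 1}" by auto
  also have "card {i \<in> {..<m}. pend i} \<le> card {v. v < n \<and> deg v = 1}"
  proof (rule card_inj_on_le[of tip])
    show "inj_on tip {i \<in> {..<m}. pend i}"
    proof (rule inj_onI)
      fix i j assume *: "i \<in> {i \<in> {..<m}. pend i}" "j \<in> {i \<in> {..<m}. pend i}" "tip i = tip j"
      then have "tip i \<in> ei i" "tip i \<in> ei j" "deg (tip i) = 1" using pend_props[of i] pend_props[of j] by auto
      then show "i = j" using deg1_unique * by blast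
    qed
  qed (use pend_props in auto)
  also have "{v. v < n \<and> deg v = 1} = {..<n} - set p" using p_facts(3) by auto
  also have "card \<dots> = n - r"
  proof -
    have "set p \<subseteq> {..<n}" using p_facts(3) by blast
    then have "card ({..<n} - set p) = card {..<n} - card (set p)" by (intro card_Diff_subset) auto
    then show ?thesis using distinct_card[OF p_facts(2)] by (simp add: r_def)
  qed
  finally have "m \<le> n - r + (r - 1)" by simp
  moreover have "card (set p) \<le> card {..<n}" by (rule card_mono) (use p_facts(3) in blast)+
  then have "r \<le> n" using distinct_card[OF p_facts(2)] by (simp add: r_def)
  ultimately show ?thesis using r_pos by linarith
qed

end

text \<open>\<open>a0\<close> and \<open>a1\<close> extend the spine at its ends. The assumption
  \<open>ne\<close> matters for \<open>r = 1\<close>, where both hang at the same vertex.\<close>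

locale cat_path = cat_spine +
  fixes a0 a1 :: nat
  assumes a0: "a0 < m" "pend a0" "stem a0 = p ! 0"
    and a1: "a1 < m" "pend a1" "stem a1 = p ! (r - 1)"
    and ne: "a0 \<noteq> a1"
begin

definition Ed :: "nat \<Rightarrow> nat" where
  "Ed i = (if i = 0 then a0 else if i = r then a1 else se (i - 1))"

lemma Ed_cases:
  assumes "i \<le> r"
  obtains "i = 0" "Ed i = a0" | "i = r" "i \<noteq> 0" "Ed i = a1" | j where "i = Suc j" "Suc j < r" "Ed i = se j"
proof -
  consider "i = 0" | "i = r" "i \<noteq> 0" | j where "i = Suc j" "Suc j < r"
    using assms by (cases i) (auto simp: le_less)
  then show ?thesis using that by cases (auto simp: Ed_def)
qed

lemma Ed_pend: "i \<le> r \<Longrightarrow> pend (Ed i) \<longleftrightarrow> i = 0 \<or> i = r"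
  using a0 a1 se_props by (auto elim: Ed_cases)

lemma r_less_n: "r < n"
proof -
  have "tip a0 < n" "deg (tip a0) = 1" using pend_props a0 by auto
  then have "tip a0 \<in> {..<n} - set p" "set p \<subseteq> {..<n}" using p_facts(3) by auto
  then have "card (set p) < card {..<n}" by (intro psubset_card_mono) blast+
  then show ?thesis using distinct_card[OF p_facts(2)] by (simp add: r_def)
qed

lemma not_Ed_pend: "e < m \<Longrightarrow> e \<notin> Ed ` {..r} \<Longrightarrow> pend e"
proof (rule ccontr)
  assume *: "e < m" "e \<notin> Ed ` {..r}" "\<not> pend e"
  then obtain k where k: "Suc k < r" "e = se k" using not_pend_ex by blast
  then have "e = Ed (Suc k)" by (simp add: Ed_def)
  then show False using * k by auto
qed

sublocale layout n m r ei "\<lambda>k. p ! k" Ed stem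
proof
  show "0 < r" "m < n" "r < n" using r_pos m_less_n r_less_n .
  show "inj_on ((!) p) {..<r}" using p_eq by (auto simp: inj_on_def)
  show "p ! k < n" if "k < r" for k using p_nth that by simp
  show "inj_on Ed {..r}"
  proof (rule inj_onI)
    fix i j assume i: "i \<in> {..r}" and j: "j \<in> {..r}" and eq: "Ed i = Ed j"
    then have "i \<le> r" "j \<le> r" by auto
    then have p: "pend (Ed i) \<longleftrightarrow> i = 0 \<or> i = r" "pend (Ed j) \<longleftrightarrow> j = 0 \<or> j = r" using Ed_pend by auto
    show "i = j"
    proof (cases "pend (Ed i)")
      case True
      then have "i = 0 \<or> i = r" "j = 0 \<or> j = r" using p eq by auto
      then show ?thesis using eq ne r_pos by (auto simp: Ed_def)
    next
      case False
      then have "0 < i" "i < r" "0 < j" "j < r" using p eq \<open>i \<le> r\<close> \<open>j \<le> r\<close> by auto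
      then show ?thesis using eq se_eq[of "i - 1" "j - 1"] by (simp add: Ed_def)
    qed
  qed
  show "Ed i < m" if "i \<le> r" for i using that a0 a1 se_props by (cases rule: Ed_cases) auto
  show "p ! k \<in> ei (Ed i) \<longleftrightarrow> i = k \<or> i = Suc k" if "k < r" "i \<le> r" for k i
    using that(2)
  proof (cases rule: Ed_cases)
    case 1
    then show ?thesis using p_in_pend[of a0 k] a0 that p_eq[of 0 k] r_pos by auto
  next
    case 2
    then show ?thesis using p_in_pend[of a1 k] a1 that p_eq[of "r - 1" k] r_pos by auto
  next
    case (3 j)
    then show ?thesis using p_in_se[OF that(1), of j] by auto
  qed
  show "p ! k \<in> ei e \<longleftrightarrow> stem e = p ! k" if "k < r" "e < m" "e \<notin> Ed ` {..r}" for k e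
    using p_in_pend[of e k] not_Ed_pend that by blast
  show "\<exists>k<r. stem e = p ! k" if "e < m" "e \<notin> Ed ` {..r}" for e
    using p_ex pend_props[of e] not_Ed_pend that by blast
  show "\<exists>!e. e < m \<and> v \<in> ei e" if "v < n" "v \<notin> (!) p ` {..<r}" for v
  proof -
    have "deg v = 1" using that p_image by auto
    then have "card {i \<in> {..<m}. v \<in> ei i} = 1" by (simp add: deg_card')
    then obtain e where "{i \<in> {..<m}. v \<in> ei i} = {e}" by (rule card_1_singletonE)
    then have "i < m \<and> v \<in> ei i \<longleftrightarrow> i = e" for i by (auto simp: set_eq_iff)
    then show ?thesis by (intro ex1I[of _ e]) simp_all
  qed
  have leaf_pend: "pend e" "v = tip e" if "v \<notin> (!) p ` {..<r}" "v \<in> ei e" "e < m" for v e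
  proof -
    have v: "v < n" "deg v = 1" using that p_image UV[of e] by (auto simp: ei_def)
    then show "pend e" using that by (auto simp: pend_def ei_def)
    then show "v = tip e" using pend_props[of e] that v by auto
  qed
  show "v = w" if "v \<notin> (!) p ` {..<r}" "w \<notin> (!) p ` {..<r}" "v \<in> ei e" "w \<in> ei e" "e < m" for v w e
    using leaf_pend(2)[of v e] leaf_pend(2)[of w e] that by simp
  show "i = 0 \<or> i = r" if "v \<notin> (!) p ` {..<r}" "i \<le> r" "v \<in> ei (Ed i)" for v i
    using leaf_pend(1)[of v "Ed i"] that Ed_pend \<open>\<And>i. i \<le> r \<Longrightarrow> Ed i < m\<close> by blast
qed

text \<open>The program counts and sums all pendant edges at a vertex and subtracts the ends of the
  path afterwards. For a single leg the second equation yields its index.\<close>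

lemma lc_eq:
  assumes "k < r"
  shows "lc k = lcnt (p ! k) - (if k = 0 then 1 else 0) - (if Suc k = r then 1 else 0)"
    and "sum id (legs k) = (\<Sum>i<m. if pend i \<and> stem i = p ! k then i else 0) - (if k = 0 then a0 else 0) - (if Suc k = r then a1 else 0)"
proof -
  let ?P = "{i \<in> {..<m}. pend i \<and> stem i = p ! k}"
  let ?A = "if k = 0 then {a0} else {}" and ?B = "if Suc k = r then {a1} else {}"
  have legs: "legs k = ?P - ?A - ?B"
  proof -
    have "e \<notin> Ed ` {..r} \<longleftrightarrow> e \<notin> ?A \<and> e \<notin> ?B" if "e < m" "pend e" "stem e = p ! k" for e
    proof -
      have "e \<in> Ed ` {..r} \<longleftrightarrow> e = a0 \<or> e = a1"
      proof
        assume "e \<in> Ed ` {..r}"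
        then obtain i where i: "i \<le> r" "e = Ed i" by auto
        then have "i = 0 \<or> i = r" using Ed_pend that by blast
        then show "e = a0 \<or> e = a1" using i by (auto simp: Ed_def)
      next
        assume "e = a0 \<or> e = a1"
        moreover have "Ed 0 = a0" "Ed r = a1" using r_pos by (auto simp: Ed_def)
        ultimately show "e \<in> Ed ` {..r}" by (metis atMost_iff image_eqI le0 order_refl)
      qed
      moreover have "k = 0" if "e = a0"
        using \<open>stem e = p ! k\<close> that a0(3) p_eq[OF r_pos assms] by simp
      moreover have "Suc k = r" if "e = a1"
      proof -
        have "r - 1 < r" using r_pos by simp
        from p_eq[OF this assms] show ?thesis using \<open>stem e = p ! k\<close> that a1(3) r_pos by simp
      qed
      ultimately show ?thesis by auto
    qed
    moreover have "pend e" if "e < m" "e \<notin> Ed ` {..r}" for e using not_Ed_pend that .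
    ultimately show ?thesis unfolding legs_def by blast
  qed
  have "stem a1 = p ! k" if "Suc k = r" using a1(3) that by (metis diff_Suc_1)
  then have AP: "?A \<subseteq> ?P" "?B \<subseteq> ?P - ?A" using a0 a1 ne by auto
  show "lc k = lcnt (p ! k) - (if k = 0 then 1 else 0) - (if Suc k = r then 1 else 0)"
  proof -
    have "card (legs k) = card (?P - ?A) - card ?B" unfolding legs using AP by (intro card_Diff_subset) auto
    also have "card (?P - ?A) = card ?P - card ?A" using AP by (intro card_Diff_subset) auto
    also have "card ?P = lcnt (p ! k)" by (simp add: lcnt_def sum.inter_filter[symmetric])
    finally show ?thesis by (simp add: lc_def)
  qed
  have "sum id (legs k) = sum id (?P - ?A) - sum id ?B" unfolding legs using AP by (intro sum_diff_nat) auto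
  also have "sum id (?P - ?A) = sum id ?P - sum id ?A" using AP by (intro sum_diff_nat) auto
  also have "sum id ?P = (\<Sum>i<m. if pend i \<and> stem i = p ! k then i else 0)"
    by (simp add: sum.inter_filter[symmetric])
  finally show "sum id (legs k) = (\<Sum>i<m. if pend i \<and> stem i = p ! k then i else 0) - (if k = 0 then a0 else 0) - (if Suc k = r then a1 else 0)"
    by simp
qed

lemma vertex_sum_eq:
  assumes "\<And>i. i < m \<Longrightarrow> \<phi> (ei i) = L i"
  shows "vertex_sum E \<phi> v = vsum L v"
proof -
  have "vertex_sum E \<phi> v = sum (\<phi> \<circ> ei) {i \<in> {..<m}. v \<in> ei i}"
    unfolding vertex_sum_def incident_eq by (rule sum.reindex[OF ei_inj'])
  also have "\<dots> = sum L {i \<in> {..<m}. v \<in> ei i}" using assms by (intro sum.cong) auto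
  finally show ?thesis unfolding vsum_def by (simp add: sum.inter_filter[symmetric])
qed

lemma labels_antimagic:
  assumes "bij_betw L {..<m} {1..m}" "inj_on (vsum L) {..<n}"
  shows "\<exists>\<phi>. (\<forall>i<m. \<phi> (ei i) = L i) \<and> antimagic_labeling {..<n} E \<phi>"
proof -
  define \<phi> where "\<phi> = L \<circ> the_inv_into {..<m} ei"
  have \<phi>: "\<phi> (ei i) = L i" if "i < m" for i
    using the_inv_into_f_f[OF ei_inj] that by (simp add: \<phi>_def)
  have bij: "bij_betw ei {..<m} E" using ei_inj ei_image by (simp add: bij_betw_def)
  then have "card E = m" using bij_betw_same_card by fastforce
  then have "bij_betw \<phi> E {1..card E}" unfolding \<phi>_def
    using bij_betw_trans[OF bij_betw_the_inv_into[OF bij] assms(1)] by simp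
  moreover have "vertex_sum E \<phi> = vsum L" using vertex_sum_eq[of \<phi> L] \<phi> by blast
  ultimately show ?thesis using \<phi> assms(2)
    unfolding antimagic_labeling_def by (intro exI[of _ \<phi>]) simp
qed

end

section \<open>The program\<close>

definition incr :: "name \<Rightarrow> aexp \<Rightarrow> aexp \<Rightarrow> com" where
  "incr a i e = Write a i (Plus (Read a i) e)"

lemma sem_incr: "sem (incr a i e) s = s\<lparr>arr := (arr s)(a := (arr s a)(aval i s := arr s a (aval i s) + aval e s))\<rparr>"
  by (simp add: incr_def)

lemma safe_incr: "safe W (incr a i e) s \<longleftrightarrow> arr s a (aval i s) + aval e s < W"
  by (simp add: incr_def)

text \<open>
  The arrays hold, per edge: the spine end \<open>S\<close> of a pendant edge and the label \<open>L\<close>; per vertex: the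
  degree \<open>D\<close>, number \<open>G\<close> and index sum \<open>E\<close> of the spine edges, number \<open>C\<close>, index sum \<open>H\<close>, first \<open>A\<close>
  and last \<open>B\<close> of the pendant edges, and the current vertex sum \<open>T\<close>. \<open>X\<close> and \<open>P\<close> list the vertices
  of the spine and the edges of the path, \<open>Z\<close> is the map of the sweep, \<open>Q\<close>, \<open>R\<close>, \<open>O\<close> are the queue
  before, between and after the sorting passes, and \<open>K\<close>, \<open>J\<close> are their counters. The
  index sums replace adjacency lists: on the spine, the next edge is \<open>E\<close> minus the previous one, and
  \<open>H\<close> is the index of a single leg.
\<close>

definition degrees_cmd :: com where
  "degrees_cmd = for_loop ''i'' (Var ''m'')
    (Seq (incr ''D'' (Read ''U'' (Var ''i'')) (Const 1)) (incr ''D'' (Read ''V'' (Var ''i'')) (Const 1)))"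

definition classify_body :: com where
  "classify_body =
    Seq (If (Equal (Read ''D'' (Read ''U'' (Var ''i''))) (Const 1))
          (Assign ''x'' (Read ''V'' (Var ''i''))) (Assign ''x'' (Read ''U'' (Var ''i''))))
    (Seq (Write ''S'' (Var ''i'') (Var ''x''))
    (If (And (Not (Equal (Read ''D'' (Read ''U'' (Var ''i''))) (Const 1)))
             (Not (Equal (Read ''D'' (Read ''V'' (Var ''i''))) (Const 1))))
      (Seq (incr ''E'' (Read ''U'' (Var ''i'')) (Var ''i''))
      (Seq (incr ''E'' (Read ''V'' (Var ''i'')) (Var ''i''))
      (Seq (incr ''G'' (Read ''U'' (Var ''i'')) (Const 1))
           (incr ''G'' (Read ''V'' (Var ''i'')) (Const 1)))))
      (Seq (If (Equal (Read ''C'' (Var ''x'')) (Const 0)) (Write ''A'' (Var ''x'') (Var ''i'')) Skip)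
      (Seq (Write ''B'' (Var ''x'') (Var ''i''))
      (Seq (incr ''C'' (Var ''x'') (Const 1))
           (incr ''H'' (Var ''x'') (Var ''i'')))))))"

definition classify_cmd :: com where "classify_cmd = for_loop ''i'' (Var ''m'') classify_body"

text \<open>A spine vertex with fewer than two spine edges is an end of the spine.\<close>

definition start_body :: com where
  "start_body = If (Not (Equal (Read ''D'' (Var ''i'')) (Const 1)))
     (Seq (Assign ''r'' (Plus (Var ''r'') (Const 1)))
       (If (Less (Read ''G'' (Var ''i'')) (Const 2)) (Assign ''x'' (Var ''i'')) Skip)) Skip"

definition start_cmd :: com where "start_cmd = for_loop ''i'' (Var ''n'') start_body"

text \<open>\<open>''y''\<close> is the previous edge, initially 0, which leaves the index sum
  unchanged. The sum of the ends minus the current vertex is the next vertex. At the last vertex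
  \<open>''z''\<close> becomes 0; the entry of \<open>P\<close> written then is replaced in
  \<open>ends_cmd\<close>.\<close>

definition walk_body :: com where
  "walk_body =
     Seq (Write ''X'' (Var ''i'') (Var ''x''))
    (Seq (Assign ''z'' (Minus (Read ''E'' (Var ''x'')) (Var ''y'')))
    (Seq (Write ''P'' (Plus (Var ''i'') (Const 1)) (Var ''z''))
    (Seq (Assign ''x'' (Minus (Plus (Read ''U'' (Var ''z'')) (Read ''V'' (Var ''z''))) (Var ''x'')))
         (Assign ''y'' (Var ''z'')))))"

definition walk_cmd :: com where "walk_cmd = for_loop ''i'' (Var ''r'') walk_body"

text \<open>Taking the first pendant edge at one end and the last at the other gives different edges
  even on a spine of one vertex.\<close>

definition ends_cmd :: com where
  "ends_cmd =
     Seq (Assign ''x'' (Read ''X'' (Const 0)))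
    (Seq (Assign ''z'' (Read ''A'' (Var ''x'')))
    (Seq (Write ''P'' (Const 0) (Var ''z''))
    (Seq (Write ''C'' (Var ''x'') (Minus (Read ''C'' (Var ''x'')) (Const 1)))
    (Seq (Write ''H'' (Var ''x'') (Minus (Read ''H'' (Var ''x'')) (Var ''z'')))
    (Seq (Assign ''x'' (Read ''X'' (Minus (Var ''r'') (Const 1))))
    (Seq (Assign ''z'' (Read ''B'' (Var ''x'')))
    (Seq (Write ''P'' (Var ''r'') (Var ''z''))
    (Seq (Write ''C'' (Var ''x'') (Minus (Read ''C'' (Var ''x'')) (Const 1)))
    (Seq (Write ''H'' (Var ''x'') (Minus (Read ''H'' (Var ''x'')) (Var ''z'')))
    (Seq (Assign ''b'' (Minus (Var ''m'') (Div (Plus (Var ''r'') (Const 1)) (Const 2))))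
         (Assign ''c'' (Const 1))))))))))))"

section \<open>Degrees, classification of the edges and the start of the spine\<close>

context cat_input
begin

abbreviation W :: nat where "W \<equiv> n ^ 3"

text \<open>\<open>n * n\<close> bounds the sums of indices or labels that are stored, and
  \<open>n\<close> leaves room for one more summand.\<close>

lemma W_bound: "x \<le> n * n + n \<Longrightarrow> x < W"
proof -
  assume "x \<le> n * n + n"
  also have "n * n + n < 3 * (n * n)"
  proof -
    have "n \<le> n * n" by simp
    moreover have "0 < n * n" using n3 by simp
    ultimately show ?thesis by linarith
  qed
  also have "3 * (n * n) \<le> n * (n * n)" using n3 by (intro mult_right_mono) auto
  finally show ?thesis by (simp add: power3_eq_cube mult.assoc)
qed

lemma W_n: "x \<le> n \<Longrightarrow> x < W"
  by (rule W_bound) simp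

definition base :: "ram_state \<Rightarrow> bool" where
  "base s \<longleftrightarrow> var s ''n'' = n \<and> var s ''m'' = m \<and> (\<forall>i<m. arr s ''U'' i = U i \<and> arr s ''V'' i = V i)"

lemma base_agree:
  assumes "base s" "agree vs as s s'" "''n'' \<notin> vs" "''m'' \<notin> vs" "''U'' \<notin> as" "''V'' \<notin> as"
  shows "base s'"
  using assms agree_var[OF assms(2)] agree_arr[OF assms(2)] unfolding base_def by simp

lemma baseD:
  assumes "base s"
  shows "var s ''n'' = n" "var s ''m'' = m" "\<And>i. i < m \<Longrightarrow> arr s ''U'' i = U i" "\<And>i. i < m \<Longrightarrow> arr s ''V'' i = V i"
  using assms by (auto simp: base_def)

lemma m_n: "m < n"
proof -
  obtain p where "spine p" using spine_exists by blast
  then interpret cat_spine n E es p by unfold_locales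
  show ?thesis by (rule m_less_n)
qed

lemma sum_le_square:
  assumes "\<And>j. j < m \<Longrightarrow> f j \<le> m" "k \<le> m"
  shows "(\<Sum>j<k. f j) \<le> n * n"
proof -
  have "(\<Sum>j<k. f j) \<le> of_nat (card {..<k}) * m"
    using assms by (intro sum_bounded_above) auto
  also have "\<dots> \<le> n * n" using assms(2) m_n by (simp add: mult_mono)
  finally show ?thesis .
qed

lemma runs_degrees:
  assumes b: "base s" and D: "\<And>v. arr s ''D'' v = 0"
  shows "\<exists>s'. runs W n degrees_cmd s s' \<and> agree {''i''} {''D''} s s' \<and> arr s' ''D'' = deg"
proof -
  let ?c = "Seq (incr ''D'' (Read ''U'' (Var ''i'')) (Const 1)) (incr ''D'' (Read ''V'' (Var ''i'')) (Const 1))"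
  let ?d = "\<lambda>k v. \<Sum>i<k. if v \<in> ei i then 1 else (0::nat)"
  define I where "I = (\<lambda>k s'. agree {''i''} {''D''} s s' \<and> arr s' ''D'' = ?d k)"
  have "\<exists>s'. runs W n (for_loop ''i'' (Var ''m'') ?c) s s' \<and> I m s' \<and> var s' ''i'' = m"
  proof (rule runs_for_loop, goal_cases)
    show "I 0 (s\<lparr>var := (var s)(''i'' := 0)\<rparr>)" using D by (simp add: I_def agree_def fun_eq_iff)
  next
    case (2 k t)
    then have k: "k < m" and I: "I k t" and vi: "var t ''i'' = k" by auto
    from I have ag: "agree {''i''} {''D''} s t" and Dt: "arr t ''D'' = ?d k" by (auto simp: I_def)
    have bt: "base t" using base_agree[OF b ag] by simp
    note f = baseD(3,4)[OF bt k]
    have upd: "(?d k)(U k := Suc (?d k (U k)), V k := Suc (?d k (V k))) = ?d (Suc k)"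
      using UV(3)[OF k] by (auto simp: fun_eq_iff ei_def)
    have sem: "sem ?c t = t\<lparr>arr := (arr t)(''D'' := ?d (Suc k))\<rparr>"
      unfolding upd[symmetric] using UV(3)[OF k] by (simp add: sem_incr vi f Dt)
    have le: "?d k v < W - 1" for v
    proof -
      have "?d k v \<le> n * n" by (rule sum_le_square) (use k in auto)
      then show ?thesis using W_bound[of "Suc (?d k v)"] n3 by simp
    qed
    have "safe W ?c t" using le[of "U k"] le[of "V k"] UV(3)[OF k] unfolding less_diff_conv by (simp add: sem_incr safe_incr vi f Dt)
    then show ?case
      using ag unfolding sem by (simp add: vi I_def agree_def)
  next
    fix k t assume "I k t"
    then have "agree {''i''} {''D''} s t" by (simp add: I_def)
    from agree_var[OF this, of "''m''"] baseD(2)[OF b] show "aval (Var ''m'') t = m" by simp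
  qed (use m_n W_n in auto)
  then show ?thesis unfolding degrees_cmd_def I_def deg_def by blast
qed

definition classified :: "nat \<Rightarrow> (name \<Rightarrow> nat \<Rightarrow> nat) \<Rightarrow> bool" where
  "classified k a \<longleftrightarrow> (\<forall>j<k. a ''S'' j = stem j) \<and>
     a ''E'' = (\<lambda>v. \<Sum>j<k. if \<not> pend j \<and> v \<in> ei j then j else 0) \<and>
     a ''G'' = (\<lambda>v. \<Sum>j<k. if \<not> pend j \<and> v \<in> ei j then 1 else 0) \<and>
     a ''C'' = (\<lambda>v. \<Sum>j<k. if pend j \<and> stem j = v then 1 else 0) \<and>
     a ''H'' = (\<lambda>v. \<Sum>j<k. if pend j \<and> stem j = v then j else 0) \<and>
     (\<forall>v. 0 < a ''C'' v \<longrightarrow> a ''A'' v < k \<and> pend (a ''A'' v) \<and> stem (a ''A'' v) = v \<and>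
        a ''B'' v < k \<and> pend (a ''B'' v) \<and> stem (a ''B'' v) = v \<and> (1 < a ''C'' v \<longrightarrow> a ''A'' v \<noteq> a ''B'' v))"

abbreviation "class_vars \<equiv> {''i'', ''x''}"
abbreviation "class_arrs \<equiv> {''S'', ''E'', ''G'', ''A'', ''B'', ''C'', ''H''}"

lemma runs_classify:
  assumes b: "base s" and D: "arr s ''D'' = deg"
    and z: "\<And>a v. a \<in> class_arrs \<Longrightarrow> arr s a v = 0"
  shows "\<exists>s'. runs W n classify_cmd s s' \<and> agree class_vars class_arrs s s' \<and> classified m (arr s')"
proof -
  define I where "I = (\<lambda>k s'. agree class_vars class_arrs s s' \<and> classified k (arr s'))"
  have "\<exists>s'. runs W n (for_loop ''i'' (Var ''m'') classify_body) s s' \<and> I m s' \<and> var s' ''i'' = m"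
  proof (rule runs_for_loop, goal_cases)
    show "I 0 (s\<lparr>var := (var s)(''i'' := 0)\<rparr>)" using z by (simp add: I_def agree_def classified_def fun_eq_iff)
  next
    case (2 k t)
    then have k: "k < m" and I: "I k t" and vi: "var t ''i'' = k" by auto
    from I have ag: "agree class_vars class_arrs s t" and cl: "classified k (arr t)" by (auto simp: I_def)
    have bt: "base t" using base_agree[OF b ag] by simp
    note f = baseD(3,4)[OF bt k]
    have Dt: "arr t ''D'' = deg" using agree_arr[OF ag, of "''D''"] D by simp
    have UVk: "U k < n" "V k < n" "U k \<noteq> V k" using UV[OF k] by auto
    have stem: "stem k = (if deg (U k) = 1 then V k else U k)" by (simp add: stem_def)
    have le: "arr t ''E'' v \<le> n * n" "arr t ''G'' v \<le> n * n" "arr t ''C'' v \<le> n * n" "arr t ''H'' v \<le> n * n" for v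
      using cl k unfolding classified_def by (auto intro!: sum_le_square)
    have W: "arr t ''E'' v + k < W" "Suc (arr t ''G'' v) < W" "Suc (arr t ''C'' v) < W" "arr t ''H'' v + k < W" for v
      using le[of v] k m_n n3 by (auto intro!: W_bound)
    have kW: "k < W" "U k < W" "V k < W" "stem k < W" using k m_n UVk stem_n[OF k] by (auto intro!: W_n)
    let ?s1 = "t\<lparr>var := (var t)(''x'' := stem k), arr := (arr t)(''S'' := (arr t ''S'')(k := stem k))\<rparr>"
    show ?case
    proof (cases "pend k")
      case False
      then have d: "deg (U k) \<noteq> 1" "deg (V k) \<noteq> 1" by (auto simp: pend_def)
      let ?E = "arr t ''E''" and ?G = "arr t ''G''"
      have sem: "sem classify_body t = ?s1\<lparr>arr := (arr t)(''S'' := (arr t ''S'')(k := stem k),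
          ''E'' := ?E(U k := ?E (U k) + k, V k := ?E (V k) + k),
          ''G'' := ?G(U k := ?G (U k) + 1, V k := ?G (V k) + 1))\<rparr>"
        unfolding classify_body_def using d UVk by (simp add: sem_incr vi f Dt stem)
      have safe: "safe W classify_body t"
        unfolding classify_body_def using d UVk W kW by (simp add: sem_incr safe_incr vi f Dt stem)
      have "?E(U k := ?E (U k) + k, V k := ?E (V k) + k) = (\<lambda>v. \<Sum>j<Suc k. if \<not> pend j \<and> v \<in> ei j then j else 0)"
        "?G(U k := ?G (U k) + 1, V k := ?G (V k) + 1) = (\<lambda>v. \<Sum>j<Suc k. if \<not> pend j \<and> v \<in> ei j then 1 else 0)"
        using cl False UVk unfolding classified_def by (auto simp: fun_eq_iff ei_def)
      moreover have "\<forall>v. 0 < arr t ''C'' v \<longrightarrow> arr t ''A'' v < Suc k \<and> arr t ''B'' v < Suc k"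
        using cl unfolding classified_def by (meson less_SucI)
      ultimately have "classified (Suc k) (arr (sem classify_body t))"
        using cl False unfolding sem classified_def by (simp add: less_Suc_eq)
      then show ?thesis using safe ag unfolding I_def by (simp add: sem vi agree_def)
    next
      case True
      then have d: "deg (U k) = 1 \<or> deg (V k) = 1" by (auto simp: pend_def)
      let ?A = "arr t ''A''" and ?B = "arr t ''B''" and ?C = "arr t ''C''" and ?H = "arr t ''H''" and ?w = "stem k"
      let ?A' = "if ?C ?w = 0 then ?A(?w := k) else ?A"
      have sem: "arr (sem classify_body t) ''S'' = (arr t ''S'')(k := ?w)"
          "arr (sem classify_body t) ''A'' = (if ?C ?w = 0 then ?A(?w := k) else ?A)"
          "arr (sem classify_body t) ''B'' = ?B(?w := k)"
          "arr (sem classify_body t) ''C'' = ?C(?w := ?C ?w + 1)"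
          "arr (sem classify_body t) ''H'' = ?H(?w := ?H ?w + k)"
          "arr (sem classify_body t) ''E'' = arr t ''E''" "arr (sem classify_body t) ''G'' = arr t ''G''"
          "var (sem classify_body t) ''i'' = k"
        and ag': "agree class_vars class_arrs s (sem classify_body t)"
        unfolding classify_body_def using d ag
        by (cases "deg (U k) = 1"; simp add: sem_incr vi f Dt stem agree_def)+
      have safe: "safe W classify_body t"
        unfolding classify_body_def using d W kW UVk
        by (cases "deg (U k) = 1"; simp add: sem_incr safe_incr vi f Dt stem)
      have "?C(?w := ?C ?w + 1) = (\<lambda>v. \<Sum>j<Suc k. if pend j \<and> stem j = v then 1 else 0)"
        "?H(?w := ?H ?w + k) = (\<lambda>v. \<Sum>j<Suc k. if pend j \<and> stem j = v then j else 0)"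
        using cl True unfolding classified_def by (auto simp: fun_eq_iff)
      moreover have "\<forall>v. 0 < (?C(?w := ?C ?w + 1)) v \<longrightarrow> ?A' v < Suc k \<and> pend (?A' v) \<and> stem (?A' v) = v \<and>
         (?B(?w := k)) v < Suc k \<and> pend ((?B(?w := k)) v) \<and> stem ((?B(?w := k)) v) = v \<and>
         (1 < (?C(?w := ?C ?w + 1)) v \<longrightarrow> ?A' v \<noteq> (?B(?w := k)) v)" (is "\<forall>v. _ \<longrightarrow> ?R v")
      proof (intro allI impI)
        fix v assume v: "0 < (?C(?w := ?C ?w + 1)) v"
        have old: "0 < ?C v \<Longrightarrow> ?A v < k \<and> pend (?A v) \<and> stem (?A v) = v \<and> ?B v < k \<and> pend (?B v) \<and> stem (?B v) = v \<and> (1 < ?C v \<longrightarrow> ?A v \<noteq> ?B v)"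
          using cl unfolding classified_def by blast
        show "?R v"
        proof (cases "v = ?w")
          case True
          then show ?thesis using old \<open>pend k\<close> by (cases "?C ?w = 0") auto
        next
          case False
          then show ?thesis using old v by auto
        qed
      qed
      ultimately have "classified (Suc k) (arr (sem classify_body t))"
        using cl True unfolding classified_def sem by (simp add: less_Suc_eq)
      then show ?thesis using safe ag' sem(8) unfolding I_def by (simp add: agree_def)
    qed
  next
    fix k t assume "I k t"
    then have "agree class_vars class_arrs s t" by (simp add: I_def)
    from agree_var[OF this, of "''m''"] baseD(2)[OF b] show "aval (Var ''m'') t = m" by simp
  qed (use m_n W_n in auto)
  then show ?thesis unfolding classify_cmd_def I_def by blast
qed

definition sdeg :: "nat \<Rightarrow> nat" where "sdeg v = (\<Sum>j<m. if \<not> pend j \<and> v \<in> ei j then 1 else 0)"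

lemma runs_start:
  assumes b: "base s" and D: "arr s ''D'' = deg" and G: "arr s ''G'' = sdeg" and r0: "var s ''r'' = 0"
  shows "\<exists>s'. runs W n start_cmd s s' \<and> agree {''i'', ''r'', ''x''} {} s s' \<and>
    (\<exists>p. spine p \<and> var s' ''r'' = length p \<and> var s' ''x'' = p ! 0)"
proof -
  let ?n = "\<lambda>k. \<Sum>v<k. if deg v \<noteq> 1 then 1 else (0::nat)"
  define I where "I = (\<lambda>k s'. agree {''i'', ''r'', ''x''} {} s s' \<and> var s' ''r'' = ?n k \<and>
    ((\<exists>v<k. deg v \<noteq> 1 \<and> sdeg v < 2) \<longrightarrow> var s' ''x'' < k \<and> deg (var s' ''x'') \<noteq> 1 \<and> sdeg (var s' ''x'') < 2))"
  have nk: "?n k \<le> k" for k by (induction k) auto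
  have "\<exists>s'. runs W n (for_loop ''i'' (Var ''n'') start_body) s s' \<and> I n s' \<and> var s' ''i'' = n"
  proof (rule runs_for_loop, goal_cases)
    show "I 0 (s\<lparr>var := (var s)(''i'' := 0)\<rparr>)" using r0 by (simp add: I_def agree_def)
  next
    case (2 k t)
    then have k: "k < n" and I: "I k t" and vi: "var t ''i'' = k" by auto
    from I have ag: "agree {''i'', ''r'', ''x''} {} s t" by (auto simp: I_def)
    have f: "arr t ''D'' = deg" "arr t ''G'' = sdeg" "var t ''r'' = ?n k"
      using agree_arr[OF ag] D G I by (auto simp: I_def)
    have "Suc (?n k) < W" "k < W" using nk[of k] k by (auto intro!: W_n)
    then have safe: "safe W start_body t" unfolding start_body_def by (simp add: vi f)
    consider "deg k = 1" | "deg k \<noteq> 1" "sdeg k < 2" | "deg k \<noteq> 1" "\<not> sdeg k < 2" by blast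
    then have "var (sem start_body t) ''i'' = k \<and> I (Suc k) ((sem start_body t)\<lparr>var := (var (sem start_body t))(''i'' := Suc k)\<rparr>)"
    proof cases
      case 1
      then show ?thesis unfolding start_body_def using I by (auto simp: I_def agree_def vi f less_Suc_eq)
    next
      case 2
      then show ?thesis unfolding start_body_def using I by (auto simp: I_def agree_def vi f less_Suc_eq)
    next
      case 3
      then show ?thesis unfolding start_body_def using I by (auto simp: I_def agree_def vi f less_Suc_eq)
    qed
    then show ?case
      using safe by blast
  next
    fix k t assume "I k t"
    then have "agree {''i'', ''r'', ''x''} {} s t" by (simp add: I_def)
    from agree_var[OF this, of "''n''"] baseD(1)[OF b] show "aval (Var ''n'') t = n" by simp
  qed (use W_n in auto)
  then obtain s' where s': "runs W n start_cmd s s'" "I n s'" unfolding start_cmd_def by blast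
  \<comment> \<open>Compare with an arbitrary order of the spine, reversed if the program has found
    its last vertex.\<close>
  obtain p0 where p0: "spine p0" using spine_exists by blast
  then interpret p0: cat_spine n E es p0 by unfold_locales
  have sdeg: "sdeg (p0 ! k) = (if 0 < k then 1 else 0) + (if Suc k < p0.r then 1 else 0)" if "k < p0.r" for k
    unfolding sdeg_def by (rule p0.sum_spine_edges[OF that])
  have "p0 ! 0 < n" "deg (p0 ! 0) \<noteq> 1" "sdeg (p0 ! 0) < 2"
    using p0.p_nth[OF p0.r_pos] sdeg[OF p0.r_pos] by auto
  then have x: "var s' ''x'' < n" "deg (var s' ''x'') \<noteq> 1" "sdeg (var s' ''x'') < 2"
    using s'(2) unfolding I_def by blast+
  from p0.p_ex[OF x(1,2)] obtain k where k: "k < p0.r" "var s' ''x'' = p0 ! k" by blast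
  have "k = 0 \<or> Suc k = p0.r" using sdeg[OF k(1)] x(3) k by (auto split: if_splits)
  then have "\<exists>p. spine p \<and> length p = length p0 \<and> var s' ''x'' = p ! 0"
  proof
    assume "k = 0" then show ?thesis using p0 k by blast
  next
    assume "Suc k = p0.r"
    then have "length p0 - Suc 0 = k" by (simp add: p0.r_def)
    then have "rev p0 ! 0 = p0 ! k" using p0.p_facts(1) by (simp add: rev_nth)
    then show ?thesis using spine_rev[OF p0] k by (intro exI[of _ "rev p0"]) simp
  qed
  moreover have "?n n = length p0"
  proof -
    have "?n n = card {v \<in> {..<n}. deg v \<noteq> 1}" by (simp add: sum.inter_filter[symmetric])
    also have "{v \<in> {..<n}. deg v \<noteq> 1} = set p0" using p0.p_facts(3) by auto
    finally show ?thesis using distinct_card[OF p0.p_facts(2)] by simp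
  qed
  ultimately obtain p where "spine p" "var s' ''r'' = length p" "var s' ''x'' = p ! 0"
    using s'(2) unfolding I_def by metis
  then show ?thesis using s' unfolding I_def by metis
qed

end

section \<open>The walk along the spine\<close>

context cat_spine
begin

definition esum :: "nat \<Rightarrow> nat" where "esum v = (\<Sum>j<m. if \<not> pend j \<and> v \<in> ei j then j else 0)"

lemma esum_p: "k < r \<Longrightarrow> esum (p ! k) = (if 0 < k then se (k - 1) else 0) + (if Suc k < r then se k else 0)"
  unfolding esum_def by (rule sum_spine_edges)

lemma m_pos: "0 < m"
proof -
  have "deg (p ! 0) \<noteq> 0" using deg_pos[of "p ! 0"] p_nth(1)[OF r_pos] by simp
  then show ?thesis by (cases "m = 0") (auto simp: deg_def)
qed

lemma r_le_n: "r \<le> n"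
proof -
  have "set p \<subseteq> {..<n}" using p_facts(3) by blast
  then have "card (set p) \<le> n" using card_mono[of "{..<n}"] by fastforce
  then show ?thesis using distinct_card[OF p_facts(2)] by (simp add: r_def)
qed

lemma runs_walk:
  assumes b: "base s" and E: "arr s ''E'' = esum" and r: "var s ''r'' = r" and x: "var s ''x'' = p ! 0"
    and y: "var s ''y'' = 0"
  shows "\<exists>s'. runs W n walk_cmd s s' \<and> agree {''i'', ''x'', ''y'', ''z''} {''X'', ''P''} s s' \<and>
    (\<forall>k<r. arr s' ''X'' k = p ! k) \<and> (\<forall>k. Suc k < r \<longrightarrow> arr s' ''P'' (Suc k) = se k)"
proof -
  let ?ag = "agree {''i'', ''x'', ''y'', ''z''} {''X'', ''P''} s"
  define I where "I = (\<lambda>k s'. ?ag s' \<and> (\<forall>j<k. arr s' ''X'' j = p ! j) \<and>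
    (\<forall>j<k. Suc j < r \<longrightarrow> arr s' ''P'' (Suc j) = se j) \<and>
    (k < r \<longrightarrow> var s' ''x'' = p ! k \<and> var s' ''y'' = (if 0 < k then se (k - 1) else 0)))"
  have "\<exists>s'. runs W n (for_loop ''i'' (Var ''r'') walk_body) s s' \<and> I r s' \<and> var s' ''i'' = r"
  proof (rule runs_for_loop, goal_cases)
    show "I 0 (s\<lparr>var := (var s)(''i'' := 0)\<rparr>)" using x y by (simp add: I_def agree_def)
  next
    case (2 k t)
    then have k: "k < r" and I: "I k t" and vi: "var t ''i'' = k" by auto
    from I have ag: "?ag t" by (simp add: I_def)
    have bt: "base t" using base_agree[OF b ag] by simp
    have Et: "arr t ''E'' = esum" using agree_arr[OF ag, of "''E''"] E by simp
    \<comment> \<open>At the last vertex the difference of index sums is 0, which is still a valid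
      edge index.\<close>
    define e where "e = (if Suc k < r then se k else 0)"
    have em: "e < m" using se_props m_pos by (simp add: e_def)
    note f = baseD(3,4)[OF bt em]
    have vx: "var t ''x'' = p ! k" "var t ''y'' = (if 0 < k then se (k - 1) else 0)" using I k by (auto simp: I_def)
    have e: "esum (p ! k) - (if 0 < k then se (k - 1) else 0) = e" using esum_p[OF k] by (simp add: e_def)
    have nxt: "U e + V e - p ! k = p ! Suc k" if "Suc k < r"
    proof -
      have "{U e, V e} = {p ! k, p ! Suc k}" using se_props(2)[OF that] that by (simp add: e_def ei_def)
      then have "U e = p ! k \<and> V e = p ! Suc k \<or> U e = p ! Suc k \<and> V e = p ! k" by (auto simp: doubleton_eq_iff)
      then show ?thesis by auto
    qed
    have sem: "sem walk_body t = t\<lparr>var := (var t)(''z'' := e, ''x'' := U e + V e - p ! k, ''y'' := e),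
      arr := (arr t)(''X'' := (arr t ''X'')(k := p ! k), ''P'' := (arr t ''P'')(Suc k := e))\<rparr>"
      unfolding walk_body_def using e f by (simp add: vi vx Et)
    have "p ! k < W" "e < W" "U e + V e - p ! k < W"
      using p_nth(1)[OF k] em m_n UV[OF em] n3 by (auto intro!: W_n W_bound simp: add_mono order.trans[of _ "n + n"])
    then have safe: "safe W walk_body t"
      unfolding walk_body_def using e f by (simp add: vi vx Et)
    have "\<forall>j<Suc k. ((arr t ''X'')(k := p ! k)) j = p ! j" using I by (auto simp: I_def less_Suc_eq)
    moreover have "\<forall>j<Suc k. Suc j < r \<longrightarrow> ((arr t ''P'')(Suc k := e)) (Suc j) = se j"
      using I by (auto simp: I_def less_Suc_eq e_def)
    moreover have "Suc k < r \<longrightarrow> e = se k" by (simp add: e_def)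
    ultimately show ?case
      using safe ag nxt unfolding sem by (simp add: I_def vi agree_def)
  next
    fix k t assume "I k t"
    then have "?ag t" by (simp add: I_def)
    from agree_var[OF this, of "''r''"] r show "aval (Var ''r'') t = r" by simp
  qed (use W_n r_le_n in auto)
  then show ?thesis unfolding walk_cmd_def I_def by force
qed

end

section \<open>Programs of the labeling passes\<close>

definition label_cmd :: com where
  "label_cmd = Seq (Write ''L'' (Var ''e'') (Var ''z''))
     (Seq (incr ''T'' (Read ''U'' (Var ''e'')) (Var ''z'')) (incr ''T'' (Read ''V'' (Var ''e'')) (Var ''z'')))"

definition sweep_label :: com where
  "sweep_label =
    Seq (Assign ''e'' (Read ''P'' (Var ''i'')))
   (Seq (If (Equal (Mod (Minus (Var ''r'') (Var ''i'')) (Const 2)) (Const 1))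
           (Assign ''z'' (Plus (Plus (Var ''b'') (Const 1)) (Div (Var ''i'') (Const 2))))
           (Seq (Assign ''z'' (Var ''c'')) (Assign ''c'' (Plus (Var ''c'') (Const 1)))))
        label_cmd)"

text \<open>At this time the legs of vertex \<open>i - 1\<close> are unlabelled, so its entry of
  \<open>T\<close> is its path sum. \<open>''z''\<close> must survive until
  \<open>sweep_insert\<close>, which looks up the label just given.\<close>

definition sweep_record :: com where
  "sweep_record =
    If (Less (Const 0) (Var ''i''))
      (Seq (Assign ''x'' (Read ''X'' (Minus (Var ''i'') (Const 1))))
           (If (Equal (Read ''C'' (Var ''x'')) (Const 1)) (Write ''Z'' (Read ''T'' (Var ''x'')) (Var ''i'')) Skip))
      Skip"

definition sweep_insert :: com where
  "sweep_insert =
    If (And (Equal (Mod (Minus (Var ''r'') (Var ''i'')) (Const 2)) (Const 1))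
            (Not (Equal (Read ''Z'' (Var ''z'')) (Const 0))))
      (Seq (Assign ''x'' (Read ''X'' (Minus (Read ''Z'' (Var ''z'')) (Const 1))))
      (Seq (Assign ''e'' (Read ''H'' (Var ''x'')))
      (Seq (Assign ''z'' (Var ''c''))
      (Seq label_cmd (Assign ''c'' (Plus (Var ''c'') (Const 1)))))))
      Skip"

definition sweep_body :: com where
  "sweep_body = Seq sweep_label (Seq sweep_record sweep_insert)"

definition sweep_cmd :: com where "sweep_cmd = for_loop ''i'' (Plus (Var ''r'') (Const 1)) sweep_body"

definition fill_body :: com where
  "fill_body = If (Equal (Read ''L'' (Var ''i'')) (Const 0))
     (Seq (Assign ''x'' (Read ''S'' (Var ''i'')))
       (If (Less (Const 1) (Read ''C'' (Var ''x'')))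
          (Seq (Assign ''e'' (Var ''i''))
          (Seq (Assign ''z'' (Var ''c''))
          (Seq label_cmd
          (Seq (Assign ''c'' (Plus (Var ''c'') (Const 1)))
               (Write ''C'' (Var ''x'') (Minus (Read ''C'' (Var ''x'')) (Const 1)))))))
          (Seq (Write ''Q'' (Var ''q'') (Var ''i'')) (Assign ''q'' (Plus (Var ''q'') (Const 1)))))) Skip"

definition fill_cmd :: com where "fill_cmd = for_loop ''i'' (Var ''m'') fill_body"

text \<open>Radix sort in base \<open>n\<close>, lower digit first; the second pass is stable and
  keeps the order of the first among equal upper digits.\<close>

definition sort_cmd :: com where
  "sort_cmd = Seq (counting_sort ''Q'' ''R'' ''K'' (Mod (Read ''T'' (Read ''S'' (Var ''x''))) (Var ''n'')))
     (counting_sort ''R'' ''O'' ''J'' (Div (Read ''T'' (Read ''S'' (Var ''x''))) (Var ''n'')))"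

definition last_body :: com where
  "last_body = Seq (Assign ''e'' (Read ''O'' (Var ''i'')))
    (Seq (Assign ''z'' (Var ''c'')) (Seq label_cmd (Assign ''c'' (Plus (Var ''c'') (Const 1)))))"

definition last_cmd :: com where "last_cmd = for_loop ''i'' (Var ''q'') last_body"

definition label_program :: com where
  "label_program = Seq sweep_cmd (Seq fill_cmd (Seq sort_cmd last_cmd))"

section \<open>Keeping the vertex sums up to date\<close>

context cat_path
begin

text \<open>Facts established by the preprocessing and preserved by all later phases. The leg counts
  \<open>C\<close> are used up by the filling pass and therefore appear only in
  \<open>ready\<close>.\<close>

definition prepared :: "ram_state \<Rightarrow> bool" where
  "prepared s \<longleftrightarrow> base s \<and> var s ''r'' = r \<and> var s ''b'' = m - nhigh \<and>
    (\<forall>k<r. arr s ''X'' k = p ! k) \<and> (\<forall>i\<le>r. arr s ''P'' i = Ed i) \<and> (\<forall>i<m. arr s ''S'' i = stem i) \<and>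
    (\<forall>k<r. lc k = 1 \<longrightarrow> arr s ''H'' (p ! k) = leg k)"

lemma preparedD:
  assumes "prepared s"
  shows "base s" "var s ''r'' = r" "var s ''b'' = m - nhigh"
    "\<And>k. k < r \<Longrightarrow> arr s ''X'' k = p ! k" "\<And>i. i \<le> r \<Longrightarrow> arr s ''P'' i = Ed i" "\<And>i. i < m \<Longrightarrow> arr s ''S'' i = stem i"
    "\<And>k. k < r \<Longrightarrow> lc k = 1 \<Longrightarrow> arr s ''H'' (p ! k) = leg k"
  using assms by (auto simp: prepared_def)

lemma prepared_agree:
  assumes "prepared s" "agree vs as s s'" "{''n'', ''m'', ''r'', ''b''} \<inter> vs = {}"
    "{''U'', ''V'', ''X'', ''P'', ''S'', ''H''} \<inter> as = {}"
  shows "prepared s'"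
proof -
  have "base s'" using base_agree[OF preparedD(1)[OF assms(1)] assms(2)] assms(3,4) by auto
  moreover have "var s' x = var s x" if "x \<in> {''r'', ''b''}" for x using agree_var[OF assms(2)] assms(3) that by auto
  moreover have "arr s' x = arr s x" if "x \<in> {''X'', ''P'', ''S'', ''H''}" for x using agree_arr[OF assms(2)] assms(4) that by auto
  ultimately show ?thesis using assms(1) by (simp add: prepared_def)
qed

lemma vsum_le: assumes "\<And>e. e < m \<Longrightarrow> L e \<le> m" shows "vsum L v \<le> m * m"
proof -
  have "vsum L v \<le> of_nat (card {..<m}) * m" unfolding vsum_def using assms by (intro sum_bounded_above) auto
  then show ?thesis by simp
qed

lemma mm_n: "m * m < n * n"
  using m_n by (simp add: mult_strict_mono)

lemma sem_label:
  assumes "base t" "e < m" "arr t ''L'' e = 0" "arr t ''T'' = vsum (arr t ''L'')" "var t ''e'' = e" "var t ''z'' = z"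
  shows "sem label_cmd t = t\<lparr>arr := (arr t)(''L'' := (arr t ''L'')(e := z), ''T'' := vsum ((arr t ''L'')(e := z)))\<rparr>"
proof -
  note f = baseD(3,4)[OF assms(1,2)]
  let ?T = "arr t ''T''"
  have "?T(U e := ?T (U e) + z, V e := ?T (V e) + z) = vsum ((arr t ''L'')(e := z))"
  proof
    fix v
    show "(?T(U e := ?T (U e) + z, V e := ?T (V e) + z)) v = vsum ((arr t ''L'')(e := z)) v"
      using vsum_upd[of e "arr t ''L''" z v, OF assms(2,3)] UV(3)[OF assms(2)] unfolding assms(4) by (auto simp: ei_def)
  qed
  then show ?thesis unfolding label_cmd_def using f UV(3)[OF assms(2)] by (simp add: sem_incr assms(5,6))
qed

lemma safe_label:
  assumes "base t" "e < m" "arr t ''L'' e = 0" "arr t ''T'' = vsum (arr t ''L'')" "var t ''e'' = e" "var t ''z'' = z"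
    "\<And>e. e < m \<Longrightarrow> arr t ''L'' e \<le> m" "z \<le> m"
  shows "safe W label_cmd t"
proof -
  note f = baseD(3,4)[OF assms(1,2)]
  have "vsum ((arr t ''L'')(e := z)) v \<le> m * m" for v
    by (rule vsum_le) (use assms(7,8) in auto)
  then have "vsum ((arr t ''L'')(e := z)) v \<le> n * n" for v
    using mm_n by (meson less_imp_le order_trans)
  from this[of "U e"] this[of "V e"] have "vsum (arr t ''L'') (U e) + z \<le> n * n" "vsum (arr t ''L'') (V e) + z \<le> n * n"
    using vsum_upd[of e "arr t ''L''" z, OF assms(2,3)] by (auto simp: ei_def)
  then have "vsum (arr t ''L'') (U e) + z < W" "vsum (arr t ''L'') (V e) + z < W" by (auto intro!: W_bound)
  moreover have "z < W" using assms(8) m_n by (intro W_n) simp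
  ultimately show ?thesis unfolding label_cmd_def using f UV(3)[OF assms(2)]
    by (simp add: sem_incr safe_incr assms(4,5,6))
qed

end

section \<open>Correctness of the sweep program\<close>

context cat_path
begin

lemma sweep_bounds:
  assumes "sweep i L c S"
  shows "c \<le> Suc m" "e < m \<Longrightarrow> L e \<le> m"
proof -
  have "c - 1 = card ({e. e < m \<and> L e \<noteq> 0} - highs)"
    using bij_betw_same_card[OF sweepD(3)[OF assms]] by simp
  also have "\<dots> \<le> card {..<m}" by (rule card_mono) auto
  finally show c: "c \<le> Suc m" by simp
  assume e: "e < m"
  show "L e \<le> m"
  proof (cases "e \<in> highs")
    case True
    then obtain t where t: "t \<le> r" "high t" "e = Ed t" by (auto simp: highs_def)
    then show ?thesis using sweepD(1)[OF assms t(1)] sweepD(2)[OF assms t(1)] hl_le[of t] by (cases "t < i") auto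
  next
    case False
    show ?thesis
    proof (cases "L e = 0")
      case False
      then have "e \<in> {e. e < m \<and> L e \<noteq> 0} - highs" using e \<open>e \<notin> highs\<close> by simp
      then have "L e \<in> {1..<c}" by (rule bij_betw_apply[OF sweepD(3)[OF assms]])
      then show ?thesis using c by simp
    qed simp
  qed
qed

text \<open>A labelled leg of vertex \<open>i - 1\<close> would need a high edge \<open>t\<close>
  with \<open>i < t\<close> and \<open>t < i\<close>, so the legs contribute nothing yet.\<close>

lemma vsum_record:
  assumes "sweep i L c S" "0 < i" "i \<le> r"
  shows "vsum (L(Ed i := x)) (p ! (i - 1)) = psum (L(Ed i := x)) (i - 1)"
proof -
  have i: "i - 1 < r" using assms by simp
  have "(L(Ed i := x)) e = 0" if e: "e \<in> legs (i - 1)" for e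
  proof -
    have "L e = 0"
    proof (rule ccontr)
      assume "L e \<noteq> 0"
      from sweepD(6)[OF assms(1) i e this] obtain t where "inserted i L (i - 1) e t" by blast
      then show False using assms(2) by (auto simp: inserted_def)
    qed
    then show ?thesis using legs_not_Ed[OF e assms(3)] by simp
  qed
  then show ?thesis using vsum_X[OF i, of "L(Ed i := x)"] by simp
qed

abbreviation "sweep_vars \<equiv> {''i'', ''e'', ''z'', ''c'', ''x''}"
abbreviation "sweep_arrs \<equiv> {''L'', ''T'', ''Z''}"

definition sweep_inv :: "ram_state \<Rightarrow> nat \<Rightarrow> ram_state \<Rightarrow> bool" where
  "sweep_inv s k t \<longleftrightarrow> agree sweep_vars sweep_arrs s t \<and> arr t ''T'' = vsum (arr t ''L'') \<and>
     sweep k (arr t ''L'') (var t ''c'') (arr t ''Z'')"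

lemma odd_iff: "(a mod 2 = Suc 0) = odd (a :: nat)"
  by presburger

lemma sweep_label_step:
  assumes pr: "prepared t" and T: "arr t ''T'' = vsum (arr t ''L'')"
    and sw: "sweep k (arr t ''L'') (var t ''c'') (arr t ''Z'')" and k: "k \<le> r" and i: "var t ''i'' = k"
  defines "z \<equiv> if high k then hl k else var t ''c''"
  defines "L1 \<equiv> (arr t ''L'')(Ed k := z)"
  shows "sem sweep_label t = t\<lparr>var := (if high k then (var t)(''e'' := Ed k, ''z'' := z)
       else (var t)(''e'' := Ed k, ''z'' := z, ''c'' := Suc (var t ''c''))), arr := (arr t)(''L'' := L1, ''T'' := vsum L1)\<rparr>" (is ?sem)
    and "safe W sweep_label t"
proof -
  note P = preparedD[OF pr]
  let ?u = "t\<lparr>var := (if high k then (var t)(''e'' := Ed k, ''z'' := z)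
       else (var t)(''e'' := Ed k, ''z'' := z, ''c'' := Suc (var t ''c'')))\<rparr>"
  have bu: "base ?u" using P(1) unfolding base_def by simp
  have L0: "arr t ''L'' (Ed k) = 0" using sweepD(1)[OF sw k] by simp
  have zm: "z \<le> m"
  proof (cases "high k")
    case True
    then show ?thesis using hl_le[OF k] by (simp add: z_def)
  next
    case False
    \<comment> \<open>The counter after the step is \<open>Suc\<close> of the label used, and every
      counter is at most \<open>Suc m\<close>.\<close>
    then show ?thesis using sweep_bounds(1)[OF sweep_step_low[OF sw k False]] by (simp add: z_def)
  qed
  have lab: "sem label_cmd ?u = ?u\<lparr>arr := (arr t)(''L'' := L1, ''T'' := vsum L1)\<rparr>"
    using sem_label[OF bu Ed_m[OF k], of z] L0 T by (simp add: L1_def)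
  have labs: "safe W label_cmd ?u"
    using safe_label[OF bu Ed_m[OF k], of z] L0 T sweep_bounds(2)[OF sw] zm by simp
  have sem1: "sem sweep_label t = sem label_cmd ?u"
    unfolding sweep_label_def z_def using P(2,3,5) k i by (simp add: odd_iff high_def hl_def)
  show ?sem unfolding sem1 lab by simp
  have "0 < n * n" using n3 by simp
  then have "Suc (var t ''c'') \<le> n * n + n" using m_n sweep_bounds(1)[OF sw] by linarith
  then have "Ed k < W" "z < W" "Suc (var t ''c'') < W" using Ed_m[OF k] m_n zm
    by (auto intro!: W_n W_bound)
  then show "safe W sweep_label t"
    using labs unfolding sweep_label_def z_def using P(2,3,5) k i by (simp add: odd_iff high_def hl_def split: if_splits)
qed

lemma runs_sweep:
  assumes pr: "prepared s" and C: "\<And>k. k < r \<Longrightarrow> arr s ''C'' (p ! k) = lc k" and c: "var s ''c'' = 1"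
    and z: "arr s ''L'' = (\<lambda>_. 0)" "arr s ''T'' = (\<lambda>_. 0)" "arr s ''Z'' = (\<lambda>_. 0)"
  shows "\<exists>s'. runs W n sweep_cmd s s' \<and> sweep_inv s (Suc r) s'"
proof -
  have "\<exists>s'. runs W n (for_loop ''i'' (Plus (Var ''r'') (Const 1)) sweep_body) s s' \<and> sweep_inv s (Suc r) s' \<and> var s' ''i'' = Suc r"
  proof (rule runs_for_loop, goal_cases)
    have "vsum (\<lambda>_. 0) = (\<lambda>_. 0)" by (simp add: vsum_def fun_eq_iff)
    then show "sweep_inv s 0 (s\<lparr>var := (var s)(''i'' := 0)\<rparr>)"
      using z c sweep_0 by (simp add: sweep_inv_def agree_def)
  next
    case (2 k t)
    then have "k < Suc r" and I: "sweep_inv s k t" and vi: "var t ''i'' = k" by auto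
    then have k: "k \<le> r" by simp
    from I have ag: "agree sweep_vars sweep_arrs s t" and T: "arr t ''T'' = vsum (arr t ''L'')"
      and sw: "sweep k (arr t ''L'') (var t ''c'') (arr t ''Z'')" by (auto simp: sweep_inv_def)
    have prt: "prepared t" by (rule prepared_agree[OF pr ag]) auto
    note P = preparedD[OF prt]
    have Ct: "arr t ''C'' (p ! j) = lc j" if "j < r" for j using agree_arr[OF ag, of "''C''"] C[OF that] by simp
    define z where "z = (if high k then hl k else var t ''c'')"
    define L1 where "L1 = (arr t ''L'')(Ed k := z)"
    define c1 where "c1 = (if high k then var t ''c'' else Suc (var t ''c''))"
    define Z1 where "Z1 = sweep_S k L1 (arr t ''Z'')"
    define t1 where "t1 = sem sweep_label t"
    note lab = sweep_label_step[OF prt T sw k vi, folded z_def, folded L1_def, folded t1_def]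
    have t1: "arr t1 = (arr t)(''L'' := L1, ''T'' := vsum L1)" "var t1 ''i'' = k" "var t1 ''z'' = z" "var t1 ''c'' = c1"
      and ag1: "agree sweep_vars sweep_arrs s t1"
      using ag unfolding lab(1) c1_def by (simp_all add: vi agree_def)
    define t2 where "t2 = sem sweep_record t1"
    have t2: "arr t2 = (arr t)(''L'' := L1, ''T'' := vsum L1, ''Z'' := Z1)" (is ?arr2)
        "var t2 ''i'' = k" (is ?i2) "var t2 ''z'' = z" (is ?z2) "var t2 ''c'' = c1" (is ?c2)
      and ag2: "agree sweep_vars sweep_arrs s t2" (is ?ag2) and safe2: "safe W sweep_record t1" (is ?safe2)
    proof -
      have kW: "k < W" using k r_less_n by (intro W_n) simp
      have "?arr2 \<and> ?i2 \<and> ?z2 \<and> ?c2 \<and> ?ag2 \<and> ?safe2"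
      proof (cases "0 < k")
        case False
        then have "t2 = t1" "Z1 = arr t ''Z''" using t1 by (auto simp: t2_def sweep_record_def Z1_def sweep_S_def)
        then show ?thesis using t1 ag1 False by (simp add: sweep_record_def fun_eq_iff)
      next
        case True
        then have k1: "k - 1 < r" using k by simp
        have X: "arr t ''X'' (k - Suc 0) = p ! (k - 1)" using P(4)[OF k1] by simp
        have xW: "p ! (k - Suc 0) < W" using X_n[OF k1] by (intro W_n) simp
        have ps: "vsum L1 (p ! (k - Suc 0)) = psum L1 (k - 1)"
          using vsum_record[OF sw True k, of z] by (simp add: L1_def)
        show ?thesis
        proof (cases "lc (k - 1) = 1")
          case l: True
          have Z1: "Z1 = (arr t ''Z'')(psum L1 (k - 1) := k)" using True l by (simp add: Z1_def sweep_S_def)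
          show ?thesis using t1 True X Ct[OF k1] l ps xW kW ag1
            unfolding t2_def sweep_record_def Z1 by (simp add: agree_def)
        next
          case l: False
          have Z1: "Z1 = arr t ''Z''" using l by (simp add: Z1_def sweep_S_def)
          show ?thesis using t1 True X Ct[OF k1] l xW ag1
            unfolding t2_def sweep_record_def Z1 by (simp add: agree_def fun_eq_iff)
        qed
      qed
      then show ?arr2 ?i2 ?z2 ?c2 ?ag2 ?safe2 by auto
    qed
    have pr2: "prepared t2" by (rule prepared_agree[OF pr ag2]) auto
    note P2 = preparedD[OF pr2]
    define t3 where "t3 = sem sweep_insert t2"
    have "safe W sweep_insert t2 \<and> var t3 ''i'' = k \<and> sweep_inv s (Suc k) t3"
    \<comment> \<open>The insertion fires exactly in the situation of
      \<open>sweep_step_special\<close>.\<close>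
    proof (cases "high k \<and> Z1 (hl k) \<noteq> 0")
      case False
      have t3: "t3 = t2" and safe3: "safe W sweep_insert t2"
        using False t2 P2(2) by (auto simp: t3_def sweep_insert_def odd_iff high_def z_def)
      have "sweep (Suc k) L1 c1 Z1"
      proof (cases "high k")
        case True
        then show ?thesis using sweep_step_high[OF sw k True] False by (simp add: L1_def z_def c1_def Z1_def)
      next
        case False
        then show ?thesis using sweep_step_low[OF sw k False] by (simp add: L1_def z_def c1_def Z1_def)
      qed
      then show ?thesis using safe3 t2 ag2 unfolding t3 sweep_inv_def by simp
    next
      case True
      then have hk: "high k" and zk: "z = hl k" and c1: "c1 = var t ''c''" by (auto simp: z_def c1_def)
      define k0 where "k0 = Z1 (hl k) - 1"
      have sp: "sweep (Suc k) (L1(leg k0 := c1)) (Suc c1) Z1" "k0 < r" "lc k0 = 1" "L1 (leg k0) = 0"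
        using sweep_step_special[OF sw k hk] True unfolding k0_def Z1_def L1_def zk c1 by auto
      have leg: "leg k0 < m" using leg_single[OF sp(3)] legs_m[of "leg k0" k0] by simp
      let ?u = "t2\<lparr>var := (var t2)(''x'' := p ! k0, ''e'' := leg k0, ''z'' := c1)\<rparr>"
      have bu: "base ?u" using P2(1) unfolding base_def by simp
      have c1m: "c1 \<le> m" using sweep_bounds(1)[OF sp(1)] by simp
      have L1m: "L1 e \<le> m" if "e < m" for e using sweep_bounds(2)[OF sw that] hl_le[OF k hk] by (simp add: L1_def zk)
      have lab: "sem label_cmd ?u = ?u\<lparr>arr := (arr ?u)(''L'' := L1(leg k0 := c1), ''T'' := vsum (L1(leg k0 := c1)))\<rparr>"
        using sem_label[OF bu leg, of c1] sp(4) t2(1) by simp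
      have labs: "safe W label_cmd ?u"
        using safe_label[OF bu leg, of c1] sp(4) t2(1) L1m c1m by simp
      have cond: "bval (And (Equal (Mod (Minus (Var ''r'') (Var ''i'')) (Const 2)) (Const 1))
            (Not (Equal (Read ''Z'' (Var ''z'')) (Const 0)))) t2"
        using True t2 P2(2) by (simp add: odd_iff high_def zk)
      have u: "sem (Seq (Assign ''x'' (Read ''X'' (Minus (Read ''Z'' (Var ''z'')) (Const 1))))
          (Seq (Assign ''e'' (Read ''H'' (Var ''x''))) (Assign ''z'' (Var ''c'')))) t2 = ?u"
        using t2 P2(4)[OF sp(2)] P2(7)[OF sp(2,3)] by (simp add: zk k0_def)
      have W: "p ! k0 < W" "leg k0 < W" "c1 < W" "Suc c1 < W" using X_n[OF sp(2)] leg m_n c1m by (auto intro!: W_n)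
      have "safe W (Seq (Assign ''x'' (Read ''X'' (Minus (Read ''Z'' (Var ''z'')) (Const 1))))
          (Seq (Assign ''e'' (Read ''H'' (Var ''x''))) (Assign ''z'' (Var ''c'')))) t2"
        using t2 P2(4)[OF sp(2)] P2(7)[OF sp(2,3)] W by (simp add: zk k0_def)
      then have safe3: "safe W sweep_insert t2"
        using cond u lab labs W t2 unfolding sweep_insert_def by simp
      have t3: "t3 = (sem label_cmd ?u)\<lparr>var := (var ?u)(''c'' := Suc c1)\<rparr>"
        using cond u lab t2 unfolding t3_def sweep_insert_def by simp
      show ?thesis using safe3 sp(1) ag2 t2 unfolding t3 lab sweep_inv_def by (simp add: agree_def)
    qed
    moreover have "sem sweep_body t = t3" by (simp add: sweep_body_def t3_def t2_def t1_def)
    moreover have "sweep_inv s (Suc k) (t3\<lparr>var := (var t3)(''i'' := Suc k)\<rparr>)" if "sweep_inv s (Suc k) t3"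
      using that by (simp add: sweep_inv_def agree_def)
    ultimately show ?case
      using lab(2) safe2 by (simp add: sweep_body_def t2_def t1_def)
  next
    fix k t assume "sweep_inv s k t"
    then have "agree sweep_vars sweep_arrs s t" by (simp add: sweep_inv_def)
    from agree_var[OF this, of "''r''"] preparedD(2)[OF pr] show "aval (Plus (Var ''r'') (Const 1)) t = Suc r" by simp
  qed (use W_n r_less_n in auto)
  then show ?thesis unfolding sweep_cmd_def by blast
qed

end

section \<open>Correctness of the filling, sorting and final passes\<close>

context cat_path
begin

lemma filling_bounds:
  assumes sw: "sweep (Suc r) L0 c0 S" and f: "filling L0 c0 i L c C Q q"
  shows "c \<le> Suc m" "e < m \<Longrightarrow> L e \<le> m"
proof -
  have "c - 1 = card ({e. e < m \<and> L e \<noteq> 0} - highs)"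
    using bij_betw_same_card[OF fillingD(5)[OF f]] by simp
  also have "\<dots> \<le> card {..<m}" by (rule card_mono) auto
  finally show c: "c \<le> Suc m" by simp
  assume e: "e < m"
  show "L e \<le> m"
  proof (cases "L0 e = 0")
    case False
    then show ?thesis using fillingD(1)[OF f e] sweep_bounds(2)[OF sw e] by simp
  next
    case True
    then have "e \<notin> highs" using sweepD(1)[OF sw] unfolding highs_def by force
    show ?thesis
    proof (cases "L e = 0")
      case False
      then have "e \<in> {e. e < m \<and> L e \<noteq> 0} - highs" using e \<open>e \<notin> highs\<close> by simp
      then have "L e \<in> {1..<c}" by (rule bij_betw_apply[OF fillingD(5)[OF f]])
      then show ?thesis using c by simp
    qed simp
  qed
qed

lemma filling_queue_bound:
  assumes "filling L0 c0 i L c C Q q"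
  shows "q \<le> i"
proof -
  have "q = card {e. e < i \<and> L e = 0}" using bij_betw_same_card[OF fillingD(7)[OF assms]] by simp
  also have "\<dots> \<le> card {..<i}" by (rule card_mono) auto
  finally show ?thesis by simp
qed

abbreviation "fill_vars \<equiv> {''i'', ''e'', ''z'', ''c'', ''x'', ''q''}"
abbreviation "fill_arrs \<equiv> {''L'', ''T'', ''C'', ''Q''}"

text \<open>\<open>s\<close> is the state after the sweep, so its \<open>L\<close> and
  \<open>''c''\<close> serve as \<open>L0\<close> and \<open>c0\<close> of
  \<open>filling\<close>.\<close>

definition fill_inv :: "ram_state \<Rightarrow> nat \<Rightarrow> ram_state \<Rightarrow> bool" where
  "fill_inv s k t \<longleftrightarrow> agree fill_vars fill_arrs s t \<and> arr t ''T'' = vsum (arr t ''L'') \<and>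
     filling (arr s ''L'') (var s ''c'') k (arr t ''L'') (var t ''c'') (arr t ''C'') (arr t ''Q'') (var t ''q'')"

lemma runs_fill:
  assumes pr: "prepared s" and C: "\<And>k. k < r \<Longrightarrow> arr s ''C'' (p ! k) = lc k" and q: "var s ''q'' = 0"
    and T: "arr s ''T'' = vsum (arr s ''L'')"
    and sw: "sweep (Suc r) (arr s ''L'') (var s ''c'') Z"
  shows "\<exists>s'. runs W n fill_cmd s s' \<and> fill_inv s m s'"
proof -
  have "\<exists>s'. runs W n (for_loop ''i'' (Var ''m'') fill_body) s s' \<and> fill_inv s m s' \<and> var s' ''i'' = m"
  proof (rule runs_for_loop, goal_cases)
    show "fill_inv s 0 (s\<lparr>var := (var s)(''i'' := 0)\<rparr>)"
      using T q filling_0[OF sw C, where Q = "arr s ''Q''"] by (simp add: fill_inv_def agree_def)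
  next
    case (2 k t)
    then have k: "k < m" and I: "fill_inv s k t" and vi: "var t ''i'' = k" by auto
    from I have ag: "agree fill_vars fill_arrs s t" and T: "arr t ''T'' = vsum (arr t ''L'')"
      and f: "filling (arr s ''L'') (var s ''c'') k (arr t ''L'') (var t ''c'') (arr t ''C'') (arr t ''Q'') (var t ''q'')"
      by (auto simp: fill_inv_def)
    have prt: "prepared t" by (rule prepared_agree[OF pr ag]) auto
    note P = preparedD[OF prt]
    have "safe W fill_body t \<and> var (sem fill_body t) ''i'' = k \<and> fill_inv s (Suc k) (sem fill_body t)"
    proof (cases "arr t ''L'' k = 0")
      case False
      then show ?thesis using filling_skip[OF f False] ag T vi
        by (simp add: fill_body_def fill_inv_def)
    next
      case L0: True
      from unlabelled_leg[OF sw f k L0] obtain j where j: "j < r" "k \<in> legs j" "stem k = p ! j" by blast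
      have S: "arr t ''S'' k = p ! j" using P(6)[OF k] j by simp
      have jW: "p ! j < W" "k < W" using X_n[OF j(1)] k m_n by (auto intro!: W_n)
      show ?thesis
      proof (cases "1 < arr t ''C'' (p ! j)")
        case True
        let ?c = "var t ''c''"
        note f' = filling_label[OF f k L0 j(1,2) True]
        have cm: "?c \<le> m" using filling_bounds(1)[OF sw f'] by simp
        let ?u = "t\<lparr>var := (var t)(''x'' := p ! j, ''e'' := k, ''z'' := ?c)\<rparr>"
        have bu: "base ?u" using P(1) unfolding base_def by simp
        let ?L = "(arr t ''L'')(k := ?c)"
        have lab: "sem label_cmd ?u = ?u\<lparr>arr := (arr ?u)(''L'' := ?L, ''T'' := vsum ?L)\<rparr>"
          using sem_label[OF bu k, of ?c] L0 T by simp
        have labs: "safe W label_cmd ?u"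
          using safe_label[OF bu k, of ?c] L0 T filling_bounds(2)[OF sw f] cm by simp
        have sem: "sem fill_body t = t\<lparr>var := (var t)(''x'' := p ! j, ''e'' := k, ''z'' := ?c, ''c'' := Suc ?c),
           arr := (arr t)(''L'' := ?L, ''T'' := vsum ?L, ''C'' := (arr t ''C'')(p ! j := arr t ''C'' (p ! j) - 1))\<rparr>"
          unfolding fill_body_def using L0 True lab by (simp add: vi S)
        have C_bound: "arr t ''C'' (p ! j) \<le> m"
        proof -
          have "arr t ''C'' (p ! j) = card {e \<in> legs j. arr t ''L'' e = 0}" by (rule fillingD(6)[OF f j(1,2) L0])
          also have "\<dots> \<le> card {..<m}" by (rule card_mono) (use legs_m in auto)
          finally show ?thesis by simp
        qed
        have W: "?c < W" "Suc ?c < W" "arr t ''C'' (p ! j) - 1 < W" using cm m_n C_bound by (auto intro!: W_n)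
        have safe: "safe W fill_body t"
          unfolding fill_body_def using L0 True lab labs W jW by (simp add: vi S)
        show ?thesis using safe f' ag unfolding sem fill_inv_def by (simp add: vi agree_def)
      next
        case False
        note f' = filling_queue[OF f k L0 j(1,2) False]
        have "Suc (var t ''q'') < W" using filling_queue_bound[OF f'] k m_n by (intro W_n) simp
        then have safe: "safe W fill_body t"
          unfolding fill_body_def using L0 False jW by (simp add: vi S)
        have sem: "sem fill_body t = t\<lparr>var := (var t)(''x'' := p ! j, ''q'' := Suc (var t ''q'')),
           arr := (arr t)(''Q'' := (arr t ''Q'')(var t ''q'' := k))\<rparr>"
          unfolding fill_body_def using L0 False by (simp add: vi S)
        show ?thesis using safe f' ag T unfolding sem fill_inv_def by (simp add: vi agree_def)
      qed
    qed
    moreover have "fill_inv s (Suc k) (u\<lparr>var := (var u)(''i'' := Suc k)\<rparr>)" if "fill_inv s (Suc k) u" for u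
      using that by (simp add: fill_inv_def agree_def)
    ultimately show ?case by blast
  next
    fix k t assume "fill_inv s k t"
    then have "agree fill_vars fill_arrs s t" by (simp add: fill_inv_def)
    from agree_var[OF this, of "''m''"] baseD(2)[OF preparedD(1)[OF pr]] show "aval (Var ''m'') t = m" by simp
  qed (use W_n m_n in auto)
  then show ?thesis unfolding fill_cmd_def by blast
qed

abbreviation "sort_vars \<equiv> {''i'', ''x'', ''a''}"
abbreviation "sort_arrs \<equiv> {''R'', ''O'', ''K'', ''J''}"

lemma runs_sort:
  assumes pr: "prepared s" and T: "arr s ''T'' = vsum L" and L: "\<And>e. e < m \<Longrightarrow> L e \<le> m"
    and q: "var s ''q'' = q" "q \<le> m" and Q: "bij_betw (arr s ''Q'') {..<q} F" "F \<subseteq> {..<m}"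
    and z: "\<And>v. arr s ''K'' v = 0" "\<And>v. arr s ''J'' v = 0"
  shows "\<exists>s'. runs W n sort_cmd s s' \<and> agree sort_vars sort_arrs s s' \<and> bij_betw (arr s' ''O'') {..<q} F \<and>
     (\<forall>t t'. t < t' \<longrightarrow> t' < q \<longrightarrow> vsum L (stem (arr s' ''O'' t)) \<le> vsum L (stem (arr s' ''O'' t')))"
proof -
  note P = preparedD[OF pr]
  let ?sort1 = "counting_sort ''Q'' ''R'' ''K'' (Mod (Read ''T'' (Read ''S'' (Var ''x''))) (Var ''n''))"
  let ?sort2 = "counting_sort ''R'' ''O'' ''J'' (Div (Read ''T'' (Read ''S'' (Var ''x''))) (Var ''n''))"
  define key where "key e = vsum L (arr s ''S'' e)" for e
  have n0: "0 < n" using n3 by simp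
  \<comment> \<open>This makes the upper digit \<open>key e div n\<close> a valid index of the
    counter array.\<close>
  have keyn: "key e < n * n" for e
    unfolding key_def by (rule le_less_trans[OF vsum_le mm_n]) (rule L)
  have Qm: "arr s ''Q'' i < m" if "i < q" for i using bij_betwE[OF Q(1)] Q(2) that by auto
  have qW: "q \<le> n" using q(2) m_n by simp
  then have qW': "q < W" by (rule W_n)
  have nW: "n < W" by (rule W_n) simp
  have mW: "x < W" if "x < m" for x by (rule W_n) (use that m_n in simp)
  have "\<exists>s'. runs W n ?sort1 s s' \<and>
     agree sort_vars {''R'', ''K''} s s' \<and>
     (\<exists>\<pi>. bij_betw \<pi> {..<q} {..<q} \<and> (\<forall>t<q. arr s' ''R'' t = arr s ''Q'' (\<pi> t)) \<and>
       (\<forall>t t'. t < t' \<and> t' < q \<longrightarrow> key (arr s ''Q'' (\<pi> t)) mod n < key (arr s ''Q'' (\<pi> t')) mod n \<or>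
          key (arr s ''Q'' (\<pi> t)) mod n = key (arr s ''Q'' (\<pi> t')) mod n \<and> \<pi> t < \<pi> t'))"
  proof (rule runs_counting_sort)
    fix s' assume ag: "agree sort_vars {''R'', ''K''} s s'"
    from agree_arr[OF this] agree_var[OF ag] baseD(1)[OF P(1)] T
    show "aval (Mod (Read ''T'' (Read ''S'' (Var ''x''))) (Var ''n'')) s' = key (var s' ''x'') mod n"
      by (simp add: key_def)
  qed (use q qW qW' nW mW Qm z n0 baseD(1)[OF P(1)] in auto)
  then obtain s1 \<pi> where r1: "runs W n ?sort1 s s1"
    and ag1: "agree sort_vars {''R'', ''K''} s s1" and \<pi>: "bij_betw \<pi> {..<q} {..<q}"
    and R: "\<And>t. t < q \<Longrightarrow> arr s1 ''R'' t = arr s ''Q'' (\<pi> t)"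
    and o1: "\<And>t t'. t < t' \<Longrightarrow> t' < q \<Longrightarrow> key (arr s ''Q'' (\<pi> t)) mod n \<le> key (arr s ''Q'' (\<pi> t')) mod n"
    by (metis less_imp_le order_refl)
  have \<pi>q: "\<pi> t < q" if "t < q" for t using bij_betwE[OF \<pi>] that by auto
  have s1: "var s1 ''q'' = q" "var s1 ''n'' = n" "arr s1 ''T'' = vsum L" "arr s1 ''S'' = arr s ''S''" "\<And>v. arr s1 ''J'' v = 0"
    using agree_arr[OF ag1] agree_var[OF ag1] q baseD(1)[OF P(1)] T z by auto
  have "\<exists>s'. runs W n ?sort2 s1 s' \<and>
     agree sort_vars {''O'', ''J''} s1 s' \<and>
     (\<exists>\<rho>. bij_betw \<rho> {..<q} {..<q} \<and> (\<forall>t<q. arr s' ''O'' t = arr s1 ''R'' (\<rho> t)) \<and>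
       (\<forall>t t'. t < t' \<and> t' < q \<longrightarrow> key (arr s1 ''R'' (\<rho> t)) div n < key (arr s1 ''R'' (\<rho> t')) div n \<or>
          key (arr s1 ''R'' (\<rho> t)) div n = key (arr s1 ''R'' (\<rho> t')) div n \<and> \<rho> t < \<rho> t'))"
  proof (rule runs_counting_sort)
    fix s' assume ag: "agree sort_vars {''O'', ''J''} s1 s'"
    from agree_arr[OF this] agree_var[OF ag] s1
    show "aval (Div (Read ''T'' (Read ''S'' (Var ''x''))) (Var ''n'')) s' = key (var s' ''x'') div n"
      by (simp add: key_def)
  next
    fix i show "key (arr s1 ''R'' i) div n < n" using keyn by (simp add: less_mult_imp_div_less)
  qed (use s1 qW qW' nW mW Qm R \<pi>q in auto)
  then obtain s2 \<rho> where r2: "runs W n ?sort2 s1 s2"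
    and ag2: "agree sort_vars {''O'', ''J''} s1 s2" and \<rho>: "bij_betw \<rho> {..<q} {..<q}"
    and O: "\<And>t. t < q \<Longrightarrow> arr s2 ''O'' t = arr s1 ''R'' (\<rho> t)"
    and o2: "\<And>t t'. t < t' \<Longrightarrow> t' < q \<Longrightarrow> key (arr s1 ''R'' (\<rho> t)) div n < key (arr s1 ''R'' (\<rho> t')) div n \<or>
          key (arr s1 ''R'' (\<rho> t)) div n = key (arr s1 ''R'' (\<rho> t')) div n \<and> \<rho> t < \<rho> t'" by blast
  have \<rho>q: "\<rho> t < q" if "t < q" for t using bij_betwE[OF \<rho>] that by auto
  have OQ: "arr s2 ''O'' t = arr s ''Q'' (\<pi> (\<rho> t))" if "t < q" for t using O[OF that] R[OF \<rho>q[OF that]] by simp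
  have "bij_betw (arr s ''Q'' \<circ> (\<pi> \<circ> \<rho>)) {..<q} F"
    by (rule bij_betw_trans[OF bij_betw_trans[OF \<rho> \<pi>] Q(1)])
  then have bij: "bij_betw (arr s2 ''O'') {..<q} F"
    using OQ by (subst bij_betw_cong[of _ _ "arr s ''Q'' \<circ> (\<pi> \<circ> \<rho>)"]) auto
  have key_le: "key (arr s2 ''O'' t) \<le> key (arr s2 ''O'' t')" if t: "t < t'" "t' < q" for t t'
  proof -
    let ?a = "key (arr s2 ''O'' t)" and ?b = "key (arr s2 ''O'' t')"
    \<comment> \<open>For equal upper digits stability gives \<open>\<rho> t < \<rho> t'\<close>,
      and the first pass has ordered the lower digits.\<close>
    have "?a div n < ?b div n \<or> ?a div n = ?b div n \<and> ?a mod n \<le> ?b mod n"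
      using o2[OF t] o1[of "\<rho> t" "\<rho> t'"] O R \<rho>q t by auto
    then show ?thesis
    proof
      assume "?a div n < ?b div n"
      then show ?thesis by (meson div_le_mono leI less_imp_le not_less)
    next
      assume "?a div n = ?b div n \<and> ?a mod n \<le> ?b mod n"
      then show ?thesis by (metis add_le_cancel_left div_mult_mod_eq)
    qed
  qed
  have "key (arr s2 ''O'' t) = vsum L (stem (arr s2 ''O'' t))" if "t < q" for t
    using P(6)[of "arr s2 ''O'' t"] OQ[OF that] Qm[OF \<pi>q[OF \<rho>q[OF that]]] by (simp add: key_def)
  then have "vsum L (stem (arr s2 ''O'' t)) \<le> vsum L (stem (arr s2 ''O'' t'))" if "t < t'" "t' < q" for t t'
    using key_le[OF that] that by simp
  moreover have "runs W n sort_cmd s s2" unfolding sort_cmd_def by (rule runs_Seq[OF r1 r2])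
  moreover have "agree sort_vars sort_arrs s s2" by (rule agree_mono_trans[OF ag1 ag2]) auto
  ultimately show ?thesis using bij by blast
qed

lemma runs_last:
  assumes pr: "prepared s" and T: "arr s ''T'' = vsum (arr s ''L'')" and q: "var s ''q'' = q"
    and fl: "final_labels n m r ei (\<lambda>k. p ! k) Ed stem L0 c0 S (arr s ''L'') (var s ''c'') C Q q (arr s ''O'')"
  shows "\<exists>s'. runs W n last_cmd s s' \<and> arr s' ''L'' = assign (arr s ''L'') (var s ''c'') (arr s ''O'') q"
proof -
  interpret fl: final_labels n m r ei "\<lambda>k. p ! k" Ed stem L0 c0 S "arr s ''L''" "var s ''c''" C Q q "arr s ''O''"
    by (rule fl)
  let ?A = "\<lambda>k. assign (arr s ''L'') (var s ''c'') (arr s ''O'') k"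
  define I where "I = (\<lambda>k t. agree {''i'', ''e'', ''z'', ''c''} {''L'', ''T''} s t \<and> var t ''c'' = var s ''c'' + k \<and>
     arr t ''L'' = ?A k \<and> arr t ''T'' = vsum (?A k))"
  have Om: "arr s ''O'' k < m \<and> arr s ''L'' (arr s ''O'' k) = 0" if "k < q" for k
    using fl.Q'_image that by blast
  have qm: "q \<le> m"
  proof -
    have "q = card {e. e < m \<and> arr s ''L'' e = 0}" using bij_betw_same_card[OF fl.Q'] by simp
    also have "\<dots> \<le> card {..<m}" by (rule card_mono) auto
    finally show ?thesis by simp
  qed
  have Am: "?A k e \<le> m" if "k \<le> q" "e < m" for k e
  proof (cases "e \<in> arr s ''O'' ` {..<k}")
    case False
    then show ?thesis using assign_other[OF False] filling_bounds(2)[OF fl.sweep fl.filling that(2)] by simp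
  next
    case True
    then obtain u where "u < k" "e = arr s ''O'' u" by auto
    then show ?thesis using assign_Q[OF fl.inj_Q' that(1)] fl.c_q that by simp
  qed
  have "\<exists>s'. runs W n (for_loop ''i'' (Var ''q'') last_body) s s' \<and> I q s' \<and> var s' ''i'' = q"
  proof (rule runs_for_loop, goal_cases)
    show "I 0 (s\<lparr>var := (var s)(''i'' := 0)\<rparr>)" using T by (simp add: I_def agree_def)
  next
    case (2 k t)
    then have k: "k < q" and I: "I k t" and vi: "var t ''i'' = k" by auto
    from I have ag: "agree {''i'', ''e'', ''z'', ''c''} {''L'', ''T''} s t" and c: "var t ''c'' = var s ''c'' + k"
      and L: "arr t ''L'' = ?A k" and Tt: "arr t ''T'' = vsum (?A k)" by (auto simp: I_def)
    have prt: "prepared t" by (rule prepared_agree[OF pr ag]) auto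
    have O: "arr t ''O'' = arr s ''O''" using agree_arr[OF ag] by simp
    let ?e = "arr s ''O'' k" and ?z = "var s ''c'' + k"
    have em: "?e < m" and Le: "arr s ''L'' ?e = 0" using Om[OF k] by auto
    have "?e \<notin> arr s ''O'' ` {..<k}"
    proof
      assume "?e \<in> arr s ''O'' ` {..<k}"
      then obtain u where "u < k" "?e = arr s ''O'' u" by auto
      then show False using inj_onD[OF fl.inj_Q', of k u] k by simp
    qed
    then have A0: "?A k ?e = 0" using assign_other Le by simp
    have zm: "?z \<le> m" using fl.c_q k by simp
    let ?u = "t\<lparr>var := (var t)(''e'' := ?e, ''z'' := ?z)\<rparr>"
    have bu: "base ?u" using preparedD(1)[OF prt] unfolding base_def by simp
    have lab: "sem label_cmd ?u = ?u\<lparr>arr := (arr ?u)(''L'' := ?A (Suc k), ''T'' := vsum (?A (Suc k)))\<rparr>"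
      using sem_label[OF bu em, of ?z] A0 L Tt by simp
    have labs: "safe W label_cmd ?u"
      using safe_label[OF bu em, of ?z] A0 L Tt Am[of k] k zm by simp
    have sem: "sem last_body t = t\<lparr>var := (var t)(''e'' := ?e, ''z'' := ?z, ''c'' := Suc ?z),
        arr := (arr t)(''L'' := ?A (Suc k), ''T'' := vsum (?A (Suc k)))\<rparr>"
      unfolding last_body_def using lab by (simp add: vi O c del: assign.simps)
    have "?e < W" "?z < W" "Suc ?z < W" using em m_n zm by (auto intro!: W_n)
    then have safe: "safe W last_body t"
      unfolding last_body_def using lab labs by (simp add: vi O c del: assign.simps)
    show ?case
      using safe ag unfolding sem by (simp add: I_def vi agree_def del: assign.simps)
  next
    fix k t assume "I k t"
    then have "agree {''i'', ''e'', ''z'', ''c''} {''L'', ''T''} s t" by (simp add: I_def)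
    from agree_var[OF this, of "''q''"] q show "aval (Var ''q'') t = q" by simp
  qed (use W_n qm m_n in auto)
  then show ?thesis unfolding last_cmd_def I_def by blast
qed

definition ready :: "ram_state \<Rightarrow> bool" where
  "ready s \<longleftrightarrow> prepared s \<and> var s ''c'' = 1 \<and> (\<forall>k<r. arr s ''C'' (p ! k) = lc k)"

lemma runs_label_program:
  assumes rd: "ready s" and q: "var s ''q'' = 0"
    and z: "\<And>a. a \<in> {''L'', ''T'', ''Z'', ''K'', ''J''} \<Longrightarrow> arr s a = (\<lambda>_. 0)"
  shows "\<exists>s'. runs W n label_program s s' \<and> bij_betw (arr s' ''L'') {..<m} {1..m} \<and> inj_on (vsum (arr s' ''L'')) {..<n}"
proof -
  from rd have pr: "prepared s" and C: "\<And>k. k < r \<Longrightarrow> arr s ''C'' (p ! k) = lc k" and c: "var s ''c'' = 1"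
    by (auto simp: ready_def)
  from runs_sweep[OF pr C c] z obtain s1 where r1: "runs W n sweep_cmd s s1" and I1: "sweep_inv s (Suc r) s1" by auto
  have ag1: "agree sweep_vars sweep_arrs s s1" and T1: "arr s1 ''T'' = vsum (arr s1 ''L'')"
    and sw: "sweep (Suc r) (arr s1 ''L'') (var s1 ''c'') (arr s1 ''Z'')" using I1 by (auto simp: sweep_inv_def)
  have pr1: "prepared s1" by (rule prepared_agree[OF pr ag1]) auto
  have C1: "arr s1 ''C'' (p ! k) = lc k" if "k < r" for k using agree_arr[OF ag1] C[OF that] by simp
  have q1: "var s1 ''q'' = 0" using agree_var[OF ag1] q by simp
  from runs_fill[OF pr1 C1 q1 T1 sw] obtain s2 where r2: "runs W n fill_cmd s1 s2" and I2: "fill_inv s1 m s2" by blast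
  have ag2: "agree fill_vars fill_arrs s1 s2" and T2: "arr s2 ''T'' = vsum (arr s2 ''L'')"
    and f: "filling (arr s1 ''L'') (var s1 ''c'') m (arr s2 ''L'') (var s2 ''c'') (arr s2 ''C'') (arr s2 ''Q'') (var s2 ''q'')"
    using I2 by (auto simp: fill_inv_def)
  have pr2: "prepared s2" by (rule prepared_agree[OF pr1 ag2]) auto
  have z2: "arr s2 ''K'' v = 0" "arr s2 ''J'' v = 0" for v
    using agree_arr[OF ag2] agree_arr[OF ag1] z by auto
  define q where "q = var s2 ''q''"
  have Q2: "bij_betw (arr s2 ''Q'') {..<q} {e. e < m \<and> arr s2 ''L'' e = 0}"
    using fillingD(7)[OF f] by (simp add: q_def)
  have qm: "q \<le> m" using filling_queue_bound[OF f] by (simp add: q_def)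
  have Fm: "{e. e < m \<and> arr s2 ''L'' e = 0} \<subseteq> {..<m}" by auto
  from runs_sort[OF pr2 T2 filling_bounds(2)[OF sw f] q_def[symmetric] qm Q2 Fm z2] obtain s3 where r3: "runs W n sort_cmd s2 s3" and ag3: "agree sort_vars sort_arrs s2 s3"
    and bij: "bij_betw (arr s3 ''O'') {..<q} {e. e < m \<and> arr s2 ''L'' e = 0}"
    and srt: "\<And>t t'. t < t' \<Longrightarrow> t' < q \<Longrightarrow> vsum (arr s2 ''L'') (stem (arr s3 ''O'' t)) \<le> vsum (arr s2 ''L'') (stem (arr s3 ''O'' t'))"
    by blast
  have pr3: "prepared s3" by (rule prepared_agree[OF pr2 ag3]) auto
  have s3: "arr s3 ''L'' = arr s2 ''L''" "arr s3 ''T'' = arr s2 ''T''" "var s3 ''c'' = var s2 ''c''" "var s3 ''q'' = q"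
    using agree_arr[OF ag3] agree_var[OF ag3] by (auto simp: q_def)
  have fl: "final_labels n m r ei (\<lambda>k. p ! k) Ed stem (arr s1 ''L'') (var s1 ''c'') (arr s1 ''Z'') (arr s3 ''L'') (var s3 ''c'')
      (arr s2 ''C'') (arr s2 ''Q'') q (arr s3 ''O'')"
    unfolding s3 by unfold_locales (use sw f bij srt in \<open>auto simp: q_def\<close>)
  have "arr s3 ''T'' = vsum (arr s3 ''L'')" using T2 s3 by simp
  from runs_last[OF pr3 this s3(4) fl] obtain s4 where r4: "runs W n last_cmd s3 s4"
    and L4: "arr s4 ''L'' = assign (arr s3 ''L'') (var s3 ''c'') (arr s3 ''O'') q" by blast
  interpret fl: final_labels n m r ei "\<lambda>k. p ! k" Ed stem "arr s1 ''L''" "var s1 ''c''" "arr s1 ''Z''" "arr s3 ''L''" "var s3 ''c''"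
      "arr s2 ''C''" "arr s2 ''Q''" q "arr s3 ''O''" by (rule fl)
  have "runs W n label_program s s4" unfolding label_program_def by (intro runs_Seq[OF r1] runs_Seq[OF r2] runs_Seq[OF r3] r4)
  then show ?thesis using fl.bij_Lf fl.inj_vsum unfolding fl.Lf_def L4[symmetric] by blast
qed

end

section \<open>Extending the spine to the path\<close>

context cat_spine
begin

text \<open>This covers the spine of one vertex, where both subtractions hit the same cell.\<close>

lemma ends_upd:
  fixes f :: "nat \<Rightarrow> nat" and a b :: nat
  assumes k: "k < r"
  defines "g \<equiv> f(p ! 0 := f (p ! 0) - a)"
  shows "(g(p ! (r - Suc 0) := g (p ! (r - Suc 0)) - b)) (p ! k) =
    f (p ! k) - (if k = 0 then a else 0) - (if Suc k = r then b else 0)"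
proof -
  have r: "r - Suc 0 < r" using r_pos by simp
  have g: "g (p ! k) = f (p ! k) - (if k = 0 then a else 0)" using p_eq[OF k r_pos] by (simp add: g_def)
  show ?thesis
  proof (cases "Suc k = r")
    case True
    then have "r - Suc 0 = k" by simp
    then show ?thesis using g True by simp
  next
    case False
    then have "p ! k \<noteq> p ! (r - Suc 0)" using p_eq[OF k r] k by simp
    then show ?thesis using g False by simp
  qed
qed

lemma runs_ends:
  assumes b: "base s" and cl: "classified m (arr s)" and r: "var s ''r'' = r"
    and X: "\<And>k. k < r \<Longrightarrow> arr s ''X'' k = p ! k" and P: "\<And>k. Suc k < r \<Longrightarrow> arr s ''P'' (Suc k) = se k"
  defines "a0 \<equiv> arr s ''A'' (p ! 0)" and "a1 \<equiv> arr s ''B'' (p ! (r - 1))"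
  shows "cat_path n E es p a0 a1"
    and "\<exists>s'. runs W n ends_cmd s s' \<and> agree {''x'', ''z'', ''b'', ''c''} {''P'', ''C'', ''H''} s s' \<and>
       cat_path.ready n es p a0 a1 s'" (is ?ends)
proof -
  have C: "arr s ''C'' = lcnt" using cl by (simp add: classified_def lcnt_def fun_eq_iff)
  have H: "arr s ''H'' = (\<lambda>v. \<Sum>j<m. if pend j \<and> stem j = v then j else 0)" using cl by (simp add: classified_def)
  have AB: "arr s ''A'' v < m \<and> pend (arr s ''A'' v) \<and> stem (arr s ''A'' v) = v \<and>
        arr s ''B'' v < m \<and> pend (arr s ''B'' v) \<and> stem (arr s ''B'' v) = v \<and> (1 < lcnt v \<longrightarrow> arr s ''A'' v \<noteq> arr s ''B'' v)"
    if "0 < lcnt v" for v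
    using cl that unfolding classified_def C by blast
  note e = lcnt_ends
  \<comment> \<open>For \<open>r = 1\<close> the common vertex has at least two pendant edges, so
    the first differs from the last.\<close>
  have ne: "a0 \<noteq> a1"
  proof (cases "r = 1")
    case True
    then show ?thesis using AB[OF e(1)] e(3) by (simp add: a0_def a1_def)
  next
    case False
    then have "p ! 0 \<noteq> p ! (r - 1)" using p_eq[of 0 "r - 1"] r_pos by auto
    then show ?thesis using AB[OF e(1)] AB[OF e(2)] by (auto simp: a0_def a1_def)
  qed
  show cp: "cat_path n E es p a0 a1"
    by unfold_locales (use AB[OF e(1)] AB[OF e(2)] ne in \<open>auto simp: a0_def a1_def\<close>)
  then interpret cp: cat_path n E es p a0 a1 .
  let ?x0 = "p ! 0" and ?x1 = "p ! (r - Suc 0)"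
  let ?C = "(arr s ''C'')(?x0 := arr s ''C'' ?x0 - 1)" and ?H = "(arr s ''H'')(?x0 := arr s ''H'' ?x0 - a0)"
  let ?C' = "?C(?x1 := ?C ?x1 - 1)" and ?H' = "?H(?x1 := ?H ?x1 - a1)"
  have X0: "arr s ''X'' 0 = ?x0" "arr s ''X'' (r - Suc 0) = ?x1" using X r_pos by auto
  have A: "arr s ''A'' ?x0 = a0" "arr s ''B'' ?x1 = a1" by (auto simp: a0_def a1_def)
  have sem: "sem ends_cmd s = s\<lparr>var := (var s)(''x'' := ?x1, ''z'' := a1, ''b'' := m - Suc r div 2, ''c'' := 1),
     arr := (arr s)(''P'' := (arr s ''P'')(0 := a0, r := a1), ''C'' := ?C', ''H'' := ?H')\<rparr>"
    unfolding ends_cmd_def using baseD(2)[OF b] r X0 A by (simp add: fun_upd_twist)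
  have xW: "?x0 < W" "?x1 < W" "a0 < W" "a1 < W" "m - Suc r div 2 < W" "1 < W"
    using p_nth(1)[OF r_pos] p_nth(1)[of "r - 1"] r_pos cp.a0 cp.a1 m_n n3 by (auto intro!: W_n)
  have CW: "arr s ''C'' v < W" "arr s ''H'' v < W" for v
    unfolding C H lcnt_def using m_n n3 by (auto intro!: W_bound trans_le_add1 sum_le_square)
  have CW': "arr s ''C'' v - x < W" "arr s ''H'' v - x < W" "arr s ''H'' v - x - y < W" for v x y
    using CW[of v] by (auto intro: less_imp_diff_less)
  have safe: "safe W ends_cmd s"
    unfolding ends_cmd_def using baseD(2)[OF b] r X0 A xW CW' by simp
  have "cp.prepared (sem ends_cmd s)"
    unfolding cp.prepared_def
  proof (intro conjI allI impI)
    show "base (sem ends_cmd s)" using b unfolding sem base_def by simp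
    show "var (sem ends_cmd s) ''r'' = r" "var (sem ends_cmd s) ''b'' = m - cp.nhigh"
      unfolding sem by (auto simp: r cp.nhigh_def)
    fix k assume k: "k < r"
    show "arr (sem ends_cmd s) ''X'' k = p ! k" unfolding sem using X[OF k] by simp
    assume l: "cp.lc k = 1"
    have "cp.leg k = sum id (cp.legs k)" using cp.leg_single[OF l] by simp
    then have "cp.leg k = arr s ''H'' (p ! k) - (if k = 0 then a0 else 0) - (if Suc k = r then a1 else 0)"
      using cp.lc_eq(2)[OF k] H by simp
    moreover have "?H' (p ! k) = arr s ''H'' (p ! k) - (if k = 0 then a0 else 0) - (if Suc k = r then a1 else 0)"
      by (rule ends_upd[OF k])
    ultimately show "arr (sem ends_cmd s) ''H'' (p ! k) = cp.leg k" unfolding sem by simp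
  next
    fix i assume "i \<le> r"
    then show "arr (sem ends_cmd s) ''P'' i = cp.Ed i"
    proof (cases rule: cp.Ed_cases)
      case (3 j)
      then show ?thesis unfolding sem using P[of j] by simp
    qed (use r_pos in \<open>auto simp: sem\<close>)
  next
    fix i assume "i < m"
    then show "arr (sem ends_cmd s) ''S'' i = stem i" unfolding sem using cl by (simp add: classified_def)
  qed
  moreover have "arr (sem ends_cmd s) ''C'' (p ! k) = cp.lc k" if k: "k < r" for k
  proof -
    have "?C' (p ! k) = arr s ''C'' (p ! k) - (if k = 0 then 1 else 0) - (if Suc k = r then 1 else 0)"
      by (rule ends_upd[OF k])
    then show ?thesis unfolding sem using cp.lc_eq(1)[OF k] C by simp
  qed
  moreover have "agree {''x'', ''z'', ''b'', ''c''} {''P'', ''C'', ''H''} s (sem ends_cmd s)"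
    unfolding sem by (simp add: agree_def)
  moreover have "var (sem ends_cmd s) ''c'' = 1" unfolding sem by simp
  ultimately show ?ends
    using runs_straight[OF safe, of n] unfolding cp.ready_def by (intro exI[of _ "sem ends_cmd s"]) blast
qed

end

section \<open>The complete program and the theorem\<close>

definition caterpillar_program :: com where
  "caterpillar_program = Seq degrees_cmd (Seq classify_cmd (Seq start_cmd (Seq walk_cmd (Seq ends_cmd label_program))))"

lemma (in cat_input) runs_program:
  "\<exists>s \<phi>. runs (n ^ 3) n caterpillar_program (input_state n es) s \<and>
    outputs_labeling es s \<phi> \<and> antimagic_labeling {..<n} E \<phi>"
proof -
  let ?s = "input_state n es"
  have b: "base ?s" by (simp add: base_def input_state_def m_def U_def V_def)
  have z0: "arr ?s a = (\<lambda>_. 0)" if "a \<notin> {''U'', ''V''}" for a using that by (auto simp: input_state_def)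
  have v0: "var ?s x = 0" if "x \<notin> {''n'', ''m''}" for x using that by (auto simp: input_state_def)
  obtain s1 where r1: "runs W n degrees_cmd ?s s1" and ag1: "agree {''i''} {''D''} ?s s1" and D1: "arr s1 ''D'' = deg"
    using runs_degrees[OF b] z0 by auto
  have b1: "base s1" using base_agree[OF b ag1] by simp
  have z1: "arr s1 a v = 0" if "a \<in> class_arrs" for a v using agree_arr[OF ag1, of a] z0[of a] that by auto
  obtain s2 where r2: "runs W n classify_cmd s1 s2" and ag2: "agree class_vars class_arrs s1 s2" and cl: "classified m (arr s2)"
    using runs_classify[OF b1 D1 z1] by blast
  have ag2': "agree {''i'', ''x''} ({''D''} \<union> class_arrs) ?s s2"
    by (rule agree_mono_trans[OF ag1 ag2]) auto
  have b2: "base s2" using base_agree[OF b ag2'] by simp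
  have "arr s2 ''D'' = deg" "arr s2 ''G'' = sdeg" "var s2 ''r'' = 0"
    using agree_arr[OF ag2] agree_var[OF ag2'] D1 cl v0 by (auto simp: classified_def sdeg_def fun_eq_iff)
  from runs_start[OF b2 this] obtain s3 p where r3: "runs W n start_cmd s2 s3" and ag3: "agree {''i'', ''r'', ''x''} {} s2 s3"
    and p: "spine p" and r3': "var s3 ''r'' = length p" and x3: "var s3 ''x'' = p ! 0" by blast
  interpret cat_spine n E es p by unfold_locales (rule p)
  have ag3': "agree {''i'', ''x'', ''r''} ({''D''} \<union> class_arrs) ?s s3"
    by (rule agree_mono_trans[OF ag2' ag3]) auto
  have b3: "base s3" using base_agree[OF b ag3'] by simp
  have arr3: "arr s3 = arr s2" using agree_arr[OF ag3] by auto
  have "arr s3 ''E'' = esum" using cl by (simp add: arr3 classified_def esum_def fun_eq_iff)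
  moreover have "var s3 ''y'' = 0" using agree_var[OF ag3'] v0 by simp
  ultimately obtain s4 where r4: "runs W n walk_cmd s3 s4" and ag4: "agree {''i'', ''x'', ''y'', ''z''} {''X'', ''P''} s3 s4"
    and X4: "\<And>k. k < r \<Longrightarrow> arr s4 ''X'' k = p ! k" and P4: "\<And>k. Suc k < r \<Longrightarrow> arr s4 ''P'' (Suc k) = se k"
    using runs_walk[OF b3 _ _ x3] r3' by (auto simp: r_def)
  have ag4': "agree {''i'', ''x'', ''r'', ''y'', ''z''} ({''D'', ''X'', ''P''} \<union> class_arrs) ?s s4"
    by (rule agree_mono_trans[OF ag3' ag4]) auto
  have b4: "base s4" using base_agree[OF b ag4'] by simp
  have cl4: "classified m (arr s4)" using cl agree_arr[OF ag4] unfolding classified_def arr3[symmetric] by simp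
  have r4': "var s4 ''r'' = r" using agree_var[OF ag4] r3' by (simp add: r_def)
  note ends = runs_ends[OF b4 cl4 r4' X4 P4]
  define a0 where "a0 = arr s4 ''A'' (p ! 0)"
  define a1 where "a1 = arr s4 ''B'' (p ! (r - 1))"
  from ends(1) interpret cat_path n E es p a0 a1 by (simp add: a0_def a1_def)
  from ends(2) obtain s5 where r5: "runs W n ends_cmd s4 s5" and ag5: "agree {''x'', ''z'', ''b'', ''c''} {''P'', ''C'', ''H''} s4 s5"
    and ready: "ready s5" by (auto simp: a0_def a1_def)
  have ag5': "agree {''i'', ''x'', ''r'', ''y'', ''z'', ''b'', ''c''} ({''D'', ''X'', ''P''} \<union> class_arrs) ?s s5"
    by (rule agree_mono_trans[OF ag4' ag5]) auto
  have "var s5 ''q'' = 0" using agree_var[OF ag5'] v0 by simp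
  moreover have "arr s5 a = (\<lambda>_. 0)" if "a \<in> {''L'', ''T'', ''Z'', ''K'', ''J''}" for a
    using agree_arr[OF ag5', of a] z0[of a] that by auto
  ultimately obtain s6 where r6: "runs W n label_program s5 s6"
    and L: "bij_betw (arr s6 ''L'') {..<m} {1..m}" "inj_on (vsum (arr s6 ''L'')) {..<n}"
    using runs_label_program[OF ready] by blast
  have "runs W n caterpillar_program ?s s6" unfolding caterpillar_program_def
    by (intro runs_Seq[OF r1] runs_Seq[OF r2] runs_Seq[OF r3] runs_Seq[OF r4] runs_Seq[OF r5] r6)
  moreover from labels_antimagic[OF L] obtain \<phi> where "\<forall>i<m. \<phi> (ei i) = arr s6 ''L'' i" "antimagic_labeling {..<n} E \<phi>"
    by blast
  ultimately show ?thesis unfolding outputs_labeling_def ei_edge m_def by blast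
qed

lemma caterpillar_graph_program:
  assumes "caterpillar_graph {..<n} E" "edge_list E es"
  shows "\<exists>t s \<phi>. exec (n ^ 3) caterpillar_program (input_state n es) t s \<and> t \<le> work caterpillar_program * Suc n \<and>
    outputs_labeling es s \<phi> \<and> antimagic_labeling {..<n} E \<phi>"
proof -
  interpret cat_input n E es by unfold_locales (fact assms)+
  from runs_program show ?thesis unfolding runs_def by blast
qed

text \<open>The copy on \<open>{..<card V}\<close> is fed to the program, and the labeling that it
  outputs is pulled back.\<close>

lemma caterpillar_graph_antimagic:
  assumes "caterpillar_graph V E"
  shows "antimagic V E"
proof -
  have simple: "simple_graph V E" and fin: "finite V" using assms by (auto simp: caterpillar_graph_def simple_graph_def)
  obtain h where h: "bij_betw h V {..<card V}" using ex_bij_betw_finite_nat[OF fin] by (auto simp: atLeast0LessThan)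
  then have inj: "inj_on h V" and im: "h ` V = {..<card V}" by (auto simp: bij_betw_def)
  have cat: "caterpillar_graph {..<card V} ((`) h ` E)"
    using caterpillar_graph_image[OF simple inj assms] by (simp add: im)
  then obtain es where "edge_list ((`) h ` E) es"
    using edge_list_exists by (auto simp: caterpillar_graph_def)
  from caterpillar_graph_program[OF cat this] obtain \<phi> where "antimagic_labeling (h ` V) ((`) h ` E) \<phi>"
    by (auto simp: im)
  from antimagic_labeling_pullback[OF simple inj this] show ?thesis unfolding antimagic_def by blast
qed

text \<open>The running time is linear; it fits the bound because \<open>ln n\<close> is at least 1
  from 3 on.\<close>

lemma linear_bigo: "(\<lambda>n. real (c * Suc n)) \<in> O(\<lambda>n. real n * ln (real n))"
proof (rule bigoI[of _ "2 * real c"], rule eventually_sequentiallyI[of 3])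
  fix n :: nat assume n: "3 \<le> n"
  have "exp 1 \<le> (3 :: real)" by (rule exp_le)
  then have "1 \<le> ln (real n)" using n by (subst ln_ge_iff) auto
  have "real c * (real n + 1) \<le> real c * (2 * real n)" using n by (intro mult_left_mono) auto
  then have "real (c * Suc n) \<le> 2 * real c * (real n * 1)" by (simp add: algebra_simps)
  also have "\<dots> \<le> 2 * real c * (real n * ln (real n))"
    using \<open>1 \<le> ln (real n)\<close> by (intro mult_left_mono) auto
  finally show "norm (real (c * Suc n)) \<le> 2 * real c * norm (real n * ln (real n))"
    using \<open>1 \<le> ln (real n)\<close> by simp
qed

theorem theorem1:
  shows "(\<forall>(V :: 'a set) E. caterpillar V E \<longrightarrow> antimagic V E) \<and>
    (\<exists>(prog :: com) (k :: nat) (T :: nat \<Rightarrow> real).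
       T \<in> O(\<lambda>n. real n * ln (real n)) \<and>
       (\<forall>n E es. caterpillar {..<n} E \<and> edge_list E es \<longrightarrow>
          (\<exists>t s \<phi>. exec (n ^ k) prog (input_state n es) t s \<and> real t \<le> T n \<and>
             outputs_labeling es s \<phi> \<and> antimagic_labeling {..<n} E \<phi>)))"
proof (intro conjI allI impI)
  show "antimagic V E" if "caterpillar V E" for V :: "'a set" and E
    using caterpillar_graph_antimagic[OF caterpillar_imp_graph[OF that]] .
  have "\<exists>t s \<phi>. exec (n ^ 3) caterpillar_program (input_state n es) t s \<and>
      real t \<le> real (work caterpillar_program * Suc n) \<and>
      outputs_labeling es s \<phi> \<and> antimagic_labeling {..<n} E \<phi>"
    if "caterpillar {..<n} E \<and> edge_list E es" for n E es
    using caterpillar_graph_program[OF caterpillar_imp_graph, of n E es] that of_nat_mono by blast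
  then show "\<exists>prog k T. T \<in> O(\<lambda>n. real n * ln (real n)) \<and>
       (\<forall>n E es. caterpillar {..<n} E \<and> edge_list E es \<longrightarrow>
          (\<exists>t s \<phi>. exec (n ^ k) prog (input_state n es) t s \<and> real t \<le> T n \<and>
             outputs_labeling es s \<phi> \<and> antimagic_labeling {..<n} E \<phi>))"
    using linear_bigo[of "work caterpillar_program"] by blast
qed

end
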